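(* Let $\mathbf s=\{s_j\}_{j\ge1}$ be a strictly increasing sequence with $s_1>0$ and $\lim_{j\to\infty}s_j=\infty$, and let $V_{j,k}=s_j\wedge s_k$, $j,k\in\mathbb N$. Let $f=Vh$, where $h\in\ell_1^+$ (which implies that $f_j=g(s_j)$, $j\ge1$, where $g$ is an increasing strictly concave function), and for $\alpha>0$ let $\widetilde Y_\alpha=\{\widetilde Y_{\alpha,j}\}_{j\in\mathbb N}$ be an $\alpha$-permanental sequence with kernel $\widetilde V_{j,k}=V_{j,k}+f_k$, $j,k\in\mathbb N$. Then $$\limsup_{j\to\infty}\frac{\widetilde Y_{\alpha,j}}{s_j\,\mathcal K_{\mathbf s}(j)}=1\quad\text{a.s.},\qquad\forall\,\alpha>0,$$ where $$\mathcal K_{\mathbf s}(j)=\log\Big(\sum_{i=1}^{j-1}1\wedge\log(s_{i+1}/s_i)\Big).$$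
   Context: $\mathbb N=\{1,2,\dots\}$; $\ell_1^+$ is the set of non-negative summable sequences; $a\wedge b=\min(a,b)$; $(Vh)_j=\sum_{k}V_{j,k}h_k$. "Increasing function" includes non-decreasing functions, and a concave function $g$ is called strictly concave when $\lim_{x\to\infty}g(x)/x=0$. Permanental sequences: for $\alpha>0$ and a matrix $K=\{K_{j,k}\}_{j,k\in\mathbb N}$, an $\alpha$-permanental sequence with kernel $K$ is a sequence $\{Z_j\}_{j\in\mathbb N}$ of non-negative random variables such that for all $n$, all distinct $i_1,\dots,i_n\in\mathbb N$ and all $t_1,\dots,t_n>0$, $E\exp(-\sum_{m=1}^n t_mZ_{i_m})=\det(I+K'T)^{-\alpha}$, where $K'=\{K_{i_p,i_q}\}_{p,q=1}^n$ and $T=\mathrm{diag}(t_1,\dots,t_n)$. For every $\alpha>0$ an $\alpha$-permanental sequence with kernel $\widetilde V$ exists, because $V$ is the strictly positive potential density of a symmetric transient Markov chain on $\mathbb N$ and $f$ is a finite excessive function for it. *)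

theory Defs
  imports "HOL-Probability.Probability" "Jordan_Normal_Form.Determinant"
begin

text \<open>
  Sequences and kernels indexed by $\{1,2,\dots\}$ are functions on \<^typ>\<open>nat\<close> whose values at
  index \<open>0\<close> are irrelevant: every definition below only inspects indices \<open>\<ge> 1\<close>.
\<close>

definition ell1_plus :: "(nat \<Rightarrow> real) set" where
  "ell1_plus = {h. (\<forall>k\<ge>1. 0 \<le> h k) \<and> h summable_on {1..}}"

definition kernel_apply :: "(nat \<Rightarrow> nat \<Rightarrow> real) \<Rightarrow> (nat \<Rightarrow> real) \<Rightarrow> nat \<Rightarrow> real" where
  "kernel_apply V h j = (\<Sum>\<^sub>\<infinity>k\<in>{1..}. V j k * h k)"

definition min_kernel :: "(nat \<Rightarrow> real) \<Rightarrow> nat \<Rightarrow> nat \<Rightarrow> real" where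
  "min_kernel s j k = min (s j) (s k)"

text \<open>
  The nonstandard meaning of strict concavity used here: concave with sublinear growth. The domain
  is taken to be \<open>[0, \<infinity>)\<close>.
\<close>

definition strictly_concave :: "(real \<Rightarrow> real) \<Rightarrow> bool" where
  "strictly_concave g \<longleftrightarrow> concave_on {0..} g \<and> ((\<lambda>x. g x / x) \<longlongrightarrow> 0) at_top"

text \<open>
  The distinct indices $i_1,\dots,i_n$ are \<open>i 0, \<dots>, i (n - 1)\<close>, and likewise for $t$. No separate
  condition that the determinant be positive is needed for \<open>powr\<close> to be the usual power: the left-hand
  side is positive while \<open>0 powr x = 0\<close>, so the determinant never vanishes; being a polynomial in
  $t$ that tends to $1$ as $t \to 0$, it is positive for all positive $t$.
\<close>

definition permanental_sequence ::
  "'a measure \<Rightarrow> real \<Rightarrow> (nat \<Rightarrow> nat \<Rightarrow> real) \<Rightarrow> (nat \<Rightarrow> 'a \<Rightarrow> real) \<Rightarrow> bool" where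
  "permanental_sequence M \<alpha> K Z \<longleftrightarrow>
     (\<forall>j\<ge>1. Z j \<in> borel_measurable M \<and> (\<forall>\<omega>\<in>space M. 0 \<le> Z j \<omega>)) \<and>
     (\<forall>n\<ge>1. \<forall>i t. inj_on i {..<n} \<and> (\<forall>m<n. 1 \<le> i m) \<and> (\<forall>m<n. 0 < t m) \<longrightarrow>
        (\<integral>\<omega>. exp (- (\<Sum>m<n. t m * Z (i m) \<omega>)) \<partial>M) =
        Determinant.det (1\<^sub>m n + Matrix.mat n n (\<lambda>(p, q). K (i p) (i q)) * mat_diag n t) powr (- \<alpha>))"

definition K_seq :: "(nat \<Rightarrow> real) \<Rightarrow> nat \<Rightarrow> real" where
  "K_seq s j = ln (\<Sum>i = 1..<j. min 1 (ln (s (Suc i) / s i)))"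

end

theory Submission
  imports Defs
begin

text \<open>
  Let \<open>K = V + 1 \<otimes> f\<close> be the kernel. On finitely many points the determinant factorises as
  \<open>det (I + V T) * (1 + \<Sum>\<^sub>k h\<^sub>k (1 - \<phi>\<^sub>k))\<close>, where \<open>h\<^sub>k \<ge> 0\<close> are the decrements of the slopes of the concave
  function \<open>g\<close> and \<open>\<phi>\<^sub>k\<close> is the Laplace transform of the local times of a path started at the point \<open>k\<close>.
  Expanding the power \<open>- \<alpha>\<close> by the negative binomial series exhibits the law of the permanental
  sequence as a mixture of laws of Markov chains of squared Bessel type with dimensions at least
  \<open>2 \<alpha>\<close>. Given the past, such a chain dominates an independent gamma variable with shape \<open>\<alpha>\<close> and scale the
  increment of \<open>s\<close>, which gives the lower bound along a sparse subsequence of indices. Moreover, the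
  conditional Laplace transform shows that the chain rarely drops far below a high level within
  a short time, so that the maximum over a block of indices is controlled by the last
  index of the block; there the marginal law is an explicit gamma law, and the Borel-Cantelli lemma
  gives the upper bound. The sum in \<open>K_seq\<close> counts the blocks up to bounded factors.
\<close>

section \<open>Laplace transforms, gamma laws and the squared Bessel kernel\<close>

text \<open>A permanental sequence is given only by its finite-dimensional Laplace transforms; its
  kernel need not be symmetric, and for general \<alpha> no Gaussian model or Markov property is
  available at the start. Yet both bounds need one step conditioned on an arbitrary past. The
  mixture supplies it: each component is Markov, and an inequality that holds for every shape
  parameter at least \<alpha> survives the averaging over components. Hence only facts uniform in
  the shape enter: the gamma distribution function decreases in the shape (lower bound), and (1 + t
  d) to the power -b is at most 1 (upper bound).

  The constant 1 is a matter of scales. A gamma variable of scale c exceeds c log N with probability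
  1/N up to powers of log N, and the logarithm of the number of blocks plays the part of log N. The
  upper bound sees the marginal scale s + f, where f = o(s) by sublinearity; the lower bound sees
  increments of s, which are nearly s itself once the chosen indices are sparse enough.\<close>

lemma laplace_unique:
  fixes \<mu> \<nu> :: "real measure"
  assumes sets: "sets \<mu> = sets borel" "sets \<nu> = sets borel"
    and "finite_measure \<mu>"
    and pos: "AE z in \<mu>. 0 \<le> z" "AE z in \<nu>. 0 \<le> z"
    and eq: "\<And>t. t > 0 \<Longrightarrow> (\<integral>\<^sup>+z. ennreal (exp (- t * z)) \<partial>\<mu>) = (\<integral>\<^sup>+z. ennreal (exp (- t * z)) \<partial>\<nu>)"
  shows "\<mu> = \<nu>"
proof -
  interpret m: finite_measure \<mu> by fact
  have [measurable_cong]: "sets \<nu> = sets borel" by fact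
  \<comment> \<open>Finiteness is assumed of \<mu> alone. Fatou's lemma along t = 1 / (n + 1) bounds
    the mass of \<nu> by that of \<mu>.\<close>
  have "(\<integral>\<^sup>+z. 1 \<partial>\<nu>) \<le> (\<integral>\<^sup>+z. liminf (\<lambda>n. ennreal (exp (- (1 / Suc n) * z))) \<partial>\<nu>)"
  proof (rule nn_integral_mono)
    fix z :: real
    have "(\<lambda>n. ennreal (exp (- (1 / Suc n) * z))) \<longlonglongrightarrow> ennreal (exp (- 0 * z))"
      by (intro tendsto_intros tendsto_ennrealI LIMSEQ_Suc[OF lim_1_over_n])
    then have "liminf (\<lambda>n. ennreal (exp (- (1 / Suc n) * z))) = 1"
      by (simp add: lim_imp_Liminf)
    then show "1 \<le> liminf (\<lambda>n. ennreal (exp (- (1 / Suc n) * z)))" by simp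
  qed
  also have "\<dots> \<le> liminf (\<lambda>n. \<integral>\<^sup>+z. ennreal (exp (- (1 / Suc n) * z)) \<partial>\<nu>)"
    by (rule nn_integral_liminf) simp
  also have "\<dots> = liminf (\<lambda>n. \<integral>\<^sup>+z. ennreal (exp (- (1 / Suc n) * z)) \<partial>\<mu>)"
    by (subst eq) auto
  also have "\<dots> \<le> liminf (\<lambda>n. emeasure \<mu> (space \<mu>))"
  proof (intro Liminf_mono always_eventually allI)
    fix n
    have "(\<integral>\<^sup>+z. ennreal (exp (- (1 / Suc n) * z)) \<partial>\<mu>) \<le> (\<integral>\<^sup>+z. 1 \<partial>\<mu>)"
      by (rule nn_integral_mono_AE) (use pos(1) in \<open>auto intro: ennreal_leI\<close>)
    then show "(\<integral>\<^sup>+z. ennreal (exp (- (1 / Suc n) * z)) \<partial>\<mu>) \<le> emeasure \<mu> (space \<mu>)" by simp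
  qed
  finally have "finite_measure \<nu>"
    by (intro finite_measureI) (auto simp: Liminf_const top_unique)
  with \<open>finite_measure \<mu>\<close> have fin: "finite_measure \<mu>" "finite_measure \<nu>" by auto
  interpret n: finite_measure \<nu> by fact
  note [measurable_cong] = sets
  have bint: "integrable \<kappa> (\<lambda>z. g (exp (- z)))"
    if \<kappa>: "\<kappa> = \<mu> \<or> \<kappa> = \<nu>" and g: "g \<in> borel_measurable borel" and B: "\<And>u. 0 \<le> u \<Longrightarrow> u \<le> 1 \<Longrightarrow> \<bar>g u\<bar> \<le> B"
    for \<kappa> and g :: "real \<Rightarrow> real" and B
  proof -
    note [measurable] = g
    have s: "sets \<kappa> = sets borel" and f: "finite_measure \<kappa>" and p: "AE z in \<kappa>. 0 \<le> z"
      using \<kappa> sets fin pos by auto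
    note [measurable_cong] = s
    show ?thesis
      by (rule finite_measure.integrable_const_bound[OF f, of _ B]) (use p B in auto)
  qed
  have expeq: "(\<integral>z. exp (- t * z) \<partial>\<mu>) = (\<integral>z. exp (- t * z) \<partial>\<nu>)" if "t > 0" for t
    by (subst (1 2) integral_eq_nn_integral) (use eq[OF that] in auto)
  \<comment> \<open>The constant polynomial needs t = 0, which the hypothesis excludes; it is
    recovered as a limit.\<close>
  have masseq: "(\<integral>z. 1 \<partial>\<mu>) = (\<integral>z. (1::real) \<partial>\<nu>)"
  proof -
    have lim: "(\<lambda>n. \<integral>z. exp (- (1 / Suc n) * z) \<partial>\<kappa>) \<longlonglongrightarrow> (\<integral>z. 1 \<partial>\<kappa>)" if \<kappa>: "\<kappa> = \<mu> \<or> \<kappa> = \<nu>" for \<kappa>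
    proof (rule integral_dominated_convergence[where w = "\<lambda>_. 1"])
      have s: "sets \<kappa> = sets borel" and f: "finite_measure \<kappa>" and p: "AE z in \<kappa>. 0 \<le> z"
        using \<kappa> sets fin pos by auto
      note [measurable_cong] = s
      show "integrable \<kappa> (\<lambda>_. 1::real)" using f by (simp add: finite_measure.integrable_const)
      show "AE z in \<kappa>. (\<lambda>n. exp (- (1 / Suc n) * z)) \<longlonglongrightarrow> 1"
      proof (rule AE_I2)
        fix z :: real
        have "(\<lambda>n. exp (- (1 / Suc n) * z)) \<longlonglongrightarrow> exp (- 0 * z)"
          by (intro tendsto_intros LIMSEQ_Suc[OF lim_1_over_n])
        then show "(\<lambda>n. exp (- (1 / Suc n) * z)) \<longlonglongrightarrow> 1" by simp
      qed
      show "AE x in \<kappa>. norm (exp (- (1 / real (Suc i)) * x)) \<le> 1" for i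
        using p by eventually_elim auto
    qed (use \<kappa> sets in \<open>auto cong: measurable_cong_sets\<close>)
    have e: "(\<integral>z. exp (- (1 / Suc n) * z) \<partial>\<mu>) = (\<integral>z. exp (- (1 / Suc n) * z) \<partial>\<nu>)" for n
      by (rule expeq) auto
    show ?thesis by (rule LIMSEQ_unique[OF lim[of \<mu>, unfolded e] lim[of \<nu>]]) auto
  qed
  \<comment> \<open>In the variable u = exp (- z) the transform at t = i is the i-th moment on
    [0, 1], so that Stone-Weierstrass reaches every continuous function of u.\<close>
  have poweq: "(\<integral>z. exp (- z) ^ i \<partial>\<mu>) = (\<integral>z. exp (- z) ^ i \<partial>\<nu>)" for i :: nat
  proof (cases "i = 0")
    case True then show ?thesis using masseq by simp
  next
    case False
    have *: "exp (- z) ^ i = exp (- real i * z)" for z :: real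
      by (simp add: exp_of_nat_mult[symmetric])
    show ?thesis unfolding * by (rule expeq) (use False in auto)
  qed
  have polyeq: "(\<integral>z. p (exp (- z)) \<partial>\<mu>) = (\<integral>z. p (exp (- z)) \<partial>\<nu>)" if p: "real_polynomial_function p" for p :: "real \<Rightarrow> real"
  proof -
    obtain a n where pa: "p = (\<lambda>x. \<Sum>i\<le>n. a i * x ^ i)" using p unfolding real_polynomial_function_iff_sum by auto
    have int: "integrable \<kappa> (\<lambda>z. a i * exp (- z) ^ i)" if "\<kappa> = \<mu> \<or> \<kappa> = \<nu>" for i \<kappa>
      by (rule bint[OF that, of "\<lambda>u. a i * u ^ i" "\<bar>a i\<bar>"])
         (auto simp: abs_mult power_abs intro!: mult_left_le power_le_one)
    show ?thesis unfolding pa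
      by (subst (1 2) Bochner_Integration.integral_sum) (use int poweq in auto)
  qed
  have conteq: "(\<integral>z. g (exp (- z)) \<partial>\<mu>) = (\<integral>z. g (exp (- z)) \<partial>\<nu>)" if g: "continuous_on UNIV g" for g :: "real \<Rightarrow> real"
  proof -
    have gm: "g \<in> borel_measurable borel" using g by (rule borel_measurable_continuous_onI)
    have "compact (g ` {0..1})" by (rule compact_continuous_image) (use g continuous_on_subset in auto)
    then obtain B where B: "\<And>u. 0 \<le> u \<Longrightarrow> u \<le> 1 \<Longrightarrow> \<bar>g u\<bar> \<le> B"
      using compact_imp_bounded bounded_iff by (metis atLeastAtMost_iff imageI real_norm_def)
    let ?C = "measure \<mu> (space \<mu>) + measure \<nu> (space \<nu>)"
    have "\<bar>(\<integral>z. g (exp (- z)) \<partial>\<mu>) - (\<integral>z. g (exp (- z)) \<partial>\<nu>)\<bar> \<le> e" if "e > 0" for e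
    proof -
      define \<epsilon> where "\<epsilon> = e / (?C + 1)"
      have C0: "?C + 1 > 0" by (simp add: add_nonneg_pos)
      have e0: "\<epsilon> > 0" using that C0 unfolding \<epsilon>_def by (rule divide_pos_pos)
      obtain p where p: "real_polynomial_function p" "\<And>x. x \<in> {0..1} \<Longrightarrow> \<bar>g x - p x\<bar> < \<epsilon>"
        using Stone_Weierstrass_real_polynomial_function[OF compact_Icc continuous_on_subset[OF g subset_UNIV] e0, of 0 1]
        by metis
      have pm: "p \<in> borel_measurable borel"
        using p(1) by (intro borel_measurable_continuous_onI continuous_on_polymonial_function)
          (simp add: real_polynomial_function_eq)
      have d: "\<bar>(\<integral>z. g (exp (- z)) \<partial>\<kappa>) - (\<integral>z. p (exp (- z)) \<partial>\<kappa>)\<bar> \<le> \<epsilon> * measure \<kappa> (space \<kappa>)"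
        if \<kappa>: "\<kappa> = \<mu> \<or> \<kappa> = \<nu>" for \<kappa>
      proof -
        have s: "sets \<kappa> = sets borel" and f: "finite_measure \<kappa>" and po: "AE z in \<kappa>. 0 \<le> z"
          using \<kappa> sets fin pos by auto
        interpret finite_measure \<kappa> by fact
        have ig: "integrable \<kappa> (\<lambda>z. g (exp (- z)))" using bint[OF \<kappa> gm B] .
        have ip: "integrable \<kappa> (\<lambda>z. p (exp (- z)))"
        proof (rule bint[OF \<kappa> pm])
          fix u :: real assume "0 \<le> u" "u \<le> 1"
          then show "\<bar>p u\<bar> \<le> B + \<epsilon>" using B[of u] p(2)[of u] by auto
        qed
        have "\<bar>(\<integral>z. g (exp (- z)) \<partial>\<kappa>) - (\<integral>z. p (exp (- z)) \<partial>\<kappa>)\<bar> = \<bar>\<integral>z. g (exp (- z)) - p (exp (- z)) \<partial>\<kappa>\<bar>"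
          using ig ip by simp
        also have "\<dots> \<le> (\<integral>z. \<bar>g (exp (- z)) - p (exp (- z))\<bar> \<partial>\<kappa>)" by (rule integral_abs_bound)
        also have "\<dots> \<le> (\<integral>z. \<epsilon> \<partial>\<kappa>)"
        proof (rule integral_mono_AE)
          show "AE z in \<kappa>. \<bar>g (exp (- z)) - p (exp (- z))\<bar> \<le> \<epsilon>"
            using po by eventually_elim (use p(2) in \<open>auto intro!: less_imp_le\<close>)
        qed (use ig ip in auto)
        finally show ?thesis by (simp add: mult.commute)
      qed
      have "\<bar>(\<integral>z. g (exp (- z)) \<partial>\<mu>) - (\<integral>z. g (exp (- z)) \<partial>\<nu>)\<bar> \<le> \<epsilon> * ?C"
        using d[of \<mu>] d[of \<nu>] polyeq[OF p(1)] by (simp add: algebra_simps)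
      also have "\<dots> \<le> \<epsilon> * (?C + 1)" using e0 by simp
      also have "\<dots> = e" unfolding \<epsilon>_def using C0 by auto
      finally show ?thesis .
    qed
    then have "\<bar>(\<integral>z. g (exp (- z)) \<partial>\<mu>) - (\<integral>z. g (exp (- z)) \<partial>\<nu>)\<bar> \<le> 0" by (rule field_le_epsilon) auto
    then show ?thesis by simp
  qed
  show ?thesis
  proof (rule measure_eqI_lessThan[OF sets])
    fix x :: real
    show "emeasure \<mu> {x<..} < \<infinity>" using m.emeasure_finite[of "{x<..}"] by (metis infinity_ennreal_def top.not_eq_extremum)
    \<comment> \<open>Continuous functions of u = exp (- z) that increase to the indicator of u <
      exp (- x), that is, of x < z.\<close>
    define g where "g n u = min 1 (real n * max 0 (exp (- x) - u))" for n u
    have gc: "continuous_on UNIV (g n)" for n unfolding g_def by (intro continuous_intros)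
    have lim: "(\<lambda>n. \<integral>z. g n (exp (- z)) \<partial>\<kappa>) \<longlonglongrightarrow> (\<integral>z. indicator {x<..} z \<partial>\<kappa>)" if \<kappa>: "\<kappa> = \<mu> \<or> \<kappa> = \<nu>" for \<kappa>
    proof (rule integral_dominated_convergence[where w = "\<lambda>_. 1"])
      have s: "sets \<kappa> = sets borel" and f: "finite_measure \<kappa>" using \<kappa> sets fin by auto
      note [measurable_cong] = s
      show "integrable \<kappa> (\<lambda>_. 1::real)" using f by (simp add: finite_measure.integrable_const)
      show "(\<lambda>z. g n (exp (- z))) \<in> borel_measurable \<kappa>" for n unfolding g_def by measurable
      show "indicat_real {x<..} \<in> borel_measurable \<kappa>" by measurable
      show "AE z in \<kappa>. (\<lambda>n. g n (exp (- z))) \<longlonglongrightarrow> indicator {x<..} z"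
      proof (rule AE_I2)
        fix z :: real
        show "(\<lambda>n. g n (exp (- z))) \<longlonglongrightarrow> indicator {x<..} z"
        proof (cases "x < z")
          case True
          then have c: "exp (- x) - exp (- z) > 0" by simp
          obtain N where N: "real N * (exp (- x) - exp (- z)) > 1" using ex_less_of_nat_mult[OF c] by auto
          have "g n (exp (- z)) = 1" if "n \<ge> N" for n
          proof -
            have "real N * (exp (- x) - exp (- z)) \<le> real n * (exp (- x) - exp (- z))"
              using that c by (intro mult_right_mono) auto
            then have "real n * (exp (- x) - exp (- z)) \<ge> 1" using N by linarith
            then show ?thesis using c unfolding g_def by (simp add: max_absorb2 min_absorb1)
          qed
          then have "eventually (\<lambda>n. g n (exp (- z)) = 1) sequentially" unfolding eventually_sequentially by auto
          then show ?thesis using True by (simp add: tendsto_eventually)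
        next
          case False then show ?thesis unfolding g_def by (simp add: max_def)
        qed
      qed
      show "AE z in \<kappa>. norm (g i (exp (- z))) \<le> 1" for i unfolding g_def by auto
    qed
    have "measure \<mu> {x<..} = measure \<nu> {x<..}"
    proof -
      have "(\<integral>z. indicat_real {x<..} z \<partial>\<mu>) = (\<integral>z. indicat_real {x<..} z \<partial>\<nu>)"
        by (rule LIMSEQ_unique[OF lim[of \<mu>, unfolded conteq[OF gc]] lim[of \<nu>]]) auto
      then show ?thesis using sets_eq_imp_space_eq[OF sets(1)] sets_eq_imp_space_eq[OF sets(2)] by simp
    qed
    then show "emeasure \<mu> {x<..} = emeasure \<nu> {x<..}"
      by (simp add: m.emeasure_eq_measure n.emeasure_eq_measure)
  qed
qed

definition gamma_dens :: "real \<Rightarrow> real \<Rightarrow> real \<Rightarrow> real" where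
  "gamma_dens b d z = (if z > 0 then z powr (b - 1) * exp (- z / d) / (d powr b * Gamma b) else 0)"

lemma gamma_dens_measurable [measurable]: "gamma_dens b d \<in> borel_measurable borel"
  unfolding gamma_dens_def[abs_def] by measurable

lemma gamma_dens_nonneg: "b > 0 \<Longrightarrow> d > 0 \<Longrightarrow> 0 \<le> gamma_dens b d z"
  unfolding gamma_dens_def by (auto intro!: divide_nonneg_nonneg mult_nonneg_nonneg Gamma_real_nonneg)

lemma gamma_dens_laplace:
  assumes b: "b > 0" and d: "d > 0" and t: "1 + t * d > 0"
  shows "(\<integral>\<^sup>+z. ennreal (gamma_dens b d z * exp (- t * z)) \<partial>lborel) = ennreal ((1 + t * d) powr (- b))"
proof -
  \<comment> \<open>With this c one has c (1/d + t) = 1, so z = c u turns the whole exponent into -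
    u.\<close>
  define c where "c = d / (1 + t * d)"
  have c: "c > 0" unfolding c_def using d t by simp
  have Gb: "Gamma b > 0" using b by (rule Gamma_real_pos)
  have "(\<integral>\<^sup>+z. ennreal (gamma_dens b d z * exp (- t * z)) \<partial>lborel)
     = ennreal c * (\<integral>\<^sup>+u. ennreal (gamma_dens b d (c * u) * exp (- t * (c * u))) \<partial>lborel)"
    by (subst nn_integral_real_affine[where c = c and t = 0]) (use c in auto)
  also have "(\<integral>\<^sup>+u. ennreal (gamma_dens b d (c * u) * exp (- t * (c * u))) \<partial>lborel) =
     (\<integral>\<^sup>+u. ennreal (c powr (b - 1) / (d powr b * Gamma b)) * ennreal (indicator {0..} u * u powr (b - 1) / exp u) \<partial>lborel)"
  proof (rule nn_integral_cong_AE)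
    have "AE u in lborel. u \<noteq> (0::real)" by (rule AE_lborel_singleton)
    then show "AE u in lborel. ennreal (gamma_dens b d (c * u) * exp (- t * (c * u))) =
      ennreal (c powr (b - 1) / (d powr b * Gamma b)) * ennreal (indicator {0..} u * u powr (b - 1) / exp u)"
    proof eventually_elim
      case (elim u)
      show ?case
      proof (cases "u > 0")
        case True
        have "c * (1 + t * d) = d" unfolding c_def using t by simp
        then have 1: "c / d + t * c = 1" using d by (simp add: field_simps)
        have "- (c * u) / d + - t * (c * u) = - (c / d + t * c) * u" by (simp add: algebra_simps)
        then have "- (c * u) / d + - t * (c * u) = - u" unfolding 1 by simp
        then have e: "exp (- (c * u) / d) * exp (- t * (c * u)) = exp (- u)" by (simp add: exp_add[symmetric])
        have "gamma_dens b d (c * u) * exp (- t * (c * u)) = c powr (b - 1) * u powr (b - 1) / (d powr b * Gamma b)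
            * (exp (- (c * u) / d) * exp (- t * (c * u)))"
          using True c unfolding gamma_dens_def by (simp add: powr_mult)
        also have "\<dots> = c powr (b - 1) / (d powr b * Gamma b) * (indicator {0..} u * u powr (b - 1) / exp u)"
          unfolding e using True by (simp add: exp_minus field_simps)
        finally show ?thesis using Gb by (simp add: ennreal_mult'[symmetric])
      next
        case False
        then have "\<not> c * u > 0" using c by (simp add: zero_less_mult_iff)
        then show ?thesis using False elim unfolding gamma_dens_def by simp
      qed
    qed
  qed
  also have "\<dots> = ennreal (c powr (b - 1) / (d powr b * Gamma b)) * ennreal (Gamma b)"
    using b by (subst nn_integral_cmult) (auto simp: Gamma_conv_nn_integral_real)
  also have "ennreal c * \<dots> = ennreal (c * (c powr (b - 1) / (d powr b * Gamma b)) * Gamma b)"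
    using c Gb by (simp add: ennreal_mult'[symmetric] mult.assoc)
  also have "c * (c powr (b - 1) / (d powr b * Gamma b)) * Gamma b = (c * c powr (b - 1)) / d powr b"
    using Gb by simp
  also have "c * c powr (b - 1) = c powr b" using c by (simp add: powr_mult_base)
  also have "c powr b / d powr b = (1 + t * d) powr (- b)"
  proof -
    have "c powr b / d powr b = (c / d) powr b" using c d by (simp add: powr_divide)
    also have "c / d = 1 / (1 + t * d)" unfolding c_def using d by simp
    also have "(1 / (1 + t * d)) powr b = (1 + t * d) powr (- b)" using t by (simp add: powr_divide powr_minus_divide)
    finally show ?thesis .
  qed
  finally show ?thesis .
qed

lemma gamma_dens_total:
  assumes "b > 0" "d > 0"
  shows "(\<integral>\<^sup>+z. ennreal (gamma_dens b d z) \<partial>lborel) = 1"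
  using gamma_dens_laplace[OF assms, of 0] by simp

definition gamma_cdf :: "real \<Rightarrow> real \<Rightarrow> real \<Rightarrow> ennreal" where
  "gamma_cdf b d c = (\<integral>\<^sup>+z. ennreal (gamma_dens b d z) * indicator {..c} z \<partial>lborel)"

lemma gamma_cdf_compl:
  assumes "b > 0" "d > 0"
  shows "gamma_cdf b d c + (\<integral>\<^sup>+z. ennreal (gamma_dens b d z) * indicator {c<..} z \<partial>lborel) = 1"
proof -
  have "gamma_cdf b d c + (\<integral>\<^sup>+z. ennreal (gamma_dens b d z) * indicator {c<..} z \<partial>lborel) =
    (\<integral>\<^sup>+z. ennreal (gamma_dens b d z) \<partial>lborel)"
    unfolding gamma_cdf_def
    by (subst nn_integral_add[symmetric]) (auto intro!: nn_integral_cong simp: indicator_def)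
  then show ?thesis using gamma_dens_total[OF assms] by simp
qed

text \<open>Monotone likelihood ratio: the quotient r of the densities increases in z. If r is at
  most 1 at c, the densities compare on {..c}; otherwise they compare the other way on {c<..}, and
  one passes to complements.\<close>

lemma gamma_cdf_antimono:
  assumes a: "a > 0" and b: "b \<ge> a" and d: "d > 0"
  shows "gamma_cdf b d c \<le> gamma_cdf a d c"
proof -
  have Ga: "Gamma a > 0" "Gamma b > 0" using a b by (auto intro!: Gamma_real_pos)
  define r where "r z = z powr (b - a) * (Gamma a * d powr a / (Gamma b * d powr b))" for z
  have rat: "gamma_dens b d z = r z * gamma_dens a d z" if "z > 0" for z
  proof -
    have "z powr (b - 1) = z powr (b - a) * z powr (a - 1)" using that by (simp add: powr_add[symmetric])
    then show ?thesis using that Ga d unfolding gamma_dens_def r_def by (simp add: field_simps)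
  qed
  have rm: "r x \<le> r y" if "0 < x" "x \<le> y" for x y
    unfolding r_def using that b Ga d by (intro mult_right_mono powr_mono2) auto
  show ?thesis
  proof (cases "c \<le> 0")
    case True
    then show ?thesis unfolding gamma_cdf_def
      by (intro nn_integral_mono) (auto simp: gamma_dens_def indicator_def)
  next
    case False
    show ?thesis
    proof (cases "r c \<le> 1")
      case True
      show ?thesis unfolding gamma_cdf_def
      proof (rule nn_integral_mono)
        fix z
        show "ennreal (gamma_dens b d z) * indicator {..c} z \<le> ennreal (gamma_dens a d z) * indicator {..c} z"
        proof (cases "0 < z \<and> z \<le> c")
          case z: True
          then have "r z \<le> 1" using rm[of z c] True by auto
          then have "gamma_dens b d z \<le> gamma_dens a d z"
            using rat[of z] z mult_right_mono[OF _ gamma_dens_nonneg[OF a d, of z], of "r z" 1] by simp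
          then show ?thesis using z by (auto intro: ennreal_leI)
        next
          case False then show ?thesis by (auto simp: gamma_dens_def indicator_def)
        qed
      qed
    next
      case rc: False
      let ?A = "\<integral>\<^sup>+z. ennreal (gamma_dens a d z) * indicator {c<..} z \<partial>lborel"
      let ?B = "\<integral>\<^sup>+z. ennreal (gamma_dens b d z) * indicator {c<..} z \<partial>lborel"
      have "?A \<le> ?B"
      proof (rule nn_integral_mono)
        fix z
        show "ennreal (gamma_dens a d z) * indicator {c<..} z \<le> ennreal (gamma_dens b d z) * indicator {c<..} z"
        proof (cases "c < z")
          case z: True
          then have "1 \<le> r z" using rm[of c z] rc False by auto
          then have "1 * gamma_dens a d z \<le> r z * gamma_dens a d z"
            using gamma_dens_nonneg[OF a d, of z] by (rule mult_right_mono)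
          then show ?thesis using z False rat[of z] by (auto intro: ennreal_leI)
        qed auto
      qed
            moreover have 1: "gamma_cdf a d c + ?A = 1" "gamma_cdf b d c + ?B = 1"
        using gamma_cdf_compl a b d by auto
      ultimately have le: "?A + gamma_cdf b d c \<le> ?A + gamma_cdf a d c"
        using add_left_mono[of ?A ?B "gamma_cdf b d c"] by (simp add: add.commute)
      have "?A \<le> 1" unfolding 1(1)[symmetric] by simp
      then have "?A \<noteq> \<infinity>" by (auto simp: top_unique)
      then show ?thesis using le by (simp add: ennreal_add_left_cancel_le)
    qed
  qed
qed

text \<open>The mass of the interval from c to c + d suffices. There u = z / d is at least 1, so u
  powr (a - 1) is at least 1 / u for every a > 0, and the surplus e in the exponent pays for that
  factor.\<close>

lemma gamma_tail_lower:
  assumes a: "a > 0" and d: "d > 0" and e: "e > 0" and c: "c \<ge> d"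
  shows "(\<integral>\<^sup>+z. ennreal (gamma_dens a d z) * indicator {c<..} z \<partial>lborel) \<ge>
    ennreal (min 1 e * exp (- 1) / Gamma a * exp (- (1 + e) * (c / d)))"
proof -
  define x where "x = c / d"
  have x: "x \<ge> 1" using c d by (simp add: x_def)
  have Ga: "Gamma a > 0" using a by (rule Gamma_real_pos)
  define m where "m = min 1 e * exp (- 1) / Gamma a * exp (- (1 + e) * x) / d"
  have m0: "m \<ge> 0" unfolding m_def using e Ga d by auto
  have lb: "m \<le> gamma_dens a d z" if z: "c < z" "z < c + d" for z
  proof -
    define u where "u = z / d"
    have u: "x < u" "u < x + 1" using z d by (auto simp: u_def x_def field_simps)
    have zu: "z = d * u" using d by (simp add: u_def)
    have E: "min 1 e * (1 + x) \<le> exp (e * x)"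
    proof -
      have "min 1 e * (1 + x) = min 1 e + min 1 e * x" by (simp add: algebra_simps)
      also have "\<dots> \<le> 1 + e * x" using x e by (intro add_mono mult_right_mono) auto
      also have "\<dots> \<le> exp (e * x)" by (rule exp_ge_add_one_self)
      finally show ?thesis .
    qed
    have "min 1 e * exp (- e * x) \<le> 1 / (1 + x)"
      using E x by (simp add: exp_minus field_simps)
    also have "\<dots> \<le> 1 / u" using u x by (intro divide_left_mono) auto
    also have "\<dots> = u powr (- 1)" using u x by (simp add: powr_minus divide_inverse)
    also have "\<dots> \<le> u powr (a - 1)" using u x a by (intro powr_mono) auto
    finally have 1: "min 1 e * exp (- e * x) \<le> u powr (a - 1)" .
    have 2: "exp (- 1) * exp (- x) \<le> exp (- u)" using u by (simp add: exp_add[symmetric])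
    have "m = (min 1 e * exp (- e * x)) * (exp (- 1) * exp (- x)) / (d * Gamma a)"
      unfolding m_def by (simp add: algebra_simps exp_add[symmetric] add_divide_distrib[symmetric])
    also have "\<dots> \<le> u powr (a - 1) * exp (- u) / (d * Gamma a)"
      using 1 2 d Ga e by (intro divide_right_mono mult_mono) auto
    also have "\<dots> = gamma_dens a d z"
    proof -
      have "d powr a = d * d powr (a - 1)" using d by (simp add: powr_mult_base)
      then show ?thesis using u x d Ga unfolding gamma_dens_def zu by (simp add: powr_mult zero_less_mult_iff)
    qed
    finally show ?thesis .
  qed
  have "ennreal (m * d) = (\<integral>\<^sup>+z. ennreal m * indicator {c<..<c + d} z \<partial>lborel)"
    using d m0 by (simp add: nn_integral_cmult_indicator ennreal_mult)
  also have "\<dots> \<le> (\<integral>\<^sup>+z. ennreal (gamma_dens a d z) * indicator {c<..} z \<partial>lborel)"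
    by (rule nn_integral_mono) (auto simp: indicator_def intro!: ennreal_leI lb)
  finally show ?thesis unfolding m_def x_def using d by simp
qed

text \<open>
  Transition density, over a time step \<open>d\<close>, of half a squared Bessel process of dimension \<open>2 b\<close>,
  written as a Poisson mixture of gamma densities. Negative starting points are treated as \<open>0\<close>.
\<close>

definition bessel_kernel :: "real \<Rightarrow> real \<Rightarrow> real \<Rightarrow> real \<Rightarrow> ennreal" where
  "bessel_kernel d b y z = (\<Sum>N. ennreal (exp (- (max 0 y / d)) * (max 0 y / d) ^ N / fact N) * ennreal (gamma_dens (b + real N) d z))"

lemma bessel_kernel_measurable [measurable]:
  assumes [measurable]: "f \<in> borel_measurable M" "g \<in> borel_measurable M"
  shows "(\<lambda>w. bessel_kernel d b (f w) (g w)) \<in> borel_measurable M"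
  unfolding bessel_kernel_def by measurable

lemma poisson_sums: "(\<lambda>N. exp (- x) * x ^ N / fact N * r ^ N) sums exp (- x + x * r)" for x r :: real
proof -
  have "(\<lambda>N. exp (- x) * ((x * r) ^ N /\<^sub>R fact N)) sums (exp (- x) * exp (x * r))"
    by (intro sums_mult exp_converges)
  moreover have "exp (- x) * ((x * r) ^ N /\<^sub>R fact N) = exp (- x) * x ^ N / fact N * r ^ N" for N
    by (simp add: power_mult_distrib divide_inverse)
  ultimately show ?thesis by (simp only: mult_exp_exp)
qed

text \<open>Each unit of the Poisson variable multiplies the transform by 1 / (1 + t d), and the
  Poisson generating function sums this up. The map from t to t / (1 + t d) is the one iterated in
  \<open>tau\<close>.\<close>

lemma bessel_kernel_laplace:
  assumes b: "b > 0" and d: "d > 0" and t: "t \<ge> 0" and y: "y \<ge> 0"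
  shows "(\<integral>\<^sup>+z. bessel_kernel d b y z * ennreal (exp (- t * z)) \<partial>lborel) =
    ennreal ((1 + t * d) powr (- b) * exp (- y * (t / (1 + t * d))))"
proof -
  define x where "x = y / d"
  have x0: "x \<ge> 0" using y d by (simp add: x_def)
  have td: "1 + t * d > 0" using t d by (simp add: add_pos_nonneg)
  define p where "p N = exp (- x) * x ^ N / fact N" for N :: nat
  have p0: "p N \<ge> 0" for N unfolding p_def using x0 by simp
  have "(\<integral>\<^sup>+z. bessel_kernel d b y z * ennreal (exp (- t * z)) \<partial>lborel) =
     (\<integral>\<^sup>+z. (\<Sum>N. ennreal (p N) * ennreal (gamma_dens (b + real N) d z * exp (- t * z))) \<partial>lborel)"
    unfolding bessel_kernel_def p_def x_def using y b d
    by (intro nn_integral_cong) (simp add: ennreal_suminf_multc[symmetric] ennreal_mult'' mult.assoc max_def)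
  also have "\<dots> = (\<Sum>N. ennreal (p N) * (\<integral>\<^sup>+z. ennreal (gamma_dens (b + real N) d z * exp (- t * z)) \<partial>lborel))"
    by (subst nn_integral_suminf) (auto simp: nn_integral_cmult)
  also have "\<dots> = (\<Sum>N. ennreal ((1 + t * d) powr (- b) * (p N * (1 / (1 + t * d)) ^ N)))"
  proof (rule suminf_cong)
    fix N
    have "(1 + t * d) powr (- (b + real N)) = (1 + t * d) powr (- b) * (1 / (1 + t * d)) ^ N"
      using td by (simp add: powr_add powr_minus powr_realpow divide_inverse power_inverse powr_diff minus_add_distrib)
    then show "ennreal (p N) * (\<integral>\<^sup>+z. ennreal (gamma_dens (b + real N) d z * exp (- t * z)) \<partial>lborel) =
      ennreal ((1 + t * d) powr (- b) * (p N * (1 / (1 + t * d)) ^ N))"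
      using b d td p0 by (subst gamma_dens_laplace) (auto simp: ennreal_mult'[symmetric] mult_ac)
  qed
  also have "\<dots> = ennreal ((1 + t * d) powr (- b) * exp (- x + x * (1 / (1 + t * d))))"
    by (intro suminf_ennreal_eq sums_mult) (use p0 td poisson_sums[of x "1 / (1 + t * d)"] in \<open>auto simp: p_def x0\<close>)
  also have "- x + x * (1 / (1 + t * d)) = - y * (t / (1 + t * d))"
  proof -
    have "1 - 1 / (1 + t * d) = t * d / (1 + t * d)" using td by (simp add: field_simps)
    then have "x * (1 - 1 / (1 + t * d)) = x * d * (t / (1 + t * d))" by simp
    moreover have "x * d = y" unfolding x_def using d by simp
    moreover have "- x + x * (1 / (1 + t * d)) = - (x * (1 - 1 / (1 + t * d)))" by (simp only: right_diff_distrib)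
    ultimately show ?thesis by simp
  qed
  finally show ?thesis .
qed

text \<open>Every Poisson component has shape b + N at least a, hence the bound by monotonicity in
  the shape. It is free of y and b, which makes it usable conditionally on the past.\<close>

lemma bessel_kernel_cdf_le:
  assumes a: "a > 0" and b: "b \<ge> a" and d: "d > 0"
  shows "(\<integral>\<^sup>+z. bessel_kernel d b y z * indicator {..c} z \<partial>lborel) \<le> gamma_cdf a d c"
proof -
  define x where "x = max 0 y / d"
  have x0: "x \<ge> 0" using d by (simp add: x_def)
  define p where "p N = exp (- x) * x ^ N / fact N" for N :: nat
  have p0: "p N \<ge> 0" for N unfolding p_def using x0 by simp
  have "(\<integral>\<^sup>+z. bessel_kernel d b y z * indicator {..c} z \<partial>lborel) =
     (\<integral>\<^sup>+z. (\<Sum>N. ennreal (p N) * (ennreal (gamma_dens (b + real N) d z) * indicator {..c} z)) \<partial>lborel)"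
    unfolding bessel_kernel_def p_def x_def
    by (intro nn_integral_cong) (simp add: ennreal_suminf_multc[symmetric] mult.assoc)
  also have "\<dots> = (\<Sum>N. ennreal (p N) * gamma_cdf (b + real N) d c)"
    unfolding gamma_cdf_def by (subst nn_integral_suminf) (auto simp: nn_integral_cmult)
  also have "\<dots> \<le> (\<Sum>N. ennreal (p N) * gamma_cdf a d c)"
    using a b d by (intro suminf_le mult_left_mono gamma_cdf_antimono summableI) auto
  also have "\<dots> = (\<Sum>N. ennreal (p N)) * gamma_cdf a d c" by simp
  also have "(\<Sum>N. ennreal (p N)) = ennreal (exp (- x + x * 1))"
    by (intro suminf_ennreal_eq) (use p0 poisson_sums[of x 1] in \<open>auto simp: p_def\<close>)
  finally show ?thesis by simp
qed

lemma bessel_kernel_total: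
  assumes "b > 0" "d > 0"
  shows "(\<integral>\<^sup>+z. bessel_kernel d b y z \<partial>lborel) = 1"
proof -
  have "(\<integral>\<^sup>+z. bessel_kernel d b y z \<partial>lborel) = (\<integral>\<^sup>+z. bessel_kernel d b (max 0 y) z * ennreal (exp (- 0 * z)) \<partial>lborel)"
    unfolding bessel_kernel_def by simp
  also have "\<dots> = 1" by (subst bessel_kernel_laplace[OF assms]) auto
  finally show ?thesis .
qed

lemma bessel_kernel_nonpos: "z \<le> 0 \<Longrightarrow> bessel_kernel d b y z = 0"
  unfolding bessel_kernel_def gamma_dens_def by simp

section \<open>The determinant of a rank one perturbation of the minimum kernel\<close>

text \<open>Subtracting row n - 1 from row n cancels the rank one part and leaves only -1 and 1 + t
  n * d n in the last two places. Adding a multiple of column n to column n - 1 clears the -1.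
  Expansion along the last row then gives a matrix of the same form, with t and b changed at n - 1
  only.\<close>

lemma det_min_kernel_step:
  fixes d t b :: "nat \<Rightarrow> real"
  defines "A \<equiv> \<lambda>n t b. Matrix.mat n n (\<lambda>(i, j). (if i = j then 1 else 0) + (\<Sum>k\<le>min i j. d k) * t j + b j)"
  assumes n: "n \<ge> 1" and nz: "1 + t n * d n \<noteq> 0"
  shows "Determinant.det (A (Suc n) t b) = (1 + t n * d n) *
    Determinant.det (A n (t(n - 1 := t (n - 1) + t n / (1 + t n * d n))) (b(n - 1 := b (n - 1) + b n / (1 + t n * d n))))"
proof -
  define c where "c = 1 / (1 + t n * d n)"
  let ?A = "A (Suc n) t b"
  define B where "B = addrow (- 1) n (n - 1) ?A"
  define C where "C = addcol c (n - 1) n B"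
  have cA: "?A \<in> carrier_mat (Suc n) (Suc n)" unfolding A_def by auto
  have cB: "B \<in> carrier_mat (Suc n) (Suc n)" unfolding B_def using cA by (auto simp: mat_addrow_def)
  have cC: "C \<in> carrier_mat (Suc n) (Suc n)" unfolding C_def using cB by (auto simp: mat_addcol_def)
  have dB: "Determinant.det B = Determinant.det ?A" unfolding B_def by (rule det_addrow[OF _ _ cA]) (use n in auto)
  have dC: "Determinant.det C = Determinant.det B" unfolding C_def by (rule det_addcol[OF _ _ cB]) (use n in auto)
  have Bidx: "B $$ (i, j) = (if i = n then (if j = n then 1 + t n * d n else if j = n - 1 then - 1 else 0)
       else (if i = j then 1 else 0) + (\<Sum>k\<le>min i j. d k) * t j + b j)" if "i \<le> n" "j \<le> n" for i j
  proof -
    have s: "(\<Sum>k\<le>n. d k) = (\<Sum>k\<le>n - 1. d k) + d n" using n by (cases n) auto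
    show ?thesis
    proof (cases "i = n")
      case False then show ?thesis using that unfolding B_def A_def by (auto simp: mat_addrow_def)
    next
      case True
      show ?thesis
      proof (cases "j = n")
        case True then show ?thesis using \<open>i = n\<close> n unfolding B_def A_def
          by (auto simp: mat_addrow_def s algebra_simps)
      next
        case False
        then have "min (n - 1) j = j" "min n j = j" using that by auto
        then show ?thesis using \<open>i = n\<close> False that n unfolding B_def A_def by (auto simp: mat_addrow_def)
      qed
    qed
  qed
  have Cidx: "C $$ (i, j) = (if j = n - 1 then c * B $$ (i, n) + B $$ (i, j) else B $$ (i, j))" if "i \<le> n" "j \<le> n" for i j
    using that cB unfolding C_def by (auto simp: mat_addcol_def)
  have Clast: "C $$ (n, j) = (if j = n then 1 + t n * d n else 0)" if "j \<le> n" for j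
    using that n nz by (auto simp: Cidx Bidx c_def)
  have "Determinant.det C = (\<Sum>j<Suc n. C $$ (n, j) * cofactor C n j)"
    by (rule laplace_expansion_row[OF cC]) auto
  also have "\<dots> = (1 + t n * d n) * cofactor C n n"
    using Clast by (simp add: sum.neutral)
  also have "cofactor C n n = Determinant.det (mat_delete C n n)" by (simp add: cofactor_def)
  also have "mat_delete C n n = A n (t(n - 1 := t (n - 1) + t n / (1 + t n * d n))) (b(n - 1 := b (n - 1) + b n / (1 + t n * d n)))"
    (is "_ = ?R")
  proof (rule eq_matI)
    fix i j assume "i < dim_row ?R" "j < dim_col ?R"
    then have ij: "i < n" "j < n" unfolding A_def by auto
    have "mat_delete C n n $$ (i, j) = C $$ (i, j)" using ij cC unfolding mat_delete_def by auto
    also have "\<dots> = ?R $$ (i, j)"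
    proof (cases "j = n - 1")
      case True
      then have "min i n = i" "min i j = i" using ij by auto
      then show ?thesis using ij True n unfolding A_def
        by (auto simp: Cidx Bidx c_def field_simps add_divide_distrib)
    next
      case False then show ?thesis using ij unfolding A_def by (auto simp: Cidx Bidx)
    qed
    finally show "mat_delete C n n $$ (i, j) = ?R $$ (i, j)" .
  qed (use cC in \<open>auto simp: A_def mat_delete_def\<close>)
  finally show ?thesis using dB dC by simp
qed

text \<open>The backward recursion for T records the entries of t as modified by successive
  eliminations from the last point downwards; the factors 1 + T j * d j are the pivots.\<close>

lemma det_min_kernel:
  fixes d t b T :: "nat \<Rightarrow> real"
  assumes "\<And>j. j < n \<Longrightarrow> T j = t j + T (Suc j) / (1 + T (Suc j) * d (Suc j))" and "T n = 0"
    and "\<And>j. j < n \<Longrightarrow> 1 + T j * d j \<noteq> 0"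
  shows "Determinant.det (Matrix.mat n n (\<lambda>(i, j). (if i = j then 1 else 0) + (\<Sum>k\<le>min i j. d k) * t j + b j)) =
    (\<Prod>j<n. 1 + T j * d j) * (1 + (\<Sum>q<n. b q / (\<Prod>j\<le>q. 1 + T j * d j)))"
  using assms
proof (induction n arbitrary: t b T)
  case 0 then show ?case by simp
next
  case (Suc n)
  have Tn: "T n = t n" using Suc.prems(1)[of n] Suc.prems(2) by simp
  show ?case
  proof (cases "n = 0")
    case True
    have "1 + d 0 * t 0 + b 0 = (1 + T 0 * d 0) * (1 + b 0 / (1 + T 0 * d 0))"
      using Suc.prems(3)[of 0] True Tn by (simp add: field_simps)
    then show ?thesis using True
      by (simp add: det_single)
  next
    case False
    define t' where "t' = t(n - 1 := t (n - 1) + t n / (1 + t n * d n))"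
    define b' where "b' = b(n - 1 := b (n - 1) + b n / (1 + t n * d n))"
    \<comment> \<open>The entry at n - 1 has already absorbed T n, so the recursion for the smaller
      matrix ends with the value 0 at n.\<close>
    define T' where "T' = T(n := 0)"
    have nz: "1 + t n * d n \<noteq> 0" using Suc.prems(3)[of n] Tn by simp
    have p: "(\<Prod>j\<le>n. 1 + T j * d j) = (\<Prod>j\<le>n - 1. 1 + T j * d j) * (1 + t n * d n)"
      using False Tn by (cases n) auto
    have "Determinant.det (Matrix.mat (Suc n) (Suc n) (\<lambda>(i, j). (if i = j then 1 else 0) + (\<Sum>k\<le>min i j. d k) * t j + b j)) =
      (1 + t n * d n) * Determinant.det (Matrix.mat n n (\<lambda>(i, j). (if i = j then 1 else 0) + (\<Sum>k\<le>min i j. d k) * t' j + b' j))"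
      unfolding t'_def b'_def using False by (intro det_min_kernel_step nz) auto
    also have "Determinant.det (Matrix.mat n n (\<lambda>(i, j). (if i = j then 1 else 0) + (\<Sum>k\<le>min i j. d k) * t' j + b' j)) =
       (\<Prod>j<n. 1 + T' j * d j) * (1 + (\<Sum>q<n. b' q / (\<Prod>j\<le>q. 1 + T' j * d j)))"
    proof (rule Suc.IH)
      fix j assume j: "j < n"
      show "T' j = t' j + T' (Suc j) / (1 + T' (Suc j) * d (Suc j))"
        using j Suc.prems(1)[of j] Tn unfolding T'_def t'_def by (cases "Suc j = n") auto
      show "1 + T' j * d j \<noteq> 0" using j Suc.prems(3)[of j] unfolding T'_def by auto
    qed (simp add: T'_def)
    also have "(\<Prod>j<n. 1 + T' j * d j) = (\<Prod>j<n. 1 + T j * d j)" unfolding T'_def by (intro prod.cong) auto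
    also have "(\<Sum>q<n. b' q / (\<Prod>j\<le>q. 1 + T' j * d j)) = (\<Sum>q<n. b' q / (\<Prod>j\<le>q. 1 + T j * d j))"
      unfolding T'_def by (intro sum.cong arg_cong2[of _ _ _ _ "(/)"] prod.cong) auto
    also have "\<dots> = (\<Sum>q<n. b q / (\<Prod>j\<le>q. 1 + T j * d j) + (if q = n - 1 then b n / (\<Prod>j\<le>n. 1 + T j * d j) else 0))"
      unfolding b'_def p using nz by (intro sum.cong) (auto simp: add_divide_distrib)
    also have "\<dots> = (\<Sum>q<Suc n. b q / (\<Prod>j\<le>q. 1 + T j * d j))"
      using False by (simp add: sum.distrib)
    finally show ?thesis using Tn by (simp add: mult_ac)
  qed
qed

text \<open>Let P q be the product of the pivots up to q. After exchanging the sums, the tail of t q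
  / P q from j on collapses to T j / P j by the recursion, and d j * T j / P j is the drop of 1 / P
  at j.\<close>

lemma slope_expansion:
  fixes d t T sg :: "nat \<Rightarrow> real"
  assumes T: "\<And>j. j < n \<Longrightarrow> T j = t j + T (Suc j) / (1 + T (Suc j) * d (Suc j))" "T n = 0"
    and nz: "\<And>j. j < n \<Longrightarrow> 1 + T j * d j \<noteq> 0"
  shows "(\<Sum>q<n. (\<Sum>j\<le>q. sg j * d j) * t q / (\<Prod>j\<le>q. 1 + T j * d j)) =
    (\<Sum>j<n. sg j * (1 / (\<Prod>i<j. 1 + T i * d i) - 1 / (\<Prod>i\<le>j. 1 + T i * d i)))"
proof -
  define P where "P q = (\<Prod>j\<le>q. 1 + T j * d j)" for q
  have PS: "P (Suc q) = P q * (1 + T (Suc q) * d (Suc q))" for q unfolding P_def by simp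
  have Pnz: "P q \<noteq> 0" if "q < n" for q unfolding P_def using nz that by auto
  have tail: "T j / P j = (\<Sum>q\<in>{j..<n}. t q / P q)" if "j \<le> n" for j
    using that
  proof (induction rule: inc_induct)
    case base then show ?case using T by simp
  next
    case (step j)
    have "T j / P j = t j / P j + T (Suc j) / (1 + T (Suc j) * d (Suc j)) / P j"
      using T(1)[OF step.hyps(2)] by (simp add: add_divide_distrib)
    also have "T (Suc j) / (1 + T (Suc j) * d (Suc j)) / P j = T (Suc j) / P (Suc j)" by (simp add: PS mult.commute)
    finally show ?case using step by (simp add: sum.atLeast_Suc_lessThan)
  qed
  have "(\<Sum>q<n. (\<Sum>j\<le>q. sg j * d j) * t q / P q) = (\<Sum>q<n. \<Sum>j\<le>q. sg j * d j * (t q / P q))"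
    by (simp add: sum_distrib_right sum_divide_distrib)
  also have "\<dots> = (\<Sum>j<n. \<Sum>q\<in>{j..<n}. sg j * d j * (t q / P q))"
    by (subst sum.Sigma, simp, simp, subst sum.Sigma, simp, simp,
        rule sum.reindex_bij_witness[where i="\<lambda>(a,b). (b,a)" and j="\<lambda>(a,b). (b,a)"]) auto
  also have "\<dots> = (\<Sum>j<n. sg j * d j * (T j / P j))" by (intro sum.cong refl) (simp add: tail sum_distrib_left)
  also have "\<dots> = (\<Sum>j<n. sg j * (1 / (\<Prod>i<j. 1 + T i * d i) - 1 / P j))"
  proof (intro sum.cong refl)
    fix j assume j: "j \<in> {..<n}"
    define X where "X = (\<Prod>i<j. 1 + T i * d i)"
    have PX: "P j = X * (1 + T j * d j)" unfolding X_def P_def lessThan_Suc_atMost[symmetric] by simp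
    have "X \<noteq> 0" "1 + T j * d j \<noteq> 0" using Pnz[of j] j by (auto simp: PX)
    then show "sg j * d j * (T j / P j) = sg j * (1 / (\<Prod>i<j. 1 + T i * d i) - 1 / P j)"
      unfolding PX X_def[symmetric] by (simp add: divide_simps)
  qed
  finally show ?thesis unfolding P_def .
qed

text \<open>Moves the differencing onto the slopes \<open>sg\<close>. For a concave function their
  decrements are nonnegative, so they can serve as mixture weights.\<close>

lemma abel_summation:
  fixes sg ps :: "nat \<Rightarrow> real"
  shows "(\<Sum>j<n. sg j * (ps j - ps (Suc j))) = sg 0 * ps 0 - (\<Sum>k<n. (sg k - sg (Suc k)) * ps (Suc k)) - sg n * ps n"
  by (induction n) (auto simp: algebra_simps)

section \<open>Mixtures of Markov chains\<close>

text \<open>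
  For the Markov chain started at \<open>0\<close> with transition densities \<open>bessel_kernel (d k) (b k)\<close>, this is
  the law of the state after \<open>k\<close> steps, weighted by the product of \<open>g m\<close> over the states visited so far.
\<close>

primrec weighted_chain :: "(nat \<Rightarrow> real) \<Rightarrow> (nat \<Rightarrow> real) \<Rightarrow> (nat \<Rightarrow> real \<Rightarrow> ennreal) \<Rightarrow> nat \<Rightarrow> real measure" where
  "weighted_chain d b g 0 = return borel 0"
| "weighted_chain d b g (Suc k) =
     density lborel (\<lambda>z. g k z * (\<integral>\<^sup>+y. bessel_kernel (d k) (b k) y z \<partial>weighted_chain d b g k))"

lemma weighted_chain_cong:
  "(\<And>m. m < k \<Longrightarrow> g m = g' m) \<Longrightarrow> weighted_chain d b g k = weighted_chain d b g' k"
  by (induction k) auto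

context
  fixes d b :: "nat \<Rightarrow> real" and g :: "nat \<Rightarrow> real \<Rightarrow> ennreal"
  assumes d: "\<And>k. d k > 0" and b: "\<And>k. b k > 0"
    and gm [measurable]: "\<And>k. g k \<in> borel_measurable borel" and g1: "\<And>k z. g k z \<le> 1"
begin

lemma sets_weighted_chain [measurable_cong]: "sets (weighted_chain d b g k) = sets borel"
  by (cases k) auto

lemma space_weighted_chain: "space (weighted_chain d b g k) = UNIV"
  using sets_eq_imp_space_eq[OF sets_weighted_chain] by simp

text \<open>The two claims need a joint induction: the mass bound uses measurability of the density,
  and measurability at the next step uses finiteness of the measure.\<close>

lemma weighted_chain_finite_props:
  "emeasure (weighted_chain d b g k) UNIV \<le> 1 \<and>
   (\<lambda>z. \<integral>\<^sup>+y. bessel_kernel (d k) (b k) y z \<partial>weighted_chain d b g k) \<in> borel_measurable borel"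
proof (induction k)
  case 0
  have "(\<lambda>z. \<integral>\<^sup>+y. bessel_kernel (d 0) (b 0) y z \<partial>return borel 0) = (\<lambda>z. bessel_kernel (d 0) (b 0) 0 z)"
    by (intro ext nn_integral_return) auto
  then show ?case by simp
next
  case (Suc k)
  let ?W = "weighted_chain d b g"
  have fk: "finite_measure (?W k)"
    by (rule finite_measureI) (use Suc in \<open>auto simp: space_weighted_chain top_unique\<close>)
  interpret k: finite_measure "?W k" by fact
  interpret kp: pair_sigma_finite "?W k" lborel ..
  note m = conjunct2[OF Suc]
  have "emeasure (?W (Suc k)) UNIV = (\<integral>\<^sup>+z. g k z * (\<integral>\<^sup>+y. bessel_kernel (d k) (b k) y z \<partial>?W k) \<partial>lborel)"
    using m by (simp add: emeasure_density)
  also have "\<dots> \<le> (\<integral>\<^sup>+z. (\<integral>\<^sup>+y. bessel_kernel (d k) (b k) y z \<partial>?W k) \<partial>lborel)"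
    using g1 by (intro nn_integral_mono) (metis mult_1 mult_right_mono zero_le)
  also have "\<dots> = (\<integral>\<^sup>+y. (\<integral>\<^sup>+z. bessel_kernel (d k) (b k) y z \<partial>lborel) \<partial>?W k)"
    by (rule kp.Fubini') measurable
  also have "\<dots> \<le> 1" using bessel_kernel_total[OF b d] Suc by (simp add: space_weighted_chain)
  finally have fin: "emeasure (?W (Suc k)) UNIV \<le> 1" .
  have "finite_measure (?W (Suc k))"
    by (rule finite_measureI) (use fin in \<open>auto simp only: space_weighted_chain infinity_ennreal_def top_unique ennreal_one_neq_top\<close>)
  then interpret Sk: finite_measure "?W (Suc k)" .
  have "(\<lambda>z. \<integral>\<^sup>+y. bessel_kernel (d (Suc k)) (b (Suc k)) y z \<partial>?W (Suc k)) \<in> borel_measurable borel"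
  proof (rule Sk.borel_measurable_nn_integral)
    have "(\<lambda>w. bessel_kernel (d (Suc k)) (b (Suc k)) (snd w) (fst w)) \<in> borel_measurable (borel \<Otimes>\<^sub>M borel)"
      by measurable
    then show "(\<lambda>(z, y). bessel_kernel (d (Suc k)) (b (Suc k)) y z) \<in> borel_measurable (borel \<Otimes>\<^sub>M ?W (Suc k))"
      using measurable_cong_sets[OF sets_pair_measure_cong[OF refl sets_weighted_chain] refl, of borel "Suc k" borel]
      by (simp add: split_beta')
  qed
  with fin show ?case by blast
qed

lemma finite_weighted_chain: "finite_measure (weighted_chain d b g k)"
  by (rule finite_measureI)
     (use weighted_chain_finite_props[of k] in \<open>auto simp: space_weighted_chain top_unique\<close>)

lemma bessel_chain_measurable [measurable]:
  "(\<lambda>z. \<integral>\<^sup>+y. bessel_kernel (d k) (b k) y z \<partial>weighted_chain d b g k) \<in> borel_measurable borel"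
  using weighted_chain_finite_props by blast

lemma weighted_chain_nonneg: "AE z in weighted_chain d b g k. 0 \<le> z"
proof (cases k)
  case 0
  have "AE z in return borel (0::real). 0 \<le> z" by (subst AE_return) auto
  then show ?thesis unfolding 0 weighted_chain.simps .
next
  case (Suc j)
  have "AE z in density lborel (\<lambda>z. g j z * (\<integral>\<^sup>+y. bessel_kernel (d j) (b j) y z \<partial>weighted_chain d b g j)). 0 \<le> z"
  proof (subst AE_density)
    show "AE z in lborel. 0 < g j z * (\<integral>\<^sup>+y. bessel_kernel (d j) (b j) y z \<partial>weighted_chain d b g j) \<longrightarrow> 0 \<le> z"
    proof (rule AE_I2, rule impI, rule ccontr)
      fix z :: real assume *: "0 < g j z * (\<integral>\<^sup>+y. bessel_kernel (d j) (b j) y z \<partial>weighted_chain d b g j)" "\<not> 0 \<le> z"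
      then have "z \<le> 0" by simp
      then have "bessel_kernel (d j) (b j) y z = 0" for y by (rule bessel_kernel_nonpos)
      with * show False by simp
    qed
  qed measurable
  then show ?thesis unfolding Suc weighted_chain.simps .
qed

lemma nn_integral_weighted_chain_Suc:
  assumes [measurable]: "F \<in> borel_measurable borel"
  shows "(\<integral>\<^sup>+z. F z \<partial>weighted_chain d b g (Suc k)) =
    (\<integral>\<^sup>+y. (\<integral>\<^sup>+z. bessel_kernel (d k) (b k) y z * (g k z * F z) \<partial>lborel) \<partial>weighted_chain d b g k)"
proof -
  interpret k: finite_measure "weighted_chain d b g k" by (rule finite_weighted_chain)
  interpret kp: pair_sigma_finite "weighted_chain d b g k" lborel ..
  have "(\<integral>\<^sup>+z. F z \<partial>weighted_chain d b g (Suc k)) =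
    (\<integral>\<^sup>+z. g k z * (\<integral>\<^sup>+y. bessel_kernel (d k) (b k) y z \<partial>weighted_chain d b g k) * F z \<partial>lborel)"
    by (simp add: nn_integral_density)
  also have "\<dots> = (\<integral>\<^sup>+z. (\<integral>\<^sup>+y. bessel_kernel (d k) (b k) y z * (g k z * F z) \<partial>weighted_chain d b g k) \<partial>lborel)"
    by (intro nn_integral_cong, subst nn_integral_multc) (measurable, simp add: mult_ac)
  also have "\<dots> = (\<integral>\<^sup>+y. (\<integral>\<^sup>+z. bessel_kernel (d k) (b k) y z * (g k z * F z) \<partial>lborel) \<partial>weighted_chain d b g k)"
    by (rule kp.Fubini') measurable
  finally show ?thesis .
qed

end

text \<open>
  In the joint Laplace transform of the chain at times \<open>0, \<dots>, n - 1\<close>, integrating out all coordinates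
  after \<open>m\<close> turns the argument \<open>t m\<close> of the coordinate \<open>m\<close> into \<open>tau d t m (n - m)\<close>.
\<close>

fun tau :: "(nat \<Rightarrow> real) \<Rightarrow> (nat \<Rightarrow> real) \<Rightarrow> nat \<Rightarrow> nat \<Rightarrow> real" where
  "tau d t m 0 = 0"
| "tau d t m (Suc k) = t m + tau d t (Suc m) k / (1 + tau d t (Suc m) k * d (Suc m))"

lemma tau_nonneg:
  assumes "\<And>m. d m > 0" "\<And>j. m \<le> j \<Longrightarrow> t j \<ge> 0"
  shows "tau d t m k \<ge> 0"
  using assms
proof (induction k arbitrary: m)
  case (Suc k)
  have "tau d t (Suc m) k \<ge> 0" by (rule Suc.IH) (use Suc.prems in auto)
  then show ?case using Suc.prems(1)[of "Suc m"] Suc.prems(2)[of m] by (auto intro!: add_nonneg_nonneg divide_nonneg_nonneg)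
qed simp

lemma tau_cong: "(\<And>j. m \<le> j \<Longrightarrow> t j = t' j) \<Longrightarrow> tau d t m k = tau d t' m k"
  by (induction k arbitrary: m) auto

text \<open>
  Only one-dimensional Laplace inversion is needed: the exponentials \<open>exp (- t m * Y m)\<close> are traded
  for \<open>g m (Y m)\<close> one coordinate at a time, starting with the first.
\<close>

lemma chain_representation:
  fixes Y :: "nat \<Rightarrow> 'a \<Rightarrow> real" and w :: "'i::countable \<Rightarrow> ennreal" and b :: "'i \<Rightarrow> nat \<Rightarrow> real"
  assumes M: "prob_space M" and Ym: "\<And>m. m < n \<Longrightarrow> Y m \<in> borel_measurable M"
    and Y0: "\<And>m \<omega>. m < n \<Longrightarrow> \<omega> \<in> space M \<Longrightarrow> 0 \<le> Y m \<omega>"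
    and d: "\<And>m. d m > 0" and b: "\<And>i m. b i m > 0"
    and L: "\<And>t. (\<And>m. t m > 0) \<Longrightarrow> (\<integral>\<^sup>+\<omega>. ennreal (exp (- (\<Sum>m<n. t m * Y m \<omega>))) \<partial>M) =
      (\<integral>\<^sup>+i. w i * (\<Prod>m<n. ennreal ((1 + tau d t m (n - m) * d m) powr (- b i m))) \<partial>count_space UNIV)"
    and g: "\<And>m. g m \<in> borel_measurable borel" and g1: "\<And>m z. g m z \<le> 1"
  shows "(\<integral>\<^sup>+\<omega>. (\<Prod>m<n. g m (Y m \<omega>)) \<partial>M) = (\<integral>\<^sup>+i. w i * emeasure (weighted_chain d (b i) g n) UNIV \<partial>count_space UNIV)"
proof -
  interpret prob_space M by fact
  note [measurable] = g
  let ?W = "\<lambda>i. weighted_chain d (b i) g"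
  note W = d b g g1
  note sW [measurable_cong] = sets_weighted_chain[OF d b g g1]
  \<comment> \<open>\<open>T t m\<close> is the exponent at coordinate m with the future integrated
    out; \<open>s t m\<close> is what it becomes when pulled back one step to the preceding state.
    \<open>C\<close> collects the factors that depend on the shapes.\<close>
  define T where "T t m = tau d t m (n - m)" for t m
  define s where "s t m = T t m / (1 + T t m * d m)" for t m
  define C where "C i t k = (\<Prod>m\<in>{k..<n}. ennreal ((1 + T t m * d m) powr (- b i m)))" for i t k
  have T0: "T t m \<ge> 0" if "\<And>j. t j > 0" for t m
    unfolding T_def using that d by (intro tau_nonneg) (auto intro: less_imp_le)
  have Ts: "T t m = t m + s t (Suc m)" if "m < n" for t m
  proof -
    have "n - m = Suc (n - Suc m)" using that by simp
    then show ?thesis unfolding s_def T_def by (simp only: tau.simps)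
  qed
  \<comment> \<open>A hybrid: coordinates below k carry g, the others still carry exponentials. The
    case k = 0 is L, the case k = n is the claim. \<open>?W i k\<close> is the law of the state just
    before coordinate k, since the chain has the extra initial state 0.\<close>
  have main: "(\<integral>\<^sup>+\<omega>. (\<Prod>m<k. g m (Y m \<omega>)) * ennreal (exp (- (\<Sum>m\<in>{k..<n}. t m * Y m \<omega>))) \<partial>M) =
     (\<integral>\<^sup>+i. w i * (C i t k * (\<integral>\<^sup>+y. ennreal (exp (- (s t k) * y)) \<partial>?W i k)) \<partial>count_space UNIV)"
    if "k \<le> n" "\<And>m. t m > 0" for k t
    using that
  proof (induction k arbitrary: t)
    case 0
    have "(\<integral>\<^sup>+y. ennreal (exp (- (s t 0) * y)) \<partial>?W i 0) = 1" for i
      unfolding weighted_chain.simps by (subst nn_integral_return) auto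
    then show ?case using L[OF 0(2)] by (simp add: C_def T_def atLeast0LessThan)
  next
    case (Suc k)
    then have kn: "k < n" by simp
    let ?q = "\<lambda>i y z. bessel_kernel (d k) (b i k) y z"
    define P where "P \<omega> = (\<Prod>m<k. g m (Y m \<omega>)) * ennreal (exp (- (\<Sum>m\<in>{Suc k..<n}. t m * Y m \<omega>)))" for \<omega>
    define R where "R z = (\<integral>\<^sup>+i. w i * (C i t (Suc k) * (ennreal (exp (- (s t (Suc k)) * z)) * (\<integral>\<^sup>+y. ?q i y z \<partial>?W i k))) \<partial>count_space UNIV)" for z
    have [measurable]: "(\<lambda>z. \<integral>\<^sup>+y. ?q i y z \<partial>?W i k) \<in> borel_measurable borel" for i
      by (rule bessel_chain_measurable[OF W])
    have [measurable]: "Y k \<in> borel_measurable M" using Ym kn .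
    have 1: "(\<lambda>\<omega>. \<Prod>m<k. g m (Y m \<omega>)) \<in> borel_measurable M"
      using Ym kn by (intro borel_measurable_prod_ennreal measurable_compose[OF _ g]) auto
    have "(\<lambda>\<omega>. \<Sum>m\<in>{Suc k..<n}. t m * Y m \<omega>) \<in> borel_measurable M"
      using Ym by (intro borel_measurable_sum borel_measurable_times) auto
    with 1 have Pm [measurable]: "P \<in> borel_measurable M"
      unfolding P_def by measurable
    have Rm [measurable]: "R \<in> borel_measurable borel"
      unfolding R_def
    proof (rule sigma_finite_measure.borel_measurable_nn_integral[OF sigma_finite_measure_count_space_countable])
      show "(\<lambda>(z, i). w i * (C i t (Suc k) * (ennreal (exp (- (s t (Suc k)) * z)) * (\<integral>\<^sup>+y. ?q i y z \<partial>?W i k))))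
        \<in> borel_measurable (borel \<Otimes>\<^sub>M count_space UNIV)"
        by (subst measurable_pair_swap_iff, rule measurable_pair_measure_countable1) auto
    qed auto
    \<comment> \<open>Fix everything except the exponent u of coordinate k. The two sides of the
      induction hypothesis, as functions of u, are the Laplace transforms of A and B. So A = B, and
      \<open>g k\<close> may be integrated in place of an exponential.\<close>
    define A where "A = distr (density M P) borel (Y k)"
    define B where "B = density lborel R"
    have nnA: "(\<integral>\<^sup>+z. G z \<partial>A) = (\<integral>\<^sup>+\<omega>. P \<omega> * G (Y k \<omega>) \<partial>M)" if [measurable]: "G \<in> borel_measurable borel" for G
      unfolding A_def by (simp add: nn_integral_distr nn_integral_density)
    have nnB: "(\<integral>\<^sup>+z. G z \<partial>B) = (\<integral>\<^sup>+i. w i * (C i t (Suc k) * (\<integral>\<^sup>+z. ennreal (exp (- (s t (Suc k)) * z)) * (\<integral>\<^sup>+y. ?q i y z \<partial>?W i k) * G z \<partial>lborel)) \<partial>count_space UNIV)"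
      if [measurable]: "G \<in> borel_measurable borel" for G
    proof -
      have "(\<integral>\<^sup>+z. G z \<partial>B) = (\<integral>\<^sup>+z. R z * G z \<partial>lborel)"
        unfolding B_def by (simp add: nn_integral_density)
      also have "\<dots> = (\<integral>\<^sup>+z. \<integral>\<^sup>+i. w i * (C i t (Suc k) * (ennreal (exp (- (s t (Suc k)) * z)) * (\<integral>\<^sup>+y. ?q i y z \<partial>?W i k) * G z)) \<partial>count_space UNIV \<partial>lborel)"
        unfolding R_def by (intro nn_integral_cong, subst nn_integral_multc[symmetric]) (auto simp: mult_ac)
      also have "\<dots> = (\<integral>\<^sup>+i. \<integral>\<^sup>+z. w i * (C i t (Suc k) * (ennreal (exp (- (s t (Suc k)) * z)) * (\<integral>\<^sup>+y. ?q i y z \<partial>?W i k) * G z)) \<partial>lborel \<partial>count_space UNIV)"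
        by (rule nn_integral_count_space_nn_integral) auto
      also have "\<dots> = (\<integral>\<^sup>+i. w i * (C i t (Suc k) * (\<integral>\<^sup>+z. ennreal (exp (- (s t (Suc k)) * z)) * (\<integral>\<^sup>+y. ?q i y z \<partial>?W i k) * G z \<partial>lborel)) \<partial>count_space UNIV)"
        by (intro nn_integral_cong) (simp add: nn_integral_cmult)
      finally show ?thesis .
    qed
    have "A = B"
    proof (rule laplace_unique)
      show "sets A = sets borel" "sets B = sets borel" unfolding A_def B_def by auto
      have P1: "P \<omega> \<le> 1" if "\<omega> \<in> space M" for \<omega>
      proof -
        have "(\<Prod>m<k. g m (Y m \<omega>)) \<le> 1" using g1 by (intro prod_le_1) auto
        moreover have "0 \<le> (\<Sum>m\<in>{Suc k..<n}. t m * Y m \<omega>)"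
          using Y0 Suc.prems(2) that by (intro sum_nonneg mult_nonneg_nonneg) (auto intro: less_imp_le)
        then have "ennreal (exp (- (\<Sum>m\<in>{Suc k..<n}. t m * Y m \<omega>))) \<le> 1"
          by (simp add: ennreal_le_1)
        ultimately show ?thesis unfolding P_def using mult_mono[of _ 1 _ 1] by fastforce
      qed
      have "emeasure A (space A) = (\<integral>\<^sup>+\<omega>. P \<omega> \<partial>M)" using nnA[of "\<lambda>_. 1"] by simp
      also have "\<dots> \<le> (\<integral>\<^sup>+\<omega>. 1 \<partial>M)" by (intro nn_integral_mono P1)
      also have "\<dots> = 1" using emeasure_space_1 by simp
      finally show "finite_measure A" by (intro finite_measureI) (auto simp: top_unique)
      show "AE z in A. 0 \<le> z" unfolding A_def
        by (subst AE_distr_iff) (auto simp: AE_density Y0 kn)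
      show "AE z in B. 0 \<le> z" unfolding B_def
      proof (subst AE_density)
        have "R z = 0" if "z < 0" for z
          using that bessel_kernel_nonpos[of z "d k"] unfolding R_def by simp
        then show "AE z in lborel. 0 < R z \<longrightarrow> 0 \<le> z" by (intro AE_I2) (metis leI less_irrefl)
      qed measurable
      fix u :: real assume u: "u > 0"
      define t' where "t' = t(k := u)"
      have t'0: "t' m > 0" for m using u Suc.prems unfolding t'_def by simp
      have Teq: "T t' m = T t m" if "Suc k \<le> m" for m
        unfolding T_def t'_def using that by (intro tau_cong) auto
      \<comment> \<open>Changing t at k leaves all later exponents alone. Hence u enters
        \<open>T t' k\<close> only as a summand, and the right-hand side is a Laplace transform in
        u.\<close>
      have seq: "s t' (Suc k) = s t (Suc k)" unfolding s_def by (simp add: Teq)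
      have Tk: "T t' k = u + s t (Suc k)" using Ts[OF kn, of t'] unfolding seq by (simp add: t'_def)
      have Ceq: "C i t' k = ennreal ((1 + T t' k * d k) powr (- b i k)) * C i t (Suc k)" for i
        unfolding C_def using kn by (subst prod.atLeast_Suc_lessThan) (auto simp: Teq intro!: prod.cong)
      have "(\<integral>\<^sup>+z. ennreal (exp (- u * z)) \<partial>A) = (\<integral>\<^sup>+\<omega>. (\<Prod>m<k. g m (Y m \<omega>)) * ennreal (exp (- (\<Sum>m\<in>{k..<n}. t' m * Y m \<omega>))) \<partial>M)"
      proof (subst nnA)
        have "(\<Sum>m\<in>{k..<n}. t' m * Y m \<omega>) = u * Y k \<omega> + (\<Sum>m\<in>{Suc k..<n}. t m * Y m \<omega>)" for \<omega>
          using kn by (subst sum.atLeast_Suc_lessThan) (auto simp: t'_def intro!: sum.cong)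
        then show "(\<integral>\<^sup>+ \<omega>. P \<omega> * ennreal (exp (- u * Y k \<omega>)) \<partial>M) = (\<integral>\<^sup>+\<omega>. (\<Prod>m<k. g m (Y m \<omega>)) * ennreal (exp (- (\<Sum>m\<in>{k..<n}. t' m * Y m \<omega>))) \<partial>M)"
          unfolding P_def by (simp add: exp_add exp_diff exp_minus divide_inverse ennreal_mult' mult_ac)
      qed measurable
      also have "\<dots> = (\<integral>\<^sup>+i. w i * (C i t' k * (\<integral>\<^sup>+y. ennreal (exp (- (s t' k) * y)) \<partial>?W i k)) \<partial>count_space UNIV)"
        by (rule Suc.IH) (use kn t'0 in auto)
      also have "\<dots> = (\<integral>\<^sup>+i. w i * (C i t (Suc k) * (\<integral>\<^sup>+y. \<integral>\<^sup>+z. ?q i y z * ennreal (exp (- (T t' k) * z)) \<partial>lborel \<partial>?W i k)) \<partial>count_space UNIV)"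
      proof (intro nn_integral_cong)
        fix i
        have "(\<integral>\<^sup>+y. \<integral>\<^sup>+z. ?q i y z * ennreal (exp (- (T t' k) * z)) \<partial>lborel \<partial>?W i k) =
          (\<integral>\<^sup>+y. ennreal ((1 + T t' k * d k) powr (- b i k)) * ennreal (exp (- (s t' k) * y)) \<partial>?W i k)"
        proof (rule nn_integral_cong_AE)
          show "AE y in ?W i k. (\<integral>\<^sup>+z. ?q i y z * ennreal (exp (- (T t' k) * z)) \<partial>lborel) =
             ennreal ((1 + T t' k * d k) powr (- b i k)) * ennreal (exp (- (s t' k) * y))"
            using weighted_chain_nonneg[OF W]
            by eventually_elim (subst bessel_kernel_laplace[OF b d T0[of t' k, OF t'0]], simp, simp add: ennreal_mult'' s_def mult.commute)
        qed
        also have "\<dots> = ennreal ((1 + T t' k * d k) powr (- b i k)) * (\<integral>\<^sup>+y. ennreal (exp (- (s t' k) * y)) \<partial>?W i k)"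
          by (rule nn_integral_cmult) measurable
        finally show "w i * (C i t' k * (\<integral>\<^sup>+y. ennreal (exp (- (s t' k) * y)) \<partial>?W i k)) =
           w i * (C i t (Suc k) * (\<integral>\<^sup>+y. \<integral>\<^sup>+z. ?q i y z * ennreal (exp (- (T t' k) * z)) \<partial>lborel \<partial>?W i k))"
          by (simp add: Ceq mult_ac)
      qed
      also have "\<dots> = (\<integral>\<^sup>+z. ennreal (exp (- u * z)) \<partial>B)"
      proof (subst nnB, measurable, intro nn_integral_cong arg_cong2[of _ _ _ _ "(*)"] refl)
        fix i
        interpret k: finite_measure "?W i k" by (rule finite_weighted_chain[OF W])
        interpret kp: pair_sigma_finite "?W i k" lborel ..
        have "(\<integral>\<^sup>+y. \<integral>\<^sup>+z. ?q i y z * ennreal (exp (- (T t' k) * z)) \<partial>lborel \<partial>?W i k) =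
           (\<integral>\<^sup>+z. \<integral>\<^sup>+y. ?q i y z * ennreal (exp (- (T t' k) * z)) \<partial>?W i k \<partial>lborel)"
          by (rule kp.Fubini'[symmetric]) measurable
        also have "\<dots> = (\<integral>\<^sup>+z. ennreal (exp (- (s t (Suc k)) * z)) * (\<integral>\<^sup>+y. ?q i y z \<partial>?W i k) * ennreal (exp (- u * z)) \<partial>lborel)"
        proof (rule nn_integral_cong)
          fix z :: real
          have "exp (- (T t' k) * z) = exp (- (s t (Suc k)) * z) * exp (- u * z)"
            unfolding mult_exp_exp by (simp add: Tk algebra_simps)
          then have "ennreal (exp (- (T t' k) * z)) = ennreal (exp (- (s t (Suc k)) * z)) * ennreal (exp (- u * z))"
            by (simp only: ennreal_mult' exp_ge_zero)
          then show "(\<integral>\<^sup>+y. ?q i y z * ennreal (exp (- (T t' k) * z)) \<partial>?W i k) =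
             ennreal (exp (- (s t (Suc k)) * z)) * (\<integral>\<^sup>+y. ?q i y z \<partial>?W i k) * ennreal (exp (- u * z))"
            by (subst nn_integral_multc) (measurable, simp only: mult_ac)
        qed
        finally show "(\<integral>\<^sup>+y. \<integral>\<^sup>+z. ?q i y z * ennreal (exp (- (T t' k) * z)) \<partial>lborel \<partial>?W i k) =
            (\<integral>\<^sup>+z. ennreal (exp (- (s t (Suc k)) * z)) * (\<integral>\<^sup>+y. ?q i y z \<partial>?W i k) * ennreal (exp (- u * z)) \<partial>lborel)" .
      qed
      finally show "(\<integral>\<^sup>+z. ennreal (exp (- u * z)) \<partial>A) = (\<integral>\<^sup>+z. ennreal (exp (- u * z)) \<partial>B)" .
    qed
    have "(\<integral>\<^sup>+\<omega>. (\<Prod>m<Suc k. g m (Y m \<omega>)) * ennreal (exp (- (\<Sum>m\<in>{Suc k..<n}. t m * Y m \<omega>))) \<partial>M) = (\<integral>\<^sup>+z. g k z \<partial>A)"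
      by (subst nnA) (auto simp: P_def mult_ac)
    also have "\<dots> = (\<integral>\<^sup>+z. g k z \<partial>B)" by (simp add: \<open>A = B\<close>)
    also have "\<dots> = (\<integral>\<^sup>+i. w i * (C i t (Suc k) * (\<integral>\<^sup>+z. ennreal (exp (- (s t (Suc k)) * z)) * (\<integral>\<^sup>+y. ?q i y z \<partial>?W i k) * g k z \<partial>lborel)) \<partial>count_space UNIV)"
      by (rule nnB) measurable
    also have "\<dots> = (\<integral>\<^sup>+i. w i * (C i t (Suc k) * (\<integral>\<^sup>+y. ennreal (exp (- (s t (Suc k)) * y)) \<partial>?W i (Suc k))) \<partial>count_space UNIV)"
      by (simp add: nn_integral_density mult_ac)
    finally show ?case .
  qed
  have "tau d t n 0 = 0" for t by simp
  then have "s (\<lambda>_. 1) n = 0" by (simp add: s_def T_def)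
  then show ?thesis using main[of n "\<lambda>_. 1"]
    by (simp add: C_def space_weighted_chain[OF W])
qed

lemma prod_mono_ennreal:
  fixes f g :: "'b \<Rightarrow> ennreal"
  shows "(\<And>i. i \<in> A \<Longrightarrow> f i \<le> g i) \<Longrightarrow> prod f A \<le> prod g A"
  by (induction A rule: infinite_finite_induct) (auto intro: mult_mono)

text \<open>A conditional inequality without conditional expectations: the weights g on the past are
  arbitrary. The bound \<open>le\<close> holds in every mixture component with the same c and H, so
  it can be integrated against the past and summed over i.\<close>

lemma chain_comparison:
  fixes Y :: "nat \<Rightarrow> 'a \<Rightarrow> real" and w :: "'i::countable \<Rightarrow> ennreal" and b :: "'i \<Rightarrow> nat \<Rightarrow> real"
  assumes M: "prob_space M" and Ym: "\<And>m. m \<le> Suc k \<Longrightarrow> Y m \<in> borel_measurable M"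
    and Y0: "\<And>m \<omega>. m \<le> Suc k \<Longrightarrow> \<omega> \<in> space M \<Longrightarrow> 0 \<le> Y m \<omega>"
    and d: "\<And>m. d m > 0" and b: "\<And>i m. b i m > 0"
    and L: "\<And>t. (\<And>m. t m > 0) \<Longrightarrow> (\<integral>\<^sup>+\<omega>. ennreal (exp (- (\<Sum>m<Suc (Suc k). t m * Y m \<omega>))) \<partial>M) =
      (\<integral>\<^sup>+i. w i * (\<Prod>m<Suc (Suc k). ennreal ((1 + tau d t m (Suc (Suc k) - m) * d m) powr (- b i m))) \<partial>count_space UNIV)"
    and g: "\<And>m. g m \<in> borel_measurable borel" and g1: "\<And>m z. g m z \<le> 1"
    and G: "G \<in> borel_measurable borel" "\<And>z. G z \<le> 1" and H: "H \<in> borel_measurable borel" "\<And>z. H z \<le> 1"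
    and le: "\<And>i y. y \<ge> 0 \<Longrightarrow> (\<integral>\<^sup>+z. bessel_kernel (d (Suc k)) (b i (Suc k)) y z * G z \<partial>lborel) \<le> c * H y"
  shows "(\<integral>\<^sup>+\<omega>. (\<Prod>m\<le>k. g m (Y m \<omega>)) * G (Y (Suc k) \<omega>) \<partial>M) \<le> c * (\<integral>\<^sup>+\<omega>. (\<Prod>m\<le>k. g m (Y m \<omega>)) * H (Y k \<omega>) \<partial>M)"
proof -
  let ?n = "Suc (Suc k)"
  define g1' where "g1' = g(Suc k := G)"
  \<comment> \<open>H is merged into the weight at k, and the last coordinate gets weight 1 and
    integrates out. Both sides then involve the same number of coordinates, hence the same weights
    w.\<close>
  define g2' where "g2' = g(k := (\<lambda>z. g k z * H z), Suc k := (\<lambda>_. 1))"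
  have g1'm: "\<And>m. g1' m \<in> borel_measurable borel" "\<And>m z. g1' m z \<le> 1"
    unfolding g1'_def using g g1 G by auto
  have gH: "g k z * H z \<le> 1" for z using mult_mono[OF g1[of k z] H(2)[of z]] by simp
  have g2'm: "\<And>m. g2' m \<in> borel_measurable borel" "\<And>m z. g2' m z \<le> 1"
    unfolding g2'_def using g g1 H gH by auto
  note rep = chain_representation[where n = ?n, OF M _ _ d b L]
  have e1: "weighted_chain d (b i) g1' (Suc k) = weighted_chain d (b i) g (Suc k)" for i
    by (rule weighted_chain_cong) (auto simp: g1'_def)
  have e2: "weighted_chain d (b i) g2' k = weighted_chain d (b i) g k" for i
    by (rule weighted_chain_cong) (auto simp: g2'_def)
  have tot: "emeasure (weighted_chain d (b i) g' ?n) UNIV =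
      (\<integral>\<^sup>+y. (\<integral>\<^sup>+z. bessel_kernel (d (Suc k)) (b i (Suc k)) y z * g' (Suc k) z \<partial>lborel) \<partial>weighted_chain d (b i) g' (Suc k))"
    if g': "\<And>m. g' m \<in> borel_measurable borel" "\<And>m z. g' m z \<le> 1" for g' i
    using nn_integral_weighted_chain_Suc[where d = d and b = "b i" and k = "Suc k" and F = "\<lambda>_. 1", OF d b g' borel_measurable_const]
      space_weighted_chain[where d = d and b = "b i" and k = ?n, OF d b g'] by (simp del: weighted_chain.simps)
  have "(\<integral>\<^sup>+\<omega>. (\<Prod>m\<le>k. g m (Y m \<omega>)) * G (Y (Suc k) \<omega>) \<partial>M) = (\<integral>\<^sup>+\<omega>. (\<Prod>m<?n. g1' m (Y m \<omega>)) \<partial>M)"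
    by (simp add: g1'_def lessThan_Suc_atMost)
  also have "\<dots> = (\<integral>\<^sup>+i. w i * emeasure (weighted_chain d (b i) g1' ?n) UNIV \<partial>count_space UNIV)"
    by (rule rep) (use Ym Y0 g1'm in auto)
  also have "\<dots> \<le> (\<integral>\<^sup>+i. c * (w i * emeasure (weighted_chain d (b i) g2' ?n) UNIV) \<partial>count_space UNIV)"
  proof (rule nn_integral_mono)
    fix i
    have [measurable_cong]: "sets (weighted_chain d (b i) g (Suc k)) = sets borel"
      "sets (weighted_chain d (b i) g2' (Suc k)) = sets borel"
      by auto
    have "emeasure (weighted_chain d (b i) g1' ?n) UNIV =
       (\<integral>\<^sup>+y. (\<integral>\<^sup>+z. bessel_kernel (d (Suc k)) (b i (Suc k)) y z * G z \<partial>lborel) \<partial>weighted_chain d (b i) g (Suc k))"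
      unfolding tot[OF g1'm] e1 by (simp add: g1'_def)
    also have "\<dots> \<le> (\<integral>\<^sup>+y. c * H y \<partial>weighted_chain d (b i) g (Suc k))"
      by (rule nn_integral_mono_AE)
         (use weighted_chain_nonneg[where d = d and b = "b i" and k = "Suc k", OF d b g g1] in \<open>eventually_elim, use le in auto\<close>)
    also have "\<dots> = c * (\<integral>\<^sup>+y. H y \<partial>weighted_chain d (b i) g (Suc k))"
      by (rule nn_integral_cmult) (use H(1) in measurable)
    also have "(\<integral>\<^sup>+y. H y \<partial>weighted_chain d (b i) g (Suc k)) = (\<integral>\<^sup>+y. 1 \<partial>weighted_chain d (b i) g2' (Suc k))"
      unfolding nn_integral_weighted_chain_Suc[where d = d and b = "b i", OF d b g g1 H(1)]
        nn_integral_weighted_chain_Suc[where d = d and b = "b i", OF d b g2'm borel_measurable_const] e2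
      by (simp add: g2'_def)
    also have "\<dots> = emeasure (weighted_chain d (b i) g2' ?n) UNIV"
    proof -
      have "g2' (Suc k) = (\<lambda>_. 1)" by (simp add: g2'_def)
      then show ?thesis unfolding tot[OF g2'm] by (simp only: mult_1_right bessel_kernel_total[OF b d])
    qed
    finally have "emeasure (weighted_chain d (b i) g1' ?n) UNIV \<le> c * emeasure (weighted_chain d (b i) g2' ?n) UNIV" .
    then show "w i * emeasure (weighted_chain d (b i) g1' ?n) UNIV \<le> c * (w i * emeasure (weighted_chain d (b i) g2' ?n) UNIV)"
      by (metis mult.left_commute mult_left_mono zero_le)
  qed
  also have "\<dots> = c * (\<integral>\<^sup>+i. w i * emeasure (weighted_chain d (b i) g2' ?n) UNIV \<partial>count_space UNIV)"
    by (rule nn_integral_cmult) auto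
  also have "(\<integral>\<^sup>+i. w i * emeasure (weighted_chain d (b i) g2' ?n) UNIV \<partial>count_space UNIV) = (\<integral>\<^sup>+\<omega>. (\<Prod>m<?n. g2' m (Y m \<omega>)) \<partial>M)"
    by (rule rep[symmetric]) (use Ym Y0 g2'm in auto)
  also have "\<dots> = (\<integral>\<^sup>+\<omega>. (\<Prod>m\<le>k. g m (Y m \<omega>)) * H (Y k \<omega>) \<partial>M)"
    by (simp add: g2'_def lessThan_Suc_atMost[symmetric] mult_ac)
  finally show ?thesis .
qed

section \<open>Expansion of the determinant power over lists of excursions\<close>

lemma sum_lists_prod_list:
  fixes F :: "'b \<Rightarrow> 'c::comm_semiring_1"
  assumes "finite A"
  shows "(\<Sum>xs | set xs \<subseteq> A \<and> length xs = m. prod_list (map F xs)) = (\<Sum>x\<in>A. F x) ^ m"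
proof (induction m)
  case 0
  have "{xs. set xs \<subseteq> A \<and> length xs = 0} = {[]}" by auto
  then show ?case by simp
next
  case (Suc m)
  let ?L = "{xs. set xs \<subseteq> A \<and> length xs = m}"
  have "(\<Sum>xs | set xs \<subseteq> A \<and> length xs = Suc m. prod_list (map F xs)) =
    (\<Sum>(xs, x)\<in>?L \<times> A. prod_list (map F (x # xs)))"
    unfolding lists_length_Suc_eq by (subst sum.reindex) (auto simp: inj_on_def split_beta')
  also have "\<dots> = (\<Sum>xs\<in>?L. \<Sum>x\<in>A. prod_list (map F (x # xs)))"
    by (rule sum.cartesian_product[symmetric])
  also have "\<dots> = (\<Sum>xs\<in>?L. prod_list (map F xs)) * (\<Sum>x\<in>A. F x)"
    by (simp add: sum_distrib_left sum_distrib_right mult.commute)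
  finally show ?case using Suc by (simp add: mult.commute)
qed

text \<open>Lists are sorted by their length m; the distributive law gives the m-th power. A list
  with an entry outside {..<n} contributes 0, so each length involves a finite sum.\<close>

lemma nn_integral_lists_prod_list:
  fixes F :: "nat \<Rightarrow> ennreal" and c :: "nat \<Rightarrow> ennreal"
  assumes F: "\<And>x. x \<ge> n \<Longrightarrow> F x = 0"
  shows "(\<integral>\<^sup>+xs. c (length xs) * prod_list (map F xs) \<partial>count_space UNIV) = (\<Sum>m. c m * (\<Sum>x<n. F x) ^ m)"
proof -
  have z: "prod_list (map F xs) = 0" if "\<not> set xs \<subseteq> {..<n}" for xs
  proof -
    obtain x where "x \<in> set xs" "x \<ge> n" using \<open>\<not> set xs \<subseteq> {..<n}\<close> by force
    then have "0 \<in> F ` set xs" using F[of x] by force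
    then show ?thesis by (induction xs) auto
  qed
  have "(\<integral>\<^sup>+xs. c (length xs) * prod_list (map F xs) \<partial>count_space UNIV) =
    (\<integral>\<^sup>+xs. (\<Sum>m. c m * prod_list (map F xs) * indicator {xs. length xs = m} xs) \<partial>count_space UNIV)"
  proof (rule nn_integral_cong)
    fix xs :: "nat list"
    have "(\<Sum>m. c m * prod_list (map F xs) * indicator {xs. length xs = m} xs) =
      (\<Sum>m\<in>{length xs}. c m * prod_list (map F xs) * indicator {xs. length xs = m} xs)"
      by (rule suminf_finite) auto
    then show "c (length xs) * prod_list (map F xs) = (\<Sum>m. c m * prod_list (map F xs) * indicator {xs. length xs = m} xs)" by simp
  qed
  also have "\<dots> = (\<Sum>m. \<integral>\<^sup>+xs. c m * prod_list (map F xs) * indicator {xs. length xs = m} xs \<partial>count_space UNIV)"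
    by (rule nn_integral_suminf) simp
  also have "\<dots> = (\<Sum>m. c m * (\<Sum>x<n. F x) ^ m)"
  proof (rule suminf_cong)
    fix m
    let ?L = "{xs. set xs \<subseteq> {..<n} \<and> length xs = m}"
    have "(\<integral>\<^sup>+xs. c m * prod_list (map F xs) * indicator {xs. length xs = m} xs \<partial>count_space UNIV) =
      (\<Sum>xs\<in>?L. c m * prod_list (map F xs) * indicator {xs. length xs = m} xs)"
      by (rule nn_integral_count_space') (use z in \<open>auto simp: finite_lists_length_eq\<close>)
    also have "\<dots> = c m * (\<Sum>xs\<in>?L. prod_list (map F xs))" by (simp add: sum_distrib_left)
    also have "(\<Sum>xs\<in>?L. prod_list (map F xs)) = (\<Sum>x<n. F x) ^ m" by (rule sum_lists_prod_list) simp
    finally show "(\<integral>\<^sup>+xs. c m * prod_list (map F xs) * indicator {xs. length xs = m} xs \<partial>count_space UNIV) = c m * (\<Sum>x<n. F x) ^ m" .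
  qed
  finally show ?thesis .
qed

text \<open>The binomial series is taken about 1 + H, not about 1, so that all coefficients of
  powers of X are nonnegative. At X = H the terms are the negative binomial probabilities, with sum
  1.\<close>

lemma negative_binomial_sums:
  fixes a H X :: real
  assumes a: "a > 0" and H: "H \<ge> 0" and X: "0 \<le> X" "X \<le> H"
  shows "(\<lambda>m. pochhammer a m / fact m * (1 + H) powr (- a - real m) * X ^ m) sums (1 + H - X) powr (- a)"
proof -
  have "(\<lambda>m. ((- a) gchoose m) * (1 + H) powr (- a - real m) * (- X) ^ m) sums (1 + H + - X) powr (- a)"
    by (rule gen_binomial_real'') (use X in auto)
  moreover have "((- a) gchoose m) * (1 + H) powr (- a - real m) * (- X) ^ m = pochhammer a m / fact m * (1 + H) powr (- a - real m) * X ^ m" for m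
  proof -
    have "(- X) ^ m = (- 1) ^ m * X ^ m" by (rule power_minus)
    moreover have "(- 1 :: real) ^ m * (- 1) ^ m = 1" by (simp add: power_mult_distrib[symmetric])
    ultimately show ?thesis by (simp add: gbinomial_pochhammer mult_ac)
  qed
  ultimately show ?thesis by simp
qed

text \<open>An entry x of the list raises the exponents at 0, ..., x by one and so contributes the
  factor 1 / (q 0 ... q x). For entries outside {..<n} both sides vanish.\<close>

lemma prod_list_chain_weights:
  fixes q hh :: "nat \<Rightarrow> real"
  assumes q: "\<And>m. q m > 0" and hh: "\<And>x. x \<ge> n \<Longrightarrow> hh x = 0"
  shows "prod_list (map hh xs) * (\<Prod>m<n. q m powr (- (a + real (length (filter (\<lambda>x. m \<le> x) xs))))) =
    (\<Prod>m<n. q m powr (- a)) * prod_list (map (\<lambda>x. hh x / (\<Prod>j\<le>x. q j)) xs)"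
proof (induction xs)
  case Nil then show ?case by simp
next
  case (Cons x xs)
  show ?case
  proof (cases "x < n")
    case False then show ?thesis using hh[of x] by simp
  next
    case True
    have "(\<Prod>m<n. q m powr (- (a + real (length (filter (\<lambda>y. m \<le> y) (x # xs)))))) =
      (\<Prod>m<n. q m powr (- (a + real (length (filter (\<lambda>y. m \<le> y) xs)))) * (if m \<in> {..x} then 1 / q m else 1))"
    proof (rule prod.cong[OF refl])
      fix m
      have qq: "q m powr (- (a + (1 + r))) = q m powr (- (a + r)) * (1 / q m)" for r
      proof -
        have "- (a + (1 + r)) = - (a + r) - 1" by simp
        then have "q m powr (- (a + (1 + r))) = q m powr (- (a + r)) / q m powr 1" by (simp only: powr_diff)
        then show ?thesis using q[of m] by simp
      qed
      show "q m powr (- (a + real (length (filter (\<lambda>y. m \<le> y) (x # xs))))) =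
         q m powr (- (a + real (length (filter (\<lambda>y. m \<le> y) xs)))) * (if m \<in> {..x} then 1 / q m else 1)"
      proof (cases "m \<le> x")
        case True
        then have "real (length (filter (\<lambda>y. m \<le> y) (x # xs))) = 1 + real (length (filter (\<lambda>y. m \<le> y) xs))" by simp
        then show ?thesis using True by (simp only: qq atMost_iff if_True)
      qed simp
    qed
    also have "\<dots> = (\<Prod>m<n. q m powr (- (a + real (length (filter (\<lambda>y. m \<le> y) xs))))) * (\<Prod>m<n. if m \<in> {..x} then 1 / q m else 1)"
      by (rule prod.distrib)
    also have "(\<Prod>m<n. if m \<in> {..x} then 1 / q m else 1) = (\<Prod>m\<in>{..<n} \<inter> {..x}. 1 / q m)"
      by (rule prod.inter_restrict[symmetric]) simp
    also have "{..<n} \<inter> {..x} = {..x}" using True by auto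
    also have "(\<Prod>m\<le>x. 1 / q m) = 1 / (\<Prod>m\<le>x. q m)" by (simp add: prod_dividef)
    finally have "prod_list (map hh (x # xs)) * (\<Prod>m<n. q m powr (- (a + real (length (filter (\<lambda>y. m \<le> y) (x # xs)))))) =
      (prod_list (map hh xs) * (\<Prod>m<n. q m powr (- (a + real (length (filter (\<lambda>y. m \<le> y) xs)))))) * (hh x / (\<Prod>m\<le>x. q m))"
      by simp
    then show ?thesis unfolding Cons by simp
  qed
qed

lemma prod_list_ennreal: "(\<And>x. F x \<ge> 0) \<Longrightarrow> prod_list (map (\<lambda>x. ennreal (F x)) xs) = ennreal (prod_list (map F xs)) \<and> prod_list (map F xs) \<ge> 0"
  by (induction xs) (auto simp: ennreal_mult)

text \<open>
  The list \<open>xs\<close> records the starting points of the additional excursions contributed by the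
  excessive function: an excursion started at \<open>x\<close> raises the shape parameter of the steps \<open>0, \<dots>, x\<close> by \<open>1\<close>.
  The number of excursions is negative binomial, and their starting points are weighted by the
  decrements of the slopes \<open>sg\<close>.
\<close>

lemma chain_laplace:
  fixes d t sg :: "nat \<Rightarrow> real" and a :: real
  assumes a: "a > 0" and d: "\<And>m. d m > 0" and sg: "\<And>m. sg m \<ge> 0" "\<And>m. sg (Suc m) \<le> sg m"
  obtains w :: "nat list \<Rightarrow> ennreal" and b :: "nat list \<Rightarrow> nat \<Rightarrow> real" where
    "\<And>xs m. b xs m \<ge> a"
    "\<And>t. (\<And>m. t m > 0) \<Longrightarrow>
      ennreal (Determinant.det (Matrix.mat (Suc k) (Suc k) (\<lambda>(i, j). (if i = j then 1 else 0) + (\<Sum>l\<le>min i j. d l) * t j + (\<Sum>l\<le>j. sg l * d l) * t j)) powr (- a)) =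
      (\<integral>\<^sup>+xs. w xs * (\<Prod>m<Suc k. ennreal ((1 + tau d t m (Suc k - m) * d m) powr (- b xs m))) \<partial>count_space UNIV)"
proof -
  let ?n = "Suc k"
  \<comment> \<open>The concave function is continued as a constant beyond the last point. The slope
    drops to 0 there, so the decrements add up to \<open>sg 0\<close> and the boundary term of the
    Abel summation disappears.\<close>
  define sg' where "sg' = sg(?n := 0)"
  define hh where "hh x = (if x < ?n then sg' x - sg' (Suc x) else 0)" for x
  define H where "H = sg 0"
  have hh0: "hh x \<ge> 0" for x using sg unfolding hh_def sg'_def by auto
  have hhH: "(\<Sum>x<?n. hh x) = H"
  proof -
    have "(\<Sum>x<?n. hh x) = (\<Sum>x<?n. sg' x - sg' (Suc x))" unfolding hh_def by (intro sum.cong) auto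
    also have "\<dots> = sg' 0 - sg' ?n" by (rule sum_lessThan_telescope')
    finally show ?thesis by (simp add: sg'_def H_def)
  qed
  have H0: "H \<ge> 0" unfolding H_def by (rule sg)
  define c where "c m = pochhammer a m / fact m * (1 + H) powr (- a - real m)" for m :: nat
  have c0: "c m \<ge> 0" for m unfolding c_def using a by (auto intro!: mult_nonneg_nonneg divide_nonneg_nonneg pochhammer_nonneg)
  define w where "w xs = ennreal (c (length xs) * prod_list (map hh xs))" for xs
  define b where "b xs m = a + real (length (filter (\<lambda>x. m \<le> x) xs))" for xs :: "nat list" and m
  show ?thesis
  proof (rule that)
    show "b xs m \<ge> a" for xs m unfolding b_def by simp
    fix t :: "nat \<Rightarrow> real" assume t: "\<And>m. t m > 0"
    define T where "T m = tau d t m (?n - m)" for m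
    define q where "q m = 1 + T m * d m" for m
    have T0: "T m \<ge> 0" for m unfolding T_def using t d by (intro tau_nonneg) (auto intro: less_imp_le)
    have q1: "q m \<ge> 1" for m unfolding q_def using T0[of m] d[of m] by auto
    have q0: "q m > 0" for m using q1[of m] by linarith
    have Trec: "T j = t j + T (Suc j) / (1 + T (Suc j) * d (Suc j))" if "j < ?n" for j
    proof -
      have "?n - j = Suc (?n - Suc j)" using that by simp
      then show ?thesis unfolding T_def by (simp only: tau.simps)
    qed
    have Tn: "T ?n = 0" unfolding T_def by simp
    have qne: "1 + T j * d j \<noteq> 0" for j using q0[of j] unfolding q_def by simp
    \<comment> \<open>\<open>ps (Suc x)\<close> is the Laplace transform attached to an excursion
      started at x. It is at most 1, which gives X \<le> H as the series requires.\<close>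
    define ps where "ps j = 1 / (\<Prod>i<j. q i)" for j
    have psS: "ps (Suc j) = 1 / (\<Prod>i\<le>j. q i)" for j unfolding ps_def lessThan_Suc_atMost ..
    have ps01: "0 \<le> ps j" "ps j \<le> 1" for j
    proof -
      have "1 \<le> (\<Prod>i<j. q i)" by (rule prod_ge_1) (rule q1)
      then show "0 \<le> ps j" "ps j \<le> 1" unfolding ps_def by auto
    qed
    define X where "X = (\<Sum>x<?n. hh x * ps (Suc x))"
    have X0: "X \<ge> 0" unfolding X_def using hh0 ps01 by (intro sum_nonneg mult_nonneg_nonneg) auto
    have XH: "X \<le> H" unfolding X_def hhH[symmetric] using hh0 ps01 by (intro sum_mono) (simp add: mult_left_le)
    define P where "P = (\<Prod>j<?n. q j)"
    have P0: "P > 0" unfolding P_def using q0 by (intro prod_pos) auto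
    define D where "D = Determinant.det (Matrix.mat ?n ?n (\<lambda>(i, j). (if i = j then 1 else 0) + (\<Sum>l\<le>min i j. d l) * t j + (\<Sum>l\<le>j. sg l * d l) * t j))"
    have "D = P * (1 + (\<Sum>j<?n. (\<Sum>l\<le>j. sg l * d l) * t j / (\<Prod>i\<le>j. q i)))"
      unfolding D_def P_def q_def
      by (rule det_min_kernel[where T = T and t = t and d = d and n = ?n, OF Trec Tn qne])
    also have "(\<Sum>j<?n. (\<Sum>l\<le>j. sg l * d l) * t j / (\<Prod>i\<le>j. q i)) = (\<Sum>j<?n. sg j * (ps j - ps (Suc j)))"
      unfolding psS unfolding ps_def q_def
      by (rule slope_expansion[where T = T and t = t and d = d and n = ?n, OF Trec Tn qne])
    also have "\<dots> = (\<Sum>j<?n. sg' j * (ps j - ps (Suc j)))" by (intro sum.cong) (auto simp: sg'_def)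
    also have "\<dots> = H - X"
      unfolding abel_summation X_def by (auto simp: sg'_def H_def ps_def hh_def)
    finally have D: "D = P * (1 + H - X)" by (simp add: algebra_simps)
    have term_eq: "w xs * (\<Prod>m<?n. ennreal (q m powr (- b xs m))) =
       ennreal (P powr (- a)) * (ennreal (c (length xs)) * prod_list (map (\<lambda>x. ennreal (hh x * ps (Suc x))) xs))" for xs
    proof -
      have "w xs * (\<Prod>m<?n. ennreal (q m powr (- b xs m))) = ennreal (c (length xs) * prod_list (map hh xs)) * ennreal (\<Prod>m<?n. q m powr (- b xs m))"
        unfolding w_def by (simp only: prod_ennreal powr_ge_zero)
      also have "\<dots> = ennreal (c (length xs) * (prod_list (map hh xs) * (\<Prod>m<?n. q m powr (- b xs m))))"
      proof -
        have "(\<Prod>m<?n. q m powr (- b xs m)) \<ge> 0" by (rule prod_nonneg) simp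
        moreover have "c (length xs) * prod_list (map hh xs) \<ge> 0" using c0 prod_list_ennreal[of hh xs] hh0 by simp
        ultimately show ?thesis by (simp only: ennreal_mult[symmetric] mult.assoc)
      qed
      also have "prod_list (map hh xs) * (\<Prod>m<?n. q m powr (- b xs m)) = (\<Prod>m<?n. q m powr (- a)) * prod_list (map (\<lambda>x. hh x / (\<Prod>j\<le>x. q j)) xs)"
        unfolding b_def by (rule prod_list_chain_weights[OF q0]) (simp add: hh_def)
      also have "(\<Prod>m<?n. q m powr (- a)) = P powr (- a)"
        unfolding P_def by (rule prod_powr_distrib[symmetric])
      also have "(\<lambda>x. hh x / (\<Prod>j\<le>x. q j)) = (\<lambda>x. hh x * ps (Suc x))" by (simp add: psS)
      finally show ?thesis
        using c0 prod_list_ennreal[of "\<lambda>x. hh x * ps (Suc x)" xs] hh0 ps01 by (simp add: ennreal_mult mult_ac)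
    qed
    have "(\<integral>\<^sup>+xs. w xs * (\<Prod>m<?n. ennreal (q m powr (- b xs m))) \<partial>count_space UNIV) =
      ennreal (P powr (- a)) * (\<integral>\<^sup>+xs. ennreal (c (length xs)) * prod_list (map (\<lambda>x. ennreal (hh x * ps (Suc x))) xs) \<partial>count_space UNIV)"
      unfolding term_eq by (rule nn_integral_cmult) simp
    also have "(\<integral>\<^sup>+xs. ennreal (c (length xs)) * prod_list (map (\<lambda>x. ennreal (hh x * ps (Suc x))) xs) \<partial>count_space UNIV) =
      (\<Sum>m. ennreal (c m) * (\<Sum>x<?n. ennreal (hh x * ps (Suc x))) ^ m)"
      by (rule nn_integral_lists_prod_list) (simp add: hh_def)
    also have "\<dots> = (\<Sum>m. ennreal (c m * X ^ m))"
    proof -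
      have "(\<Sum>x<?n. ennreal (hh x * ps (Suc x))) = ennreal X"
        unfolding X_def by (rule sum_ennreal) (use hh0 ps01 in auto)
      then show ?thesis using c0 X0 by (simp only: ennreal_power ennreal_mult zero_le_power)
    qed
    also have "\<dots> = ennreal ((1 + H - X) powr (- a))"
    proof (rule suminf_ennreal_eq)
      show "0 \<le> c m * X ^ m" for m by (intro mult_nonneg_nonneg c0 zero_le_power X0)
      show "(\<lambda>m. c m * X ^ m) sums (1 + H - X) powr (- a)"
        unfolding c_def by (rule negative_binomial_sums[OF a H0 X0 XH])
    qed
    also have "ennreal (P powr (- a)) * \<dots> = ennreal (D powr (- a))"
      unfolding D using P0 XH by (simp add: powr_mult ennreal_mult)
    finally show "ennreal (Determinant.det (Matrix.mat ?n ?n (\<lambda>(i, j). (if i = j then 1 else 0) + (\<Sum>l\<le>min i j. d l) * t j + (\<Sum>l\<le>j. sg l * d l) * t j)) powr (- a)) =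
      (\<integral>\<^sup>+xs. w xs * (\<Prod>m<?n. ennreal ((1 + tau d t m (?n - m) * d m) powr (- b xs m))) \<partial>count_space UNIV)"
      unfolding D_def q_def T_def by simp
  qed
qed

section \<open>Permanental sequences\<close>

lemma permanental_sequenceD:
  assumes "permanental_sequence M a K Z" "n \<ge> 1" "inj_on i {..<n}" "\<And>m. m < n \<Longrightarrow> 1 \<le> i m" "\<And>m. m < n \<Longrightarrow> 0 < t m"
  shows "(\<integral>\<omega>. exp (- (\<Sum>m<n. t m * Z (i m) \<omega>)) \<partial>M) =
    Determinant.det (1\<^sub>m n + Matrix.mat n n (\<lambda>(p, q). K (i p) (i q)) * mat_diag n t) powr (- a)"
proof -
  have "\<forall>n\<ge>1. \<forall>i t. inj_on i {..<n} \<and> (\<forall>m<n. 1 \<le> i m) \<and> (\<forall>m<n. 0 < t m) \<longrightarrow>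
        (\<integral>\<omega>. exp (- (\<Sum>m<n. t m * Z (i m) \<omega>)) \<partial>M) =
        Determinant.det (1\<^sub>m n + Matrix.mat n n (\<lambda>(p, q). K (i p) (i q)) * mat_diag n t) powr (- a)"
    using assms(1) unfolding permanental_sequence_def by (rule conjunct2)
  from this[rule_format, of n i t] assms(2-) show ?thesis by simp
qed

text \<open>Along any increasing choice of indices the kernel is again a minimum kernel plus a
  concave function of the points, so the mixture representation applies to every subsequence. The
  one-step estimate has to be supplied only for shapes b \<ge> a.\<close>

lemma permanental_comparison:
  fixes s f :: "nat \<Rightarrow> real" and \<phi> :: "real \<Rightarrow> real" and Y :: "nat \<Rightarrow> 'a \<Rightarrow> real" and idx :: "nat \<Rightarrow> nat"
    and gg :: "nat \<Rightarrow> real \<Rightarrow> ennreal"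
  assumes M: "prob_space M" and a: "a > 0"
    and Y: "permanental_sequence M a (\<lambda>j k. min_kernel s j k + f k) Y"
    and s: "strict_mono_on {1..} s" "s 1 > 0"
    and f: "\<And>j. j \<ge> 1 \<Longrightarrow> f j = \<phi> (s j)"
    and phi: "concave_on {0..} \<phi>" "mono_on {0..} \<phi>" "\<phi> 0 = 0"
    and idx: "strict_mono idx" "idx 0 \<ge> 1"
    and g: "\<And>m. gg m \<in> borel_measurable borel" "\<And>m z. gg m z \<le> 1"
    and G: "G \<in> borel_measurable borel" "\<And>z. G z \<le> 1" and H: "H \<in> borel_measurable borel" "\<And>z. H z \<le> 1"
    and le: "\<And>b y. b \<ge> a \<Longrightarrow> y \<ge> 0 \<Longrightarrow>
      (\<integral>\<^sup>+z. bessel_kernel (s (idx (Suc k)) - s (idx k)) b y z * G z \<partial>lborel) \<le> c * H y"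
  shows "(\<integral>\<^sup>+\<omega>. (\<Prod>m\<le>k. gg m (Y (idx m) \<omega>)) * G (Y (idx (Suc k)) \<omega>) \<partial>M) \<le>
     c * (\<integral>\<^sup>+\<omega>. (\<Prod>m\<le>k. gg m (Y (idx m) \<omega>)) * H (Y (idx k) \<omega>) \<partial>M)"
proof -
  interpret prob_space M by fact
  have idx1: "idx m \<ge> 1" for m using idx strict_mono_less_eq[OF idx(1), of 0 m] by (meson le0 order_trans)
  have s0: "s j > 0" if "j \<ge> 1" for j
    using s that by (cases "j = 1") (auto simp: strict_mono_on_def intro: less_trans)
  \<comment> \<open>The point 0 is put in front: the first increment is then
    \<open>s (idx 0)\<close>, and since \<phi> vanishes at 0 the slopes times increments sum to
    f.\<close>
  define x where "x m = (case m of 0 \<Rightarrow> 0 | Suc l \<Rightarrow> s (idx l))" for m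
  have x_Suc: "x (Suc m) = s (idx m)" and x_0: "x 0 = 0" for m by (simp_all add: x_def)
  have x_less: "x m < x (Suc m)" for m
  proof (cases m)
    case 0 then show ?thesis using s0 idx1 by (simp add: x_def)
  next
    case (Suc l)
    then show ?thesis using s(1) idx1[of l] idx1[of m] strict_monoD[OF idx(1), of l m] by (auto simp: x_def strict_mono_on_def)
  qed
  have x_nn: "x m \<ge> 0" for m using s0 idx1 by (cases m) (auto simp: x_def intro: less_imp_le)
  define d where "d m = x (Suc m) - x m" for m
  define sg where "sg m = (\<phi> (x (Suc m)) - \<phi> (x m)) / d m" for m
  have d0: "d m > 0" for m using x_less[of m] by (simp add: d_def)
  have sumd: "(\<Sum>l\<le>m. d l) = s (idx m)" for m
    unfolding d_def lessThan_Suc_atMost[symmetric] sum_lessThan_telescope by (simp add: x_Suc x_0)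
  have sumsg: "(\<Sum>l\<le>m. sg l * d l) = f (idx m)" for m
  proof -
    have "sg l * d l = \<phi> (x (Suc l)) - \<phi> (x l)" for l unfolding sg_def using d0[of l] by simp
    then have "(\<Sum>l\<le>m. sg l * d l) = (\<Sum>l<Suc m. \<phi> (x (Suc l)) - \<phi> (x l))" unfolding lessThan_Suc_atMost by simp
    also have "\<dots> = \<phi> (x (Suc m)) - \<phi> (x 0)" by (rule sum_lessThan_telescope)
    finally show ?thesis using f[OF idx1] phi by (simp add: x_Suc x_0)
  qed
  have sg0: "sg m \<ge> 0" for m
    unfolding sg_def using d0[of m] x_nn x_less[of m] mono_onD[OF phi(2), of "x m" "x (Suc m)"] by (auto intro!: divide_nonneg_pos)
  have sgS: "sg (Suc m) \<le> sg m" for m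
  proof -
    \<comment> \<open>Concavity enters here: chord slopes over adjacent intervals decrease.\<close>
    have cv: "convex_on {0..} (\<lambda>z. - \<phi> z)" using phi(1) by (simp add: concave_on_def)
    have "(- \<phi> (x m) - - \<phi> (x (Suc m))) / (x m - x (Suc m)) \<le> (- \<phi> (x (Suc m)) - - \<phi> (x (Suc (Suc m)))) / (x (Suc m) - x (Suc (Suc m)))"
      using convex_on_slope_le[OF cv, of "x m" "x (Suc (Suc m))" "x (Suc m)"] x_nn x_less[of m] x_less[of "Suc m"]
      by (meson atLeast_iff le_less_trans less_le_not_le order_trans)
    moreover have "(- \<phi> (x l) - - \<phi> (x (Suc l))) / (x l - x (Suc l)) = - sg l" for l
      unfolding sg_def d_def using x_less[of l] by (simp add: field_simps)
    ultimately show ?thesis by simp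
  qed
  have Ym: "Y (idx m) \<in> borel_measurable M" and Y0: "\<omega> \<in> space M \<Longrightarrow> 0 \<le> Y (idx m) \<omega>" for m \<omega>
    using Y idx1[of m] unfolding permanental_sequence_def by auto
  have dk: "s (idx (Suc k)) - s (idx k) = d (Suc k)" unfolding d_def by (simp add: x_Suc)
  show ?thesis
  proof (rule chain_laplace[where d = d and sg = sg and a = a and k = "Suc k", OF a d0 sg0 sgS])
    fix w :: "nat list \<Rightarrow> ennreal" and b
    assume b: "\<And>xs m. b xs m \<ge> a" and L: "\<And>t. (\<And>m. t m > 0) \<Longrightarrow>
        ennreal (Determinant.det (Matrix.mat (Suc (Suc k)) (Suc (Suc k)) (\<lambda>(i, j). (if i = j then 1 else 0) + (\<Sum>l\<le>min i j. d l) * t j + (\<Sum>l\<le>j. sg l * d l) * t j)) powr (- a)) =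
        (\<integral>\<^sup>+xs. w xs * (\<Prod>m<Suc (Suc k). ennreal ((1 + tau d t m (Suc (Suc k) - m) * d m) powr (- b xs m))) \<partial>count_space UNIV)"
    show ?thesis
    proof (rule chain_comparison[where Y = "\<lambda>m. Y (idx m)" and d = d and b = b and w = w, OF M Ym Y0 d0])
      show "0 < b xs m" for xs m using b[of xs m] a by linarith
      show "(\<integral>\<^sup>+z. bessel_kernel (d (Suc k)) (b xs (Suc k)) y z * G z \<partial>lborel) \<le> c * H y" if "0 \<le> y" for xs y
        using le[OF b that] unfolding dk .
      fix t :: "nat \<Rightarrow> real" assume t: "\<And>m. 0 < t m"
      let ?n = "Suc (Suc k)"
      have int: "integrable M (\<lambda>\<omega>. exp (- (\<Sum>m<?n. t m * Y (idx m) \<omega>)))"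
      proof (rule integrable_const_bound)
        show "AE \<omega> in M. norm (exp (- (\<Sum>m<?n. t m * Y (idx m) \<omega>))) \<le> 1"
        proof (rule AE_I2)
          fix \<omega> assume "\<omega> \<in> space M"
          then have "0 \<le> (\<Sum>m<?n. t m * Y (idx m) \<omega>)"
            using Y0 t by (intro sum_nonneg mult_nonneg_nonneg) (auto intro: less_imp_le)
          then show "norm (exp (- (\<Sum>m<?n. t m * Y (idx m) \<omega>))) \<le> 1" by simp
        qed
        show "(\<lambda>\<omega>. exp (- (\<Sum>m<?n. t m * Y (idx m) \<omega>))) \<in> borel_measurable M"
          using Ym by (intro measurable_compose[OF _ borel_measurable_exp] borel_measurable_uminus borel_measurable_sum borel_measurable_times borel_measurable_const)
      qed
      have "(\<integral>\<^sup>+\<omega>. ennreal (exp (- (\<Sum>m<?n. t m * Y (idx m) \<omega>))) \<partial>M) =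
        ennreal (\<integral>\<omega>. exp (- (\<Sum>m<?n. t m * Y (idx m) \<omega>)) \<partial>M)"
        by (rule nn_integral_eq_integral[OF int]) simp
      also have "(\<integral>\<omega>. exp (- (\<Sum>m<?n. t m * Y (idx m) \<omega>)) \<partial>M) =
        Determinant.det (1\<^sub>m ?n + Matrix.mat ?n ?n (\<lambda>(p, q). min_kernel s (idx p) (idx q) + f (idx q)) * mat_diag ?n t) powr (- a)"
        by (rule permanental_sequenceD[OF Y _ strict_mono_imp_inj_on[OF idx(1)]]) (use idx1 t in auto)
      also have "1\<^sub>m ?n + Matrix.mat ?n ?n (\<lambda>(p, q). min_kernel s (idx p) (idx q) + f (idx q)) * mat_diag ?n t =
        Matrix.mat ?n ?n (\<lambda>(i, j). (if i = j then 1 else 0) + (\<Sum>l\<le>min i j. d l) * t j + (\<Sum>l\<le>j. sg l * d l) * t j)"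
      proof -
        have mk: "min_kernel s (idx i) (idx j) = s (idx (min i j))" for i j
        proof -
          have mono: "s (idx i) \<le> s (idx j)" if "i \<le> j" for i j
            using that s(1) idx1[of i] idx1[of j] strict_mono_less_eq[OF idx(1), of i j] strict_mono_on_leD[of "{1..}" s "idx i" "idx j"] by auto
          show ?thesis unfolding min_kernel_def using mono[of i j] mono[of j i] by (auto simp: min_def)
        qed
        show ?thesis
          by (subst mat_diag_mult_right[of _ ?n ?n], simp, rule eq_matI)
             (auto simp: sumd sumsg mk distrib_right)
      qed
      also note L[OF t]
      finally show "(\<integral>\<^sup>+\<omega>. ennreal (exp (- (\<Sum>m<?n. t m * Y (idx m) \<omega>))) \<partial>M) =
        (\<integral>\<^sup>+xs. w xs * (\<Prod>m<?n. ennreal ((1 + tau d t m (?n - m) * d m) powr (- b xs m))) \<partial>count_space UNIV)" .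
    qed (use g G H in auto)
  qed
qed

lemma permanental_marginal:
  fixes s f :: "nat \<Rightarrow> real" and Y :: "nat \<Rightarrow> 'a \<Rightarrow> real"
  assumes M: "prob_space M" and a: "a > 0"
    and Y: "permanental_sequence M a (\<lambda>j k. min_kernel s j k + f k) Y"
    and j: "j \<ge> 1" and sf: "s j + f j > 0"
  shows "distr M borel (Y j) = density lborel (\<lambda>z. ennreal (gamma_dens a (s j + f j) z))"
proof -
  interpret prob_space M by fact
  have [measurable]: "Y j \<in> borel_measurable M" and Y0: "\<omega> \<in> space M \<Longrightarrow> 0 \<le> Y j \<omega>" for \<omega>
    using Y j unfolding permanental_sequence_def by auto
  let ?c = "s j + f j"
  show ?thesis
  proof (rule laplace_unique)
    show "finite_measure (distr M borel (Y j))" by (rule finite_measure_distr) measurable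
    show "AE z in distr M borel (Y j). 0 \<le> z" by (subst AE_distr_iff) (auto simp: Y0)
    show "AE z in density lborel (\<lambda>z. ennreal (gamma_dens a ?c z)). 0 \<le> z"
      by (subst AE_density) (auto simp: gamma_dens_def)
    fix t :: real assume t: "t > 0"
    have int: "integrable M (\<lambda>\<omega>. exp (- t * Y j \<omega>))"
      by (rule integrable_const_bound[of _ 1]) (use t Y0 in auto)
    have "(\<integral>\<^sup>+z. ennreal (exp (- t * z)) \<partial>distr M borel (Y j)) = (\<integral>\<^sup>+\<omega>. ennreal (exp (- t * Y j \<omega>)) \<partial>M)"
      by (rule nn_integral_distr) auto
    also have "\<dots> = ennreal (\<integral>\<omega>. exp (- t * Y j \<omega>) \<partial>M)" by (rule nn_integral_eq_integral[OF int]) simp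
    also have "(\<integral>\<omega>. exp (- t * Y j \<omega>) \<partial>M) =
      Determinant.det (1\<^sub>m 1 + Matrix.mat 1 1 (\<lambda>(p, q). min_kernel s j j + f j) * mat_diag 1 (\<lambda>_. t)) powr (- a)"
    proof -
      have "(\<integral>\<omega>. exp (- (\<Sum>m<1::nat. t * Y j \<omega>)) \<partial>M) =
        Determinant.det (1\<^sub>m 1 + Matrix.mat 1 1 (\<lambda>(p, q). min_kernel s j j + f j) * mat_diag 1 (\<lambda>_. t)) powr (- a)"
        by (rule permanental_sequenceD[OF Y, of 1 "\<lambda>_. j"]) (use j t in \<open>auto simp: inj_on_def\<close>)
      then show ?thesis by simp
    qed
    also have "1\<^sub>m 1 + Matrix.mat 1 1 (\<lambda>(p, q). min_kernel s j j + f j) * mat_diag 1 (\<lambda>_. t) = Matrix.mat 1 1 (\<lambda>_. 1 + t * ?c)"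
      by (subst mat_diag_mult_right[of _ 1 1], simp, rule eq_matI) (auto simp: min_kernel_def algebra_simps)
    also have "Determinant.det (Matrix.mat 1 1 (\<lambda>_. 1 + t * ?c)) = 1 + t * ?c" by (simp add: det_single)
    also have "ennreal ((1 + t * ?c) powr (- a)) = (\<integral>\<^sup>+z. ennreal (gamma_dens a ?c z * exp (- t * z)) \<partial>lborel)"
      by (rule gamma_dens_laplace[OF a sf, symmetric]) (use t sf in \<open>simp add: add_pos_nonneg\<close>)
    also have "\<dots> = (\<integral>\<^sup>+z. ennreal (exp (- t * z)) \<partial>density lborel (\<lambda>z. ennreal (gamma_dens a ?c z)))"
      by (simp add: nn_integral_density ennreal_mult'')
    finally show "(\<integral>\<^sup>+z. ennreal (exp (- t * z)) \<partial>distr M borel (Y j)) =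
       (\<integral>\<^sup>+z. ennreal (exp (- t * z)) \<partial>density lborel (\<lambda>z. ennreal (gamma_dens a ?c z)))" .
  qed auto
qed

text \<open>Markov's inequality for the exponential moment at th / (s j + f j), finite because th <
  1. Taking th near 1 costs only a constant and nearly keeps the true decay rate exp (- x).\<close>

lemma permanental_chernoff:
  fixes s f :: "nat \<Rightarrow> real" and Y :: "nat \<Rightarrow> 'a \<Rightarrow> real"
  assumes M: "prob_space M" and a: "a > 0"
    and Y: "permanental_sequence M a (\<lambda>j k. min_kernel s j k + f k) Y"
    and j: "j \<ge> 1" and sf: "s j + f j > 0" and th: "0 < th" "th < 1"
  shows "emeasure M {\<omega> \<in> space M. x * (s j + f j) \<le> Y j \<omega>} \<le> ennreal ((1 - th) powr (- a) * exp (- th * x))"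
proof -
  interpret prob_space M by fact
  have [measurable]: "Y j \<in> borel_measurable M"
    using Y j unfolding permanental_sequence_def by auto
  let ?c = "s j + f j"
  have "emeasure M {\<omega> \<in> space M. x * ?c \<le> Y j \<omega>} = (\<integral>\<^sup>+\<omega>. indicator {x * ?c..} (Y j \<omega>) \<partial>M)"
    by (subst nn_integral_indicator[symmetric], measurable, intro nn_integral_cong) (auto simp: indicator_def)
  also have "\<dots> \<le> (\<integral>\<^sup>+\<omega>. ennreal (exp (- th * x)) * ennreal (exp (- (- th / ?c) * Y j \<omega>)) \<partial>M)"
  proof (rule nn_integral_mono)
    fix \<omega>
    show "indicator {x * ?c..} (Y j \<omega>) \<le> ennreal (exp (- th * x)) * ennreal (exp (- (- th / ?c) * Y j \<omega>))"
    proof (cases "x * ?c \<le> Y j \<omega>")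
      case True
      then have "x \<le> Y j \<omega> / ?c" using sf by (simp add: pos_le_divide_eq)
      then have "th * x \<le> th * (Y j \<omega> / ?c)" using th by (intro mult_left_mono) auto
      then have "1 \<le> exp (- th * x) * exp (- (- th / ?c) * Y j \<omega>)" unfolding mult_exp_exp by simp
      then have "1 \<le> ennreal (exp (- th * x) * exp (- (- th / ?c) * Y j \<omega>))" by (simp only: ennreal_ge_1)
      then show ?thesis using True by (simp add: ennreal_mult)
    qed simp
  qed
  also have "\<dots> = ennreal (exp (- th * x)) * (\<integral>\<^sup>+z. ennreal (exp (- (- th / ?c) * z)) \<partial>distr M borel (Y j))"
    by (simp add: nn_integral_cmult nn_integral_distr)
  also have "(\<integral>\<^sup>+z. ennreal (exp (- (- th / ?c) * z)) \<partial>distr M borel (Y j)) = (\<integral>\<^sup>+z. ennreal (gamma_dens a ?c z * exp (- (- th / ?c) * z)) \<partial>lborel)"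
    unfolding permanental_marginal[OF M a Y j sf] by (simp add: nn_integral_density ennreal_mult'')
  also have "\<dots> = ennreal ((1 + (- th / ?c) * ?c) powr (- a))"
    by (rule gamma_dens_laplace[OF a sf]) (use sf th in auto)
  also have "1 + (- th / ?c) * ?c = 1 - th" using sf by simp
  finally show ?thesis by (simp add: ennreal_mult[symmetric] mult.commute)
qed

section \<open>Upper and lower bounds\<close>

text \<open>The asymptotics are derived from f = \<phi> o s rather than from h. Concavity,
  monotonicity and \<phi> 0 = 0 provide the chains; sublinearity makes the marginal scale s + f
  asymptotic to s.\<close>

locale min_permanental = prob_space M for M :: "'a measure" +
  fixes a :: real and s f :: "nat \<Rightarrow> real" and \<phi> :: "real \<Rightarrow> real" and Y :: "nat \<Rightarrow> 'a \<Rightarrow> real"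
  assumes a: "a > 0"
    and Y: "permanental_sequence M a (\<lambda>j k. min_kernel s j k + f k) Y"
    and s: "strict_mono_on {1..} s" "s 1 > 0" "filterlim s at_top sequentially"
    and f: "\<And>j. j \<ge> 1 \<Longrightarrow> f j = \<phi> (s j)"
    and phi: "concave_on {0..} \<phi>" "mono_on {0..} \<phi>" "\<phi> 0 = 0" "((\<lambda>x. \<phi> x / x) \<longlongrightarrow> 0) at_top"
begin

lemma Y_measurable [measurable]: "j \<ge> 1 \<Longrightarrow> Y j \<in> borel_measurable M"
  using Y unfolding permanental_sequence_def by auto

lemma Y_nonneg: "j \<ge> 1 \<Longrightarrow> \<omega> \<in> space M \<Longrightarrow> 0 \<le> Y j \<omega>"
  using Y unfolding permanental_sequence_def by auto

lemma s_less: "1 \<le> i \<Longrightarrow> i < j \<Longrightarrow> s i < s j"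
  using s(1) by (auto simp: strict_mono_on_def)

lemma s_le: "1 \<le> i \<Longrightarrow> i \<le> j \<Longrightarrow> s i \<le> s j"
  using s_less[of i j] by (cases "i = j") auto

lemma s_pos: "1 \<le> j \<Longrightarrow> 0 < s j"
  using s_le[of 1 j] s(2) by simp

lemma f_nonneg: "1 \<le> j \<Longrightarrow> 0 \<le> f j"
  using f[of j] mono_onD[OF phi(2), of 0 "s j"] s_pos[of j] phi(3) by simp

lemmas comparison = permanental_comparison[OF prob_space_axioms a Y s(1) s(2) f phi(1) phi(2) phi(3)]

text \<open>A is the event that level x is first reached at j, so it depends on the past up to j. In
  the kernel transform the power with exponent - b is at most 1 and is dropped, which leaves a bound
  common to all shapes.\<close>

lemma two_step_laplace:
  fixes x t :: real
  assumes ij: "1 \<le> i0" "i0 \<le> j" "j < n" and t: "t \<ge> 0"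
  defines "A \<equiv> {\<omega> \<in> space M. (\<forall>i\<in>{i0..<j}. Y i \<omega> < x) \<and> x \<le> Y j \<omega>}"
  shows "(\<integral>\<^sup>+\<omega>. indicator A \<omega> * ennreal (exp (- t * Y n \<omega>)) \<partial>M) \<le>
    (\<integral>\<^sup>+\<omega>. indicator A \<omega> * ennreal (exp (- (t / (1 + t * (s n - s j))) * Y j \<omega>)) \<partial>M)"
proof -
  define k where "k = j - i0"
  \<comment> \<open>The path is followed from i0 to j and then jumps straight to n. The values
    beyond \<open>Suc k\<close> only keep \<open>idx\<close> strictly increasing.\<close>
  define idx where "idx m = (if m \<le> k then i0 + m else n + (m - Suc k))" for m
  have idx: "strict_mono idx" "idx 0 \<ge> 1" "idx k = j" "idx (Suc k) = n" "idx m \<ge> 1" for m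
  proof -
    show "strict_mono idx" unfolding strict_mono_Suc_iff idx_def k_def using ij by auto
  qed (use ij in \<open>auto simp: idx_def k_def\<close>)
  define d where "d = s n - s j"
  have d: "d > 0" unfolding d_def using s_less[of j n] ij by simp
  define \<tau> where "\<tau> = t / (1 + t * d)"
  have t0: "\<tau> \<ge> 0" unfolding \<tau>_def using t d by (auto intro!: divide_nonneg_nonneg add_nonneg_nonneg)
  define gg :: "nat \<Rightarrow> real \<Rightarrow> ennreal" where "gg m = (if m < k then indicator {..<x} else indicator {x..})" for m
  have ind: "(\<Prod>m\<le>k. gg m (Y (idx m) \<omega>)) = indicator A \<omega>" if "\<omega> \<in> space M" for \<omega>
  proof -
    have "(\<Prod>m\<le>k. gg m (Y (idx m) \<omega>)) = (\<Prod>m<k. indicator {..<x} (Y (i0 + m) \<omega>)) * indicator {x..} (Y j \<omega>)"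
      unfolding lessThan_Suc_atMost[symmetric] prod.lessThan_Suc idx(3)
      by (intro arg_cong2[of _ _ _ _ "(*)"] prod.cong) (auto simp: gg_def idx_def)
    also have "(\<Prod>m<k. indicator {..<x} (Y (i0 + m) \<omega>) :: ennreal) = (\<Prod>i\<in>{i0..<j}. indicator {..<x} (Y i \<omega>))"
      by (rule prod.reindex_bij_witness[where i = "\<lambda>i. i - i0" and j = "\<lambda>m. i0 + m"]) (use ij in \<open>auto simp: k_def\<close>)
    also have "\<dots> = (if \<forall>i\<in>{i0..<j}. Y i \<omega> < x then 1 else 0)"
      by (auto simp: indicator_def intro!: prod.neutral)
    finally show ?thesis using that by (auto simp: A_def indicator_def)
  qed
  \<comment> \<open>The truncation by \<open>max 0\<close> keeps the test functions at most 1 on the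
    whole line, as the comparison demands; on the nonnegative values of Y it changes
    nothing.\<close>
  have "(\<integral>\<^sup>+\<omega>. (\<Prod>m\<le>k. gg m (Y (idx m) \<omega>)) * ennreal (exp (- t * max 0 (Y (idx (Suc k)) \<omega>))) \<partial>M) \<le>
     1 * (\<integral>\<^sup>+\<omega>. (\<Prod>m\<le>k. gg m (Y (idx m) \<omega>)) * ennreal (exp (- \<tau> * max 0 (Y (idx k) \<omega>))) \<partial>M)"
  proof (rule comparison[OF _ idx(1,2), where G = "\<lambda>z. ennreal (exp (- t * max 0 z))" and H = "\<lambda>z. ennreal (exp (- \<tau> * max 0 z))"])
    show "gg m \<in> borel_measurable borel" for m unfolding gg_def by auto
    show "gg m z \<le> 1" for m z unfolding gg_def by (auto simp: indicator_def)
    show "ennreal (exp (- t * max 0 z)) \<le> 1" for z using t by simp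
    show "ennreal (exp (- \<tau> * max 0 z)) \<le> 1" for z using t0 by simp
    fix b y :: real assume b: "a \<le> b" and y: "0 \<le> y"
    have b0: "b > 0" using a b by simp
    have "(\<integral>\<^sup>+z. bessel_kernel (s (idx (Suc k)) - s (idx k)) b y z * ennreal (exp (- t * max 0 z)) \<partial>lborel) =
      (\<integral>\<^sup>+z. bessel_kernel d b y z * ennreal (exp (- t * z)) \<partial>lborel)"
    proof (rule nn_integral_cong)
      fix z
      show "bessel_kernel (s (idx (Suc k)) - s (idx k)) b y z * ennreal (exp (- t * max 0 z)) = bessel_kernel d b y z * ennreal (exp (- t * z))"
        using bessel_kernel_nonpos[of z d b y] unfolding idx d_def[symmetric] by (cases "z \<le> 0") auto
    qed
    also have "\<dots> = ennreal ((1 + t * d) powr (- b) * exp (- y * (t / (1 + t * d))))"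
      by (rule bessel_kernel_laplace[OF b0 d t y])
    also have "\<dots> \<le> ennreal (1 * exp (- y * (t / (1 + t * d))))"
    proof (intro ennreal_leI mult_right_mono)
      have "1 \<le> (1 + t * d) powr b" using b0 t d by (intro ge_one_powr_ge_zero) auto
      then show "(1 + t * d) powr (- b) \<le> 1" by (simp add: powr_minus inverse_le_1_iff)
    qed simp
    also have "\<dots> = 1 * ennreal (exp (- \<tau> * max 0 y))" using y by (simp add: \<tau>_def mult.commute)
    finally show "(\<integral>\<^sup>+z. bessel_kernel (s (idx (Suc k)) - s (idx k)) b y z * ennreal (exp (- t * max 0 z)) \<partial>lborel) \<le> 1 * ennreal (exp (- \<tau> * max 0 y))" .
  qed (auto simp: f)
  also have "(\<integral>\<^sup>+\<omega>. (\<Prod>m\<le>k. gg m (Y (idx m) \<omega>)) * ennreal (exp (- t * max 0 (Y (idx (Suc k)) \<omega>))) \<partial>M) =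
    (\<integral>\<^sup>+\<omega>. indicator A \<omega> * ennreal (exp (- t * Y n \<omega>)) \<partial>M)"
    using ij by (intro nn_integral_cong) (simp add: ind idx Y_nonneg max_absorb2)
  also have "1 * (\<integral>\<^sup>+\<omega>. (\<Prod>m\<le>k. gg m (Y (idx m) \<omega>)) * ennreal (exp (- \<tau> * max 0 (Y (idx k) \<omega>))) \<partial>M) =
    (\<integral>\<^sup>+\<omega>. indicator A \<omega> * ennreal (exp (- \<tau> * Y j \<omega>)) \<partial>M)"
    unfolding mult_1 using ij by (intro nn_integral_cong) (simp add: ind idx Y_nonneg max_absorb2)
  finally show ?thesis unfolding \<tau>_def d_def .
qed

text \<open>
  Ottaviani's argument: once the chain has exceeded \<open>x\<close>, it is still above \<open>(1 - \<delta>) * x\<close> at time \<open>n\<close>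
  with probability at least one half.
\<close>

lemma maximal_inequality:
  assumes i0: "1 \<le> i0" "i0 \<le> n" and del: "0 < \<delta>" "\<delta> < 1" and x: "0 < x"
    and D: "4 * ln 2 * (s n - s i0) \<le> \<delta>\<^sup>2 * x"
  shows "prob {\<omega> \<in> space M. \<exists>j\<in>{i0..n}. x \<le> Y j \<omega>} \<le> 2 * prob {\<omega> \<in> space M. (1 - \<delta>) * x \<le> Y n \<omega>}"
proof -
  define A where "A j = {\<omega> \<in> space M. (\<forall>i\<in>{i0..<j}. Y i \<omega> < x) \<and> x \<le> Y j \<omega>}" for j
  define E where "E = {\<omega> \<in> space M. (1 - \<delta>) * x \<le> Y n \<omega>}"
  have [measurable]: "Y n \<in> borel_measurable M" using i0 by simp
  have Em [measurable]: "E \<in> sets M" unfolding E_def by measurable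
  have Am: "A j \<in> sets M" if "j \<in> {i0..n}" for j
  proof -
    have 1: "{\<omega> \<in> space M. Y i \<omega> < x} \<in> sets M" "{\<omega> \<in> space M. x \<le> Y i \<omega>} \<in> sets M" if "i0 \<le> i" for i
    proof -
      have [measurable]: "Y i \<in> borel_measurable M" using that i0 by simp
      show "{\<omega> \<in> space M. Y i \<omega> < x} \<in> sets M" "{\<omega> \<in> space M. x \<le> Y i \<omega>} \<in> sets M" by measurable
    qed
    show ?thesis unfolding A_def
      by (intro sets.sets_Collect_conj sets.sets_Collect_finite_All 1) (use that in auto)
  qed
  have step: "prob (A j) \<le> 2 * prob (A j \<inter> E)" if j: "j \<in> {i0..n}" for j
  proof (cases "j = n")
    case True
    have "(1 - \<delta>) * x \<le> x" using del x by (simp add: algebra_simps)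
    then have "A j \<inter> E = A j" unfolding A_def E_def True by auto
    then show ?thesis by simp
  next
    case False
    then have jn: "i0 \<le> j" "j < n" "1 \<le> j" using j i0 by auto
    define d where "d = s n - s j"
    have d: "d > 0" unfolding d_def using s_less[of j n] jn by simp
    have dD: "d \<le> s n - s i0" unfolding d_def using s_le[of i0 j] jn i0 by simp
    \<comment> \<open>Since 1 / (1 + t d) \<ge> 1 - t d, the exponent below is at most t (t d -
      \<delta>) x. This is minimal at t d = \<delta> / 2, with value - \<delta>^2 x / (4 d), and the
      hypothesis D makes it at most - ln 2.\<close>
    define t where "t = \<delta> / (2 * d)"
    have t: "t > 0" unfolding t_def using del d by simp
    have td: "t * d = \<delta> / 2" unfolding t_def using d by simp
    define \<tau> where "\<tau> = t / (1 + t * d)"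
    have tau: "\<tau> \<ge> t * (1 - \<delta> / 2)"
    proof -
      have "(1 - \<delta> / 2) * (1 + \<delta> / 2) \<le> 1" by (simp add: algebra_simps)
      then have "1 - \<delta> / 2 \<le> 1 / (1 + \<delta> / 2)" using del by (simp add: pos_le_divide_eq)
      then have "t * (1 - \<delta> / 2) \<le> t * (1 / (1 + \<delta> / 2))" using t by (intro mult_left_mono) auto
      then show ?thesis unfolding \<tau>_def td by simp
    qed
    have t0: "\<tau> > 0" unfolding \<tau>_def using t d by (auto intro!: divide_pos_pos add_pos_pos)
    have Ajm [measurable]: "A j \<in> sets M" using Am j .
    have [measurable]: "Y n \<in> borel_measurable M" "Y j \<in> borel_measurable M" using jn i0 by auto
    have "emeasure M (A j - E) = (\<integral>\<^sup>+\<omega>. indicator (A j - E) \<omega> \<partial>M)" by simp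
    also have "\<dots> \<le> (\<integral>\<^sup>+\<omega>. ennreal (exp (t * ((1 - \<delta>) * x))) * (indicator (A j) \<omega> * ennreal (exp (- t * Y n \<omega>))) \<partial>M)"
    proof (rule nn_integral_mono)
      fix \<omega> assume w: "\<omega> \<in> space M"
      show "indicator (A j - E) \<omega> \<le> ennreal (exp (t * ((1 - \<delta>) * x))) * (indicator (A j) \<omega> * ennreal (exp (- t * Y n \<omega>)))"
      proof (cases "\<omega> \<in> A j - E")
        case True
        then have "Y n \<omega> \<le> (1 - \<delta>) * x" using w unfolding E_def by auto
        then have "t * Y n \<omega> \<le> t * ((1 - \<delta>) * x)" using t by (intro mult_left_mono) auto
        then have "1 \<le> exp (t * ((1 - \<delta>) * x)) * exp (- t * Y n \<omega>)" unfolding mult_exp_exp by simp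
        then have "1 \<le> ennreal (exp (t * ((1 - \<delta>) * x)) * exp (- t * Y n \<omega>))" by (simp only: ennreal_ge_1)
        then show ?thesis using True by (simp add: ennreal_mult)
      qed simp
    qed
    also have "\<dots> = ennreal (exp (t * ((1 - \<delta>) * x))) * (\<integral>\<^sup>+\<omega>. indicator (A j) \<omega> * ennreal (exp (- t * Y n \<omega>)) \<partial>M)"
      by (rule nn_integral_cmult) measurable
    also have "\<dots> \<le> ennreal (exp (t * ((1 - \<delta>) * x))) * (\<integral>\<^sup>+\<omega>. indicator (A j) \<omega> * ennreal (exp (- \<tau> * Y j \<omega>)) \<partial>M)"
      unfolding A_def \<tau>_def d_def using i0 jn t by (intro mult_left_mono two_step_laplace) auto
    also have "\<dots> \<le> ennreal (exp (t * ((1 - \<delta>) * x))) * (\<integral>\<^sup>+\<omega>. indicator (A j) \<omega> * ennreal (exp (- \<tau> * x)) \<partial>M)"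
    proof (rule mult_left_mono[OF nn_integral_mono])
      fix \<omega>
      show "indicator (A j) \<omega> * ennreal (exp (- \<tau> * Y j \<omega>)) \<le> indicator (A j) \<omega> * ennreal (exp (- \<tau> * x))"
      proof (cases "\<omega> \<in> A j")
        case True
        then have "x \<le> Y j \<omega>" unfolding A_def by auto
        then have "\<tau> * x \<le> \<tau> * Y j \<omega>" using t0 by (intro mult_left_mono) auto
        then show ?thesis by (intro mult_left_mono ennreal_leI) auto
      qed simp
    qed simp
    also have "(\<integral>\<^sup>+\<omega>. indicator (A j) \<omega> * ennreal (exp (- \<tau> * x)) \<partial>M) = emeasure M (A j) * ennreal (exp (- \<tau> * x))"
      by (subst nn_integral_multc) auto
    also have "ennreal (exp (t * ((1 - \<delta>) * x))) * (emeasure M (A j) * ennreal (exp (- \<tau> * x))) =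
       ennreal (exp (t * ((1 - \<delta>) * x) + - \<tau> * x) * prob (A j))"
    proof -
      have "ennreal (exp u) * (ennreal p * ennreal (exp v)) = ennreal (exp (u + v) * p)" if "p \<ge> 0" for u v p
        using that by (simp add: exp_add ennreal_mult mult_ac)
      then show ?thesis unfolding emeasure_eq_measure by (simp only: measure_nonneg)
    qed
    finally have "prob (A j - E) \<le> exp (t * ((1 - \<delta>) * x) + - \<tau> * x) * prob (A j)"
      by (simp add: emeasure_eq_measure)
    also have "\<dots> \<le> (1 / 2) * prob (A j)"
    proof (intro mult_right_mono)
      have "4 * ln 2 * d \<le> \<delta>\<^sup>2 * x"
        using D dD by (meson ln_ge_zero mult_left_mono mult_nonneg_nonneg one_le_numeral order_trans zero_le_numeral)
      then have "ln 2 * (4 * d) \<le> \<delta>\<^sup>2 * x" by (simp add: mult_ac)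
      then have "ln 2 \<le> \<delta>\<^sup>2 * x / (4 * d)" using d by (simp add: pos_le_divide_eq)
      also have "\<delta>\<^sup>2 * x / (4 * d) = t * x * \<delta> / 2" unfolding t_def using d by (simp add: power2_eq_square)
      finally have 1: "ln 2 \<le> t * x * \<delta> / 2" .
      have "t * (1 - \<delta> / 2) * x \<le> \<tau> * x" using tau x by (intro mult_right_mono) auto
      then have "t * ((1 - \<delta>) * x) + - \<tau> * x \<le> - (t * x * \<delta> / 2)" by (simp add: algebra_simps)
      also have "\<dots> \<le> - ln 2" using 1 by simp
      finally have "exp (t * ((1 - \<delta>) * x) + - \<tau> * x) \<le> exp (- ln 2)" by simp
      then show "exp (t * ((1 - \<delta>) * x) + - \<tau> * x) \<le> 1 / 2" by (simp add: exp_minus)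
    qed simp
    finally have "prob (A j - E) \<le> (1 / 2) * prob (A j)" .
    moreover have "prob (A j) = prob (A j \<inter> E) + prob (A j - E)"
      using finite_measure_Diff'[OF Ajm Em] by simp
    ultimately show ?thesis by simp
  qed
  have disj: "disjoint_family_on A {i0..n}"
    unfolding disjoint_family_on_def
  proof (intro ballI impI)
    fix i j assume ij: "i \<in> {i0..n}" "j \<in> {i0..n}" "i \<noteq> j"
    show "A i \<inter> A j = {}"
      using ij by (cases "i < j") (force simp: A_def)+
  qed
  have un: "{\<omega> \<in> space M. \<exists>j\<in>{i0..n}. x \<le> Y j \<omega>} = (\<Union>j\<in>{i0..n}. A j)" (is "?U = _")
  proof
    show "?U \<subseteq> (\<Union>j\<in>{i0..n}. A j)"
    proof
      fix \<omega> assume w: "\<omega> \<in> ?U"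
      define j where "j = (LEAST j. j \<in> {i0..n} \<and> x \<le> Y j \<omega>)"
      have ex: "\<exists>j. j \<in> {i0..n} \<and> x \<le> Y j \<omega>" using w by auto
      have j: "j \<in> {i0..n} \<and> x \<le> Y j \<omega>" unfolding j_def by (rule LeastI_ex[OF ex])
      have "Y i \<omega> < x" if "i \<in> {i0..<j}" for i
        using not_less_Least[of i "\<lambda>j. j \<in> {i0..n} \<and> x \<le> Y j \<omega>"] that j unfolding j_def[symmetric] by auto
      then have "\<omega> \<in> A j" using j w unfolding A_def by auto
      then show "\<omega> \<in> (\<Union>j\<in>{i0..n}. A j)" using j by blast
    qed
  qed (auto simp: A_def)
  have "prob ?U = (\<Sum>j\<in>{i0..n}. prob (A j))"
    unfolding un by (rule finite_measure_finite_Union) (use Am disj in auto)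
  also have "\<dots> \<le> (\<Sum>j\<in>{i0..n}. 2 * prob (A j \<inter> E))" by (intro sum_mono step)
  also have "\<dots> = 2 * (\<Sum>j\<in>{i0..n}. prob (A j \<inter> E))" by (simp add: sum_distrib_left)
  also have "(\<Sum>j\<in>{i0..n}. prob (A j \<inter> E)) = prob (\<Union>j\<in>{i0..n}. A j \<inter> E)"
    by (rule finite_measure_finite_Union[symmetric]) (use Am disj in \<open>auto simp: disjoint_family_on_def\<close>)
  also have "\<dots> \<le> prob E" by (rule finite_measure_mono) auto
  finally show ?thesis unfolding E_def by simp
qed

section \<open>Growth of the block counter compared with ln s\<close>

definition log_sum :: "nat \<Rightarrow> real" where
  "log_sum j = (\<Sum>i = 1..<j. min 1 (ln (s (Suc i) / s i)))"

lemma ln_ratio_pos: "1 \<le> i \<Longrightarrow> 0 < ln (s (Suc i) / s i)"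
  using s_less[of i "Suc i"] s_pos[of i] by simp

lemma log_sum_Suc: "1 \<le> j \<Longrightarrow> log_sum (Suc j) = log_sum j + min 1 (ln (s (Suc j) / s j))"
  unfolding log_sum_def by simp

lemma log_sum_mono:
  assumes "1 \<le> i" "i \<le> j"
  shows "log_sum i \<le> log_sum j"
  using assms(2)
proof (induction j rule: dec_induct)
  case (step n)
  have "0 < min 1 (ln (s (Suc n) / s n))" using ln_ratio_pos[of n] step assms by simp
  then show ?case using step log_sum_Suc[of n] assms by simp
qed simp

lemma log_sum_diff_le:
  assumes "1 \<le> i" "i \<le> j"
  shows "log_sum j - log_sum i \<le> ln (s j / s i)"
  using assms(2)
proof (induction j rule: dec_induct)
  case base then show ?case using s_pos[OF assms(1)] by simp
next
  case (step n)
  have p: "s n > 0" "s i > 0" "s (Suc n) > 0" using s_pos step assms by auto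
  have "log_sum (Suc n) - log_sum i \<le> ln (s n / s i) + ln (s (Suc n) / s n)"
    using step log_sum_Suc[of n] assms by simp
  also have "\<dots> = ln (s (Suc n) / s i)" using p by (simp add: ln_div)
  finally show ?case .
qed

text \<open>An increment below 1 means that no summand was truncated, so the sum of logarithms
  telescopes. This is what keeps s nearly constant on a block.\<close>

lemma log_sum_diff_ge:
  assumes "1 \<le> i" "i \<le> j" "log_sum j - log_sum i < 1"
  shows "ln (s j / s i) \<le> log_sum j - log_sum i"
  using assms(2,3)
proof (induction j rule: dec_induct)
  case base then show ?case using s_pos[OF assms(1)] by simp
next
  case (step n)
  have p: "s n > 0" "s i > 0" "s (Suc n) > 0" using s_pos step assms by auto
  have L: "log_sum (Suc n) = log_sum n + min 1 (ln (s (Suc n) / s n))" using log_sum_Suc step assms by simp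
  have "log_sum i \<le> log_sum n" using log_sum_mono assms step by simp
  then have lt: "min 1 (ln (s (Suc n) / s n)) < 1" using step.prems L by simp
  then have m: "min 1 (ln (s (Suc n) / s n)) = ln (s (Suc n) / s n)" by (simp add: min_def split: if_splits)
  have "log_sum n - log_sum i < 1" using log_sum_mono[of n "Suc n"] step assms by simp
  then have "ln (s n / s i) \<le> log_sum n - log_sum i" by (rule step.IH)
  moreover have "ln (s (Suc n) / s i) = ln (s n / s i) + ln (s (Suc n) / s n)" using p by (simp add: ln_div)
  ultimately show ?case using L m by simp
qed

text \<open>If the sum stayed bounded, its growth after some N would be below 1 and hence
  untruncated, and s would remain below e * s N.\<close>

lemma log_sum_at_top: "filterlim log_sum at_top sequentially"
proof -
  have unb: "\<exists>j\<ge>1. log_sum j > B" for B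
  proof (rule ccontr)
    assume "\<not> (\<exists>j\<ge>1. log_sum j > B)"
    then have B: "log_sum j \<le> B" if "j \<ge> 1" for j using that by (auto simp: not_less)
    define S where "S = (SUP j\<in>{1..}. log_sum j)"
    have bdd: "bdd_above (log_sum ` {1..})" by (rule bdd_aboveI[of _ B]) (use B in auto)
    have le: "log_sum j \<le> S" if "j \<ge> 1" for j unfolding S_def by (rule cSUP_upper[OF _ bdd]) (use that in auto)
    have "\<exists>N\<in>{1..}. S - 1 < log_sum N"
      using less_cSUP_iff[of "{1..}" log_sum "S - 1", OF _ bdd] unfolding S_def[symmetric] by auto
    then obtain N where N: "N \<ge> 1" "S - 1 < log_sum N" by auto
    have "s j \<le> exp 1 * s N" if "j \<ge> N" for j
    proof -
      have "log_sum j - log_sum N < 1" using le[of j] N that by simp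
      then have "ln (s j / s N) < 1" using log_sum_diff_ge[of N j] N that by simp
      then have "s j / s N < exp 1" using s_pos[of j] s_pos[of N] N that by (metis divide_pos_pos exp_less_mono exp_ln le_trans)
      then show ?thesis using s_pos[of N] N by (simp add: pos_divide_less_eq)
    qed
    moreover have "eventually (\<lambda>j. s j > exp 1 * s N) sequentially"
      using s(3) by (rule filterlim_at_top_dense[THEN iffD1, rule_format])
    ultimately show False unfolding eventually_sequentially by (metis linorder_not_less max.cobounded1 max.cobounded2)
  qed
  show ?thesis
    unfolding filterlim_at_top_dense
  proof
    fix Z
    obtain j where "j \<ge> 1" "log_sum j > Z" using unb by auto
    then have "log_sum n > Z" if "n \<ge> j" for n using log_sum_mono[of j n] that by simp
    then show "eventually (\<lambda>n. Z < log_sum n) sequentially" unfolding eventually_sequentially by auto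
  qed
qed

lemma K_seq_log_sum: "K_seq s j = ln (log_sum j)"
  unfolding K_seq_def log_sum_def ..

lemma f_over_s: "(\<lambda>j. f j / s j) \<longlonglongrightarrow> 0"
proof -
  have "(\<lambda>j. \<phi> (s j) / s j) \<longlonglongrightarrow> 0" by (rule filterlim_compose[OF phi(4) s(3)])
  moreover have "eventually (\<lambda>j. \<phi> (s j) / s j = f j / s j) sequentially"
    using eventually_ge_at_top[of 1] by eventually_elim (simp add: f)
  ultimately show ?thesis by (rule Lim_transform_eventually)
qed

text \<open>The m-th block collects the indices with \<open>log_sum\<close> between m \<eta> and (m
  + 1) \<eta>. On it K is at least ln (m \<eta>), and s varies by a factor below exp \<eta>, so one
  maximal inequality per block suffices and the probabilities are summable in m.\<close>

lemma upper_bound: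
  assumes eps: "0 < \<epsilon>" "\<epsilon> \<le> 1"
  shows "AE \<omega> in M. eventually (\<lambda>j. Y j \<omega> \<le> (1 + \<epsilon>) * (s j * K_seq s j)) sequentially"
proof -
  \<comment> \<open>Three factors 1 - \<eta> will be lost: in the maximal inequality, in comparing s
    at the two ends of a block, and in replacing s + f by s. The choice gives (1 - 3 \<eta>) (1 +
    \<epsilon>) = 1 + \<epsilon> / 2.\<close>
  define \<eta> where "\<eta> = \<epsilon> / (6 * (1 + \<epsilon>))"
  have eta: "0 < \<eta>" "\<eta> < 1 / 6" using eps unfolding \<eta>_def by (auto simp: field_simps)
  \<comment> \<open>Chosen so that th (1 + \<epsilon> / 2) = 1 + \<epsilon> / 4, an exponent still
    above 1 and hence summable.\<close>
  define th where "th = (1 + \<epsilon> / 4) / (1 + \<epsilon> / 2)"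
  have th: "0 < th" "th < 1" using eps unfolding th_def by (auto simp: field_simps)
  have thp: "th * (1 + \<epsilon> / 2) = 1 + \<epsilon> / 4" using eps unfolding th_def by simp
  have cube: "1 + \<epsilon> / 2 \<le> (1 - \<eta>) * (1 + \<epsilon>) * ((1 - \<eta>) * (1 - \<eta>))"
  proof -
    have "1 - 3 * \<eta> \<le> (1 - \<eta>) * ((1 - \<eta>) * (1 - \<eta>))"
    proof -
      have "(1 - \<eta>) * ((1 - \<eta>) * (1 - \<eta>)) = 1 - 3 * \<eta> + \<eta>\<^sup>2 * (3 - \<eta>)" by (simp add: power2_eq_square algebra_simps)
      moreover have "\<eta>\<^sup>2 * (3 - \<eta>) \<ge> 0" using eta by (intro mult_nonneg_nonneg) auto
      ultimately show ?thesis by simp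
    qed
    then have "(1 - 3 * \<eta>) * (1 + \<epsilon>) \<le> (1 - \<eta>) * ((1 - \<eta>) * (1 - \<eta>)) * (1 + \<epsilon>)" using eps by (intro mult_right_mono) auto
    moreover have "(1 - 3 * \<eta>) * (1 + \<epsilon>) = 1 + \<epsilon> / 2" unfolding \<eta>_def using eps by (simp add: field_simps)
    ultimately show ?thesis by (simp add: mult_ac)
  qed
  define E where "E m = {\<omega> \<in> space M. \<exists>j\<in>{j. 1 \<le> j \<and> real m * \<eta> \<le> log_sum j \<and> log_sum j < (real m + 1) * \<eta>}.
      (1 + \<epsilon>) * (s j * K_seq s j) \<le> Y j \<omega>}" for m
  define C where "C = 2 * (1 - th) powr (- a)"
  have small: "eventually (\<lambda>j. f j / s j < \<eta>) sequentially"
    using order_tendstoD(2)[OF f_over_s eta(1)] .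
  then obtain N where N: "\<And>j. j \<ge> N \<Longrightarrow> f j / s j < \<eta>" unfolding eventually_sequentially by blast
  have finB: "finite {j. 1 \<le> j \<and> log_sum j < b}" for b
  proof -
    obtain J where "\<And>j. j \<ge> J \<Longrightarrow> log_sum j > b"
      using log_sum_at_top unfolding filterlim_at_top_dense eventually_sequentially by blast
    then have "{j. 1 \<le> j \<and> log_sum j < b} \<subseteq> {..<J}" by (auto simp: not_less[symmetric]) (meson less_asym not_le)
    then show ?thesis using finite_subset by blast
  qed
  have Em: "E m \<in> sets M" for m
  proof -
    have "E m = (\<Union>j\<in>{j. 1 \<le> j \<and> real m * \<eta> \<le> log_sum j \<and> log_sum j < (real m + 1) * \<eta>}.
        {\<omega> \<in> space M. (1 + \<epsilon>) * (s j * K_seq s j) \<le> Y j \<omega>})" unfolding E_def by auto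
    moreover have "{\<omega> \<in> space M. (1 + \<epsilon>) * (s j * K_seq s j) \<le> Y j \<omega>} \<in> sets M" if "1 \<le> j" for j
    proof -
      have [measurable]: "Y j \<in> borel_measurable M" using that by simp
      show ?thesis by measurable
    qed
    ultimately show ?thesis by (auto intro!: sets.countable_UN')
  qed
  have bound: "eventually (\<lambda>m. prob (E m) \<le> C * (real m * \<eta>) powr (- (1 + \<epsilon> / 4))) sequentially"
  proof -
    \<comment> \<open>Beyond b the block lies past N, where f is below \<eta> s, and L = ln (m
      \<eta>) is at least 1 and large enough for the maximal inequality.\<close>
    define b where "b = max 1 (max (log_sum N) (exp (max 1 (4 * ln 2 / \<eta>\<^sup>2))))"
    have "filterlim (\<lambda>m. real m * \<eta>) at_top sequentially"
      using eta by (intro filterlim_at_top_mult_tendsto_pos[OF tendsto_const _ filterlim_real_sequentially]) (auto simp: mult.commute)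
    then have "eventually (\<lambda>m. real m * \<eta> > b) sequentially" unfolding filterlim_at_top_dense by blast
    then show ?thesis
    proof eventually_elim
      case (elim m)
      define L where "L = ln (real m * \<eta>)"
      have m1: "real m * \<eta> > 1" and mN: "real m * \<eta> > log_sum N" and mE: "real m * \<eta> > exp (max 1 (4 * ln 2 / \<eta>\<^sup>2))"
        using elim unfolding b_def by auto
      have "exp (max 1 (4 * ln 2 / \<eta>\<^sup>2)) < exp L" using mE m1 unfolding L_def by simp
      then have L: "1 \<le> L" "4 * ln 2 / \<eta>\<^sup>2 \<le> L" by auto
      then have L2: "4 * ln 2 \<le> \<eta>\<^sup>2 * L" using eta by (simp add: pos_divide_le_eq mult.commute)
      have expL: "exp (- th * ((1 + \<epsilon> / 2) * L)) = (real m * \<eta>) powr (- (1 + \<epsilon> / 4))"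
      proof -
        have "- th * ((1 + \<epsilon> / 2) * L) = - (th * (1 + \<epsilon> / 2)) * L" by simp
        then show ?thesis unfolding thp using m1 eta by (cases "m = 0") (auto simp: powr_def L_def)
      qed
      let ?B = "{j. 1 \<le> j \<and> real m * \<eta> \<le> log_sum j \<and> log_sum j < (real m + 1) * \<eta>}"
      \<comment> \<open>A single step of \<open>log_sum\<close> can exceed \<eta>, so a block may be
        empty.\<close>
      show ?case
      proof (cases "?B = {}")
        case True
        then have "E m = {}" unfolding E_def by blast
        then show ?thesis unfolding C_def by simp
      next
        case False
        have fin: "finite ?B" by (rule finite_subset[OF _ finB[of "(real m + 1) * \<eta>"]]) auto
        define i0 where "i0 = Min ?B"
        define n where "n = Max ?B"
        have i0: "i0 \<in> ?B" unfolding i0_def by (rule Min_in[OF fin False])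
        have n: "n \<in> ?B" unfolding n_def by (rule Max_in[OF fin False])
        have i0n: "i0 \<le> n" unfolding i0_def by (rule Min_le[OF fin n])
        have "N \<le> n"
        proof (rule ccontr)
          assume "\<not> N \<le> n"
          then have "log_sum n \<le> log_sum N" using n by (intro log_sum_mono) auto
          then show False using n mN by simp
        qed
        have sp: "s i0 > 0" "s n > 0" using s_pos i0 n by auto
        have fn: "f n \<le> \<eta> * s n" using N[OF \<open>N \<le> n\<close>] sp by (simp add: pos_divide_less_eq)
        have diff: "log_sum n - log_sum i0 < \<eta>" using i0 n by (auto simp: algebra_simps)
        have "ln (s n / s i0) < \<eta>" using log_sum_diff_ge[of i0 n] i0 i0n diff eta by auto
        then have "s n / s i0 < exp \<eta>" using sp by (metis divide_pos_pos exp_less_mono exp_ln)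
        also have eb: "exp \<eta> \<le> 1 / (1 - \<eta>)"
        proof -
          have "1 - \<eta> \<le> exp (- \<eta>)" using exp_ge_add_one_self[of "- \<eta>"] by simp
          then show ?thesis using eta by (simp add: exp_minus field_simps)
        qed
        finally have sn: "s n * (1 - \<eta>) \<le> s i0" using sp eta by (simp add: field_simps)
        \<comment> \<open>One level below all thresholds of the block, since s and K are at least
          \<open>s i0\<close> and L there.\<close>
        define x where "x = (1 + \<epsilon>) * (s i0 * L)"
        have x: "x > 0" unfolding x_def using eps sp L by simp
        have sub: "E m \<subseteq> {\<omega> \<in> space M. \<exists>j\<in>{i0..n}. x \<le> Y j \<omega>}"
        proof
          fix \<omega> assume "\<omega> \<in> E m"
          then obtain j where w: "\<omega> \<in> space M" and j: "j \<in> ?B" and Yj: "(1 + \<epsilon>) * (s j * K_seq s j) \<le> Y j \<omega>" unfolding E_def by blast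
          have ij: "i0 \<le> j" "j \<le> n" unfolding i0_def n_def using fin j by auto
          have "L \<le> K_seq s j" unfolding K_seq_log_sum L_def using j m1 by auto
          then have "s i0 * L \<le> s j * K_seq s j" using ij i0 L sp by (intro mult_mono s_le) (auto intro: less_imp_le[OF s_pos])
          then have "x \<le> (1 + \<epsilon>) * (s j * K_seq s j)" unfolding x_def using eps by (intro mult_left_mono) auto
          then have "x \<le> Y j \<omega>" using Yj by linarith
          then show "\<omega> \<in> {\<omega> \<in> space M. \<exists>j\<in>{i0..n}. x \<le> Y j \<omega>}"
            using w ij by (intro CollectI conjI bexI[of _ j]) auto
        qed
        \<comment> \<open>As \<eta> < 1/2, the increment of s across the block is at most
          \<open>s i0\<close>, which reduces the condition to 4 ln 2 \<le> \<eta>^2 L.\<close>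
        have D: "4 * ln 2 * (s n - s i0) \<le> \<eta>\<^sup>2 * x"
        proof -
          have "s n * (1 / 2) \<le> s n * (1 - \<eta>)" using eta sp by (intro mult_left_mono) auto
          then have "s n - s i0 \<le> s i0" using sn by simp
          then have "4 * ln 2 * (s n - s i0) \<le> 4 * ln 2 * s i0" by (intro mult_left_mono) auto
          also have "\<dots> \<le> \<eta>\<^sup>2 * L * s i0" using L2 sp by (intro mult_right_mono) auto
          also have "\<dots> \<le> (1 + \<epsilon>) * (\<eta>\<^sup>2 * L * s i0)" using eps L sp mult_right_mono[of 1 "1 + \<epsilon>" "\<eta>\<^sup>2 * L * s i0"] by simp
          finally show ?thesis unfolding x_def by (simp add: mult_ac)
        qed
        have sfn: "s n + f n > 0" using sp f_nonneg[of n] n by auto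
        have low: "((1 + \<epsilon> / 2) * L) * (s n + f n) \<le> (1 - \<eta>) * x"
        proof -
          have "(s n + f n) * (1 - \<eta>) \<le> (s n * (1 + \<eta>)) * (1 - \<eta>)" using fn eta by (intro mult_right_mono) (auto simp: algebra_simps)
          also have "\<dots> = s n * (1 - \<eta>\<^sup>2)" by (simp add: power2_eq_square algebra_simps)
          also have "\<dots> \<le> s n" using sp by (simp add: mult_left_le)
          finally have "(s n + f n) * (1 - \<eta>) * (1 - \<eta>) \<le> s n * (1 - \<eta>)" using eta by (intro mult_right_mono) auto
          also have "\<dots> \<le> s i0" by (rule sn)
          finally have q: "(s n + f n) * ((1 - \<eta>) * (1 - \<eta>)) \<le> s i0" by (simp add: mult.assoc)
          have "((1 + \<epsilon> / 2) * L) * (s n + f n) \<le> ((1 - \<eta>) * (1 + \<epsilon>) * ((1 - \<eta>) * (1 - \<eta>)) * L) * (s n + f n)"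
            using cube L sfn by (intro mult_right_mono) auto
          also have "\<dots> = (1 - \<eta>) * (1 + \<epsilon>) * L * ((s n + f n) * ((1 - \<eta>) * (1 - \<eta>)))" by (simp add: mult_ac)
          also have "\<dots> \<le> (1 - \<eta>) * (1 + \<epsilon>) * L * s i0" using q eta eps L by (intro mult_left_mono) auto
          finally show ?thesis unfolding x_def by (simp add: mult_ac)
        qed
        have [measurable]: "Y n \<in> borel_measurable M" using n by auto
        have meas: "{\<omega> \<in> space M. \<exists>j\<in>{i0..n}. x \<le> Y j \<omega>} \<in> sets M"
        proof (intro sets.sets_Collect_finite_Ex)
          fix j assume "j \<in> {i0..n}"
          then have [measurable]: "Y j \<in> borel_measurable M" using i0 by auto
          show "{\<omega> \<in> space M. x \<le> Y j \<omega>} \<in> sets M" by measurable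
        qed simp
        have "prob (E m) \<le> prob {\<omega> \<in> space M. \<exists>j\<in>{i0..n}. x \<le> Y j \<omega>}"
          by (rule finite_measure_mono[OF sub meas])
        also have "\<dots> \<le> 2 * prob {\<omega> \<in> space M. (1 - \<eta>) * x \<le> Y n \<omega>}"
          by (rule maximal_inequality[OF _ i0n eta(1) _ x D]) (use i0 eta in auto)
        also have "prob {\<omega> \<in> space M. (1 - \<eta>) * x \<le> Y n \<omega>} \<le> prob {\<omega> \<in> space M. ((1 + \<epsilon> / 2) * L) * (s n + f n) \<le> Y n \<omega>}"
          by (rule finite_measure_mono) (use low in auto)
        also have "\<dots> \<le> (1 - th) powr (- a) * exp (- th * ((1 + \<epsilon> / 2) * L))"
          using permanental_chernoff[OF prob_space_axioms a Y _ sfn th, of "(1 + \<epsilon> / 2) * L"] n by (simp add: emeasure_eq_measure)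
        finally show ?thesis unfolding C_def expL by simp
      qed
    qed
  qed
  have "summable (\<lambda>m. prob (E m))"
  proof (rule summable_comparison_test_ev)
    show "eventually (\<lambda>m. norm (prob (E m)) \<le> C * (real m * \<eta>) powr (- (1 + \<epsilon> / 4))) sequentially"
      using bound by eventually_elim simp
    have "summable (\<lambda>m. real m powr (- (1 + \<epsilon> / 4)))" using eps by (subst summable_real_powr_iff) auto
    then have "summable (\<lambda>m. (C * \<eta> powr (- (1 + \<epsilon> / 4))) * real m powr (- (1 + \<epsilon> / 4)))" by (rule summable_mult)
    then show "summable (\<lambda>m. C * (real m * \<eta>) powr (- (1 + \<epsilon> / 4)))"
      using eta by (simp add: powr_mult mult_ac)
  qed
  then have "AE \<omega> in M. eventually (\<lambda>m. \<omega> \<in> space M - E m) sequentially"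
    by (intro borel_cantelli_AE1 Em) (auto simp: less_top[symmetric])
  then show ?thesis
  proof eventually_elim
    case (elim \<omega>)
    then obtain m0 where m0: "\<And>m. m \<ge> m0 \<Longrightarrow> \<omega> \<in> space M - E m" unfolding eventually_sequentially by blast
    have "eventually (\<lambda>j. log_sum j > real m0 * \<eta>) sequentially"
      using log_sum_at_top unfolding filterlim_at_top_dense by blast
    then show ?case using eventually_ge_at_top[of 1]
    proof eventually_elim
      case (elim j)
      define m where "m = nat \<lfloor>log_sum j / \<eta>\<rfloor>"
      have q: "real m0 < log_sum j / \<eta>" using elim eta by (simp add: pos_less_divide_eq)
      have q0: "0 \<le> log_sum j / \<eta>" using q of_nat_0_le_iff[of m0] by linarith
      have "real m = of_int \<lfloor>log_sum j / \<eta>\<rfloor>" unfolding m_def using q0 by simp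
      then have "real m \<le> log_sum j / \<eta>" "log_sum j / \<eta> < real m + 1" by linarith+
      then have jm: "real m * \<eta> \<le> log_sum j" "log_sum j < (real m + 1) * \<eta>" using eta by (auto simp: pos_le_divide_eq pos_divide_less_eq)
      have "m0 \<le> m" unfolding m_def using q by (simp add: le_nat_floor)
      then have "\<omega> \<in> space M" "\<omega> \<notin> E m" using m0 by auto
      then have "\<not> (1 + \<epsilon>) * (s j * K_seq s j) \<le> Y j \<omega>" unfolding E_def using jm elim by blast
      then show ?case by simp
    qed
  qed
qed

section \<open>Lower bound along a sparse subsequence\<close>

text \<open>Induction on q removes the last coordinate: whatever the past, it stays below its level
  with at most the gamma probability for its own increment. The bound is the one for independent
  gamma variables. As p \<ge> 1, each coordinate in the range has a predecessor.\<close>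

lemma orthant_bound:
  fixes idx :: "nat \<Rightarrow> nat" and c :: "nat \<Rightarrow> real" and q :: nat
  assumes idx: "strict_mono idx" "idx 0 \<ge> 1" and p: "p \<ge> 1"
  shows "emeasure M {\<omega> \<in> space M. \<forall>m\<in>{p..<p + q}. Y (idx m) \<omega> \<le> c m} \<le>
    (\<Prod>m\<in>{p..<p + q}. gamma_cdf a (s (idx m) - s (idx (m - 1))) (c m))"
proof (induction q)
  case 0
  have "emeasure M {\<omega> \<in> space M. \<forall>m\<in>{p..<p + 0}. Y (idx m) \<omega> \<le> c m} \<le> 1" by (rule emeasure_le_1)
  then show ?case by simp
next
  case (Suc q)
  have idx1: "idx m \<ge> 1" for m using idx strict_mono_less_eq[OF idx(1), of 0 m] by (meson le0 order_trans)
  have Yi [measurable]: "Y (idx m) \<in> borel_measurable M" for m using idx1 by simp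
  define k where "k = p + q - 1"
  have k: "Suc k = p + q" using p by (simp add: k_def)
  define d where "d = s (idx (Suc k)) - s (idx k)"
  have d: "d > 0" unfolding d_def using s_less[OF idx1] strict_monoD[OF idx(1), of k "Suc k"] by simp
  \<comment> \<open>The coordinates before p belong to the chain but are left unconstrained.\<close>
  define gg :: "nat \<Rightarrow> real \<Rightarrow> ennreal" where "gg m = (if p \<le> m then indicator {..c m} else (\<lambda>_. 1))" for m
  let ?A = "{\<omega> \<in> space M. \<forall>m\<in>{p..<p + q}. Y (idx m) \<omega> \<le> c m}"
  let ?A' = "{\<omega> \<in> space M. \<forall>m\<in>{p..<p + Suc q}. Y (idx m) \<omega> \<le> c m}"
  have Am [measurable]: "?A \<in> sets M" "?A' \<in> sets M" by measurable
  have ind: "(\<Prod>m\<le>k. gg m (Y (idx m) \<omega>)) = indicator ?A \<omega>" if "\<omega> \<in> space M" for \<omega>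
  proof -
    have "(\<Prod>m\<le>k. gg m (Y (idx m) \<omega>)) = (\<Prod>m\<le>k. if m \<in> {p..<p + q} then indicator {..c m} (Y (idx m) \<omega>) else 1)"
      using k by (intro prod.cong) (auto simp: gg_def)
    also have "\<dots> = (\<Prod>m\<in>{..k} \<inter> {p..<p + q}. indicator {..c m} (Y (idx m) \<omega>))"
      by (rule prod.inter_restrict[symmetric]) simp
    also have "{..k} \<inter> {p..<p + q} = {p..<p + q}" using k by auto
    also have "(\<Prod>m\<in>{p..<p + q}. indicator {..c m} (Y (idx m) \<omega>) :: ennreal) = (if \<forall>m\<in>{p..<p + q}. Y (idx m) \<omega> \<le> c m then 1 else 0)"
      by (auto simp: indicator_def intro!: prod.neutral)
    finally show ?thesis using that by (auto simp: indicator_def)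
  qed
  have "emeasure M ?A' = (\<integral>\<^sup>+\<omega>. indicator ?A' \<omega> \<partial>M)" by simp
  also have "\<dots> = (\<integral>\<^sup>+\<omega>. (\<Prod>m\<le>k. gg m (Y (idx m) \<omega>)) * indicator {..c (Suc k)} (Y (idx (Suc k)) \<omega>) \<partial>M)"
  proof (rule nn_integral_cong)
    fix \<omega> assume w: "\<omega> \<in> space M"
    have "{p..<p + Suc q} = insert (Suc k) {p..<p + q}" using k by auto
    then show "indicator ?A' \<omega> = (\<Prod>m\<le>k. gg m (Y (idx m) \<omega>)) * (indicator {..c (Suc k)} (Y (idx (Suc k)) \<omega>) :: ennreal)"
      unfolding ind[OF w] using w by (auto simp: indicator_def)
  qed
  also have "\<dots> \<le> gamma_cdf a d (c (Suc k)) * (\<integral>\<^sup>+\<omega>. (\<Prod>m\<le>k. gg m (Y (idx m) \<omega>)) * 1 \<partial>M)"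
  proof (rule comparison[OF _ idx, where G = "indicator {..c (Suc k)}" and H = "\<lambda>_. 1"])
    show "gg m \<in> borel_measurable borel" for m unfolding gg_def by auto
    show "gg m z \<le> 1" for m z unfolding gg_def by (auto simp: indicator_def)
    show "indicator {..c (Suc k)} z \<le> (1 :: ennreal)" for z by (auto simp: indicator_def)
    show "(\<integral>\<^sup>+z. bessel_kernel (s (idx (Suc k)) - s (idx k)) b y z * indicator {..c (Suc k)} z \<partial>lborel) \<le> gamma_cdf a d (c (Suc k)) * 1"
      if "a \<le> b" for b y
      using bessel_kernel_cdf_le[OF a that d] unfolding d_def by simp
  qed (auto simp: f)
  also have "(\<integral>\<^sup>+\<omega>. (\<Prod>m\<le>k. gg m (Y (idx m) \<omega>)) * 1 \<partial>M) = (\<integral>\<^sup>+\<omega>. indicator ?A \<omega> \<partial>M)"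
    by (intro nn_integral_cong) (simp add: ind)
  also have "\<dots> = emeasure M ?A" by simp
  also have "gamma_cdf a d (c (Suc k)) * emeasure M ?A \<le> gamma_cdf a d (c (Suc k)) *
     (\<Prod>m\<in>{p..<p + q}. gamma_cdf a (s (idx m) - s (idx (m - 1))) (c m))"
    by (intro mult_left_mono Suc) simp
  also have "\<dots> = (\<Prod>m\<in>{p..<p + Suc q}. gamma_cdf a (s (idx m) - s (idx (m - 1))) (c m))"
    using k by (simp add: prod.atLeastLessThan_Suc mult.commute d_def[symmetric]) (simp add: d_def k[symmetric])
  finally show ?case .
qed

text \<open>Greedy choice: the next index is the first at which s has grown by the factor R. Up to
  the index just before it, \<open>log_sum\<close> gains at most ln R; the final step may be an
  enormous jump of s, but the truncation at 1 limits its contribution to 1.\<close>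

lemma sparse_indices:
  assumes R: "R > 1"
  obtains idx where "strict_mono idx" "idx 0 = 1" "\<And>k. R * s (idx k) \<le> s (idx (Suc k))"
    "\<And>k. log_sum (idx k) \<le> real k * (ln R + 1)"
proof -
  define nxt where "nxt i = (LEAST j. i < j \<and> R * s i \<le> s j)" for i
  define idx where "idx k = (nxt ^^ k) 1" for k
  have ex: "\<exists>j. i < j \<and> R * s i \<le> s j" for i
  proof -
    have "eventually (\<lambda>j. R * s i \<le> s j) sequentially" using s(3) unfolding filterlim_at_top by blast
    then obtain J where "\<And>j. j \<ge> J \<Longrightarrow> R * s i \<le> s j" unfolding eventually_sequentially by blast
    then show ?thesis by (intro exI[of _ "max J (Suc i)"]) auto
  qed
  have nx: "i < nxt i" "R * s i \<le> s (nxt i)" for i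
    using LeastI_ex[OF ex[of i]] unfolding nxt_def by auto
  have nl: "s j < R * s i" if "i < j" "j < nxt i" for i j
    using not_less_Least[of j "\<lambda>j. i < j \<and> R * s i \<le> s j"] that unfolding nxt_def[symmetric] by auto
  have S: "idx (Suc k) = nxt (idx k)" for k unfolding idx_def by simp
  have i0: "idx 0 = 1" unfolding idx_def by simp
  have sm: "strict_mono idx" unfolding strict_mono_Suc_iff S using nx by auto
  have idx1: "idx k \<ge> 1" for k using i0 strict_mono_less_eq[OF sm, of 0 k] by simp
  have step: "log_sum (idx (Suc k)) \<le> log_sum (idx k) + (ln R + 1)" for k
  proof -
    define l where "l = idx (Suc k) - 1"
    have l: "idx k \<le> l" "Suc l = idx (Suc k)" "1 \<le> l" using nx(1)[of "idx k"] idx1[of k] by (auto simp: l_def S)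
    have "log_sum (idx (Suc k)) \<le> log_sum l + 1" unfolding l(2)[symmetric] log_sum_Suc[OF l(3)] by simp
    moreover have "log_sum l - log_sum (idx k) \<le> ln R"
    proof -
      have "s l \<le> R * s (idx k)"
      proof (cases "idx k = l")
        case True
        then show ?thesis using R s_pos[OF l(3)] by simp
      next
        case False
        then show ?thesis using nl[of "idx k" l] l S[of k] by auto
      qed
      then have "s l / s (idx k) \<le> R" using s_pos[OF idx1[of k]] by (simp add: pos_divide_le_eq)
      then have "ln (s l / s (idx k)) \<le> ln R" using s_pos[OF idx1[of k]] s_pos[OF l(3)] R by simp
      then show ?thesis using log_sum_diff_le[OF idx1 l(1)] by linarith
    qed
    ultimately show ?thesis by simp
  qed
  have "log_sum (idx k) \<le> real k * (ln R + 1)" for k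
  proof (induction k)
    case 0 then show ?case by (simp add: i0 log_sum_def)
  next
    case (Suc k) then show ?case using step[of k] by (simp add: algebra_simps)
  qed
  then show ?thesis using that[OF sm i0] nx(2) S by simp
qed

text \<open>The m-th sparse coordinate exceeds its level with conditional probability at least a
  constant times 1 / m. The harmonic series diverges, so the probability of never exceeding after a
  given index is 0.\<close>

lemma lower_bound:
  assumes eps: "0 < \<epsilon>" "\<epsilon> < 1"
  shows "AE \<omega> in M. \<exists>\<^sub>F j in sequentially. (1 - \<epsilon>) * (s j * K_seq s j) < Y j \<omega>"
proof -
  \<comment> \<open>With this R the previous point is at most \<epsilon> / 2 times the current one,
    so the increment d is at least (1 - \<epsilon> / 2) * s (idx m).\<close>
  define R where "R = 2 / \<epsilon>"
  have R: "R > 1" using eps unfolding R_def by simp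
  obtain idx where idx: "strict_mono idx" "idx 0 = 1" "\<And>k. R * s (idx k) \<le> s (idx (Suc k))"
    "\<And>k. log_sum (idx k) \<le> real k * (ln R + 1)"
    using sparse_indices[OF R] by blast
  have idx1: "idx k \<ge> 1" for k using idx strict_mono_less_eq[OF idx(1), of 0 k] by simp
  have Yi [measurable]: "Y (idx m) \<in> borel_measurable M" for m using idx1 by simp
  define C where "C = ln R + 1"
  have C: "C > 1" unfolding C_def using R by simp
  \<comment> \<open>C bounds the gain of \<open>log_sum\<close> per sparse step, so ln (C k)
    dominates K at \<open>idx k\<close>. Exceeding this explicit, larger level is enough.\<close>
  define c where "c k = (1 - \<epsilon>) * (s (idx k) * ln (C * real k))" for k
  define \<kappa> where "\<kappa> = min 1 (\<epsilon> / 2) * exp (- 1) / Gamma a"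
  have kap: "\<kappa> > 0" unfolding \<kappa>_def using eps Gamma_real_pos[OF a] by simp
  define u where "u m = gamma_cdf a (s (idx m) - s (idx (m - 1))) (c m)" for m
  have "filterlim (\<lambda>k. (1 - \<epsilon>) * ln (C * real k)) at_top sequentially"
  proof (rule filterlim_tendsto_pos_mult_at_top[OF tendsto_const])
    show "filterlim (\<lambda>k. ln (C * real k)) at_top sequentially"
      by (rule filterlim_compose[OF ln_at_top], rule filterlim_tendsto_pos_mult_at_top[OF tendsto_const _ filterlim_real_sequentially]) (use C in simp)
  qed (use eps in simp)
  \<comment> \<open>From p0 on the level c m is at least s (idx m), hence at least d, as the gamma
    tail estimate requires.\<close>
  then obtain p0 where p0: "\<And>k. k \<ge> p0 \<Longrightarrow> (1 - \<epsilon>) * ln (C * real k) \<ge> 1"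
    unfolding filterlim_at_top eventually_sequentially by blast
  have ub: "u m \<le> ennreal (exp (- (\<kappa> / C) * (1 / real m)))" if m: "m \<ge> max 1 p0" for m
  proof -
    define d where "d = s (idx m) - s (idx (m - 1))"
    have m1: "m = Suc (m - 1)" using m by simp
    have sm: "s (idx m) > 0" "s (idx (m - 1)) > 0" using s_pos idx1 by auto
    have "R * s (idx (m - 1)) \<le> s (idx m)" using idx(3)[of "m - 1"] m1 by simp
    then have "s (idx (m - 1)) \<le> (\<epsilon> / 2) * s (idx m)" using eps unfolding R_def by (simp add: field_simps)
    then have dl: "d \<ge> (1 - \<epsilon> / 2) * s (idx m)" unfolding d_def by (simp add: algebra_simps)
    have "(1 - \<epsilon> / 2) * s (idx m) > 0" using eps sm by simp
    then have d: "d > 0" using dl by linarith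
    have L: "ln (C * real m) > 0"
    proof (rule ccontr)
      assume "\<not> ln (C * real m) > 0"
      then have "(1 - \<epsilon>) * ln (C * real m) \<le> 0" using eps by (intro mult_nonneg_nonpos) auto
      then show False using p0[of m] m by simp
    qed
    have cd: "c m \<ge> d"
    proof -
      have "d \<le> s (idx m) * 1" unfolding d_def using sm by simp
      also have "\<dots> \<le> s (idx m) * ((1 - \<epsilon>) * ln (C * real m))" using p0[of m] m sm by (intro mult_left_mono) auto
      finally show ?thesis unfolding c_def by (simp add: mult_ac)
    qed
    \<comment> \<open>The loss 1 + \<epsilon> / 2 of the tail estimate and the loss 1 - \<epsilon> /
      2 in d are both covered by the factor 1 - \<epsilon> in c. The tail is then at least \<kappa>
      / (C m).\<close>
    have expo: "(1 + \<epsilon> / 2) * (c m / d) \<le> ln (C * real m)"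
    proof -
      have e2: "(1 + \<epsilon> / 2) * (1 - \<epsilon>) \<le> 1 - \<epsilon> / 2" using eps by (simp add: algebra_simps)
      have "(1 + \<epsilon> / 2) * c m = ((1 + \<epsilon> / 2) * (1 - \<epsilon>)) * (s (idx m) * ln (C * real m))" unfolding c_def by (simp add: mult_ac)
      also have "\<dots> \<le> (1 - \<epsilon> / 2) * (s (idx m) * ln (C * real m))" using e2 L sm by (intro mult_right_mono) auto
      also have "\<dots> = ((1 - \<epsilon> / 2) * s (idx m)) * ln (C * real m)" by simp
      also have "\<dots> \<le> d * ln (C * real m)" using dl L by (intro mult_right_mono) auto
      finally show ?thesis using d by (simp add: pos_divide_le_eq mult.commute)
    qed
    let ?t = "\<integral>\<^sup>+z. ennreal (gamma_dens a d z) * indicator {c m<..} z \<partial>lborel"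
    have Cm: "C * real m > 0" using C m by simp
    have "\<kappa> / C * (1 / real m) = \<kappa> * exp (- ln (C * real m))" using Cm by (simp add: exp_minus inverse_eq_divide)
    also have "\<dots> \<le> \<kappa> * exp (- (1 + \<epsilon> / 2) * (c m / d))"     proof -
      have "- ln (C * real m) \<le> - (1 + \<epsilon> / 2) * (c m / d)" using expo by (simp only: mult_minus_left neg_le_iff_le)
      then show ?thesis using kap by (intro mult_left_mono) auto
    qed
    finally have "ennreal (\<kappa> / C * (1 / real m)) \<le> ennreal (\<kappa> * exp (- (1 + \<epsilon> / 2) * (c m / d)))" by (rule ennreal_leI)
    also have "\<dots> \<le> ?t" using gamma_tail_lower[OF a d _ cd, of "\<epsilon> / 2"] eps unfolding \<kappa>_def by simp
    finally have t: "ennreal (\<kappa> / C * (1 / real m)) \<le> ?t" .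
    have q0: "\<kappa> / C * (1 / real m) \<ge> 0" using kap C by simp
    have "u m + ennreal (\<kappa> / C * (1 / real m)) \<le> u m + ?t" using t by (rule add_left_mono)
    also have "\<dots> = 1" unfolding u_def d_def[symmetric] by (rule gamma_cdf_compl[OF a d])
    finally have le: "u m + ennreal (\<kappa> / C * (1 / real m)) \<le> 1" .
    have "u m \<le> 1" using le by (meson le_iff_add order_trans)
    then obtain r where r: "u m = ennreal r" "r \<ge> 0" by (cases "u m") (auto simp: top_unique)
    have "ennreal (r + \<kappa> / C * (1 / real m)) \<le> ennreal 1" using le q0 r by (simp add: ennreal_plus)
    then have "r + \<kappa> / C * (1 / real m) \<le> 1" using ennreal_le_iff by fastforce
    \<comment> \<open>By 1 - y \<le> exp (- y) the product over m becomes the exponential of a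
      harmonic sum.\<close>
    also have "1 \<le> exp (- (\<kappa> / C) * (1 / real m)) + \<kappa> / C * (1 / real m)" using exp_ge_add_one_self[of "- (\<kappa> / C) * (1 / real m)"] by simp
    finally show ?thesis unfolding r(1) by (intro ennreal_leI) simp
  qed
  have null: "AE \<omega> in M. \<exists>m\<ge>p. c m < Y (idx m) \<omega>" if p: "p \<ge> max 1 p0" for p
  proof -
    let ?N = "{\<omega> \<in> space M. \<forall>m\<in>{p..}. Y (idx m) \<omega> \<le> c m}"
    have Nm: "?N \<in> sets M" by measurable
    have le: "prob ?N \<le> exp (- (\<kappa> / C) * (\<Sum>m\<in>{p..<p + q}. 1 / real m))" for q
    proof -
      have "emeasure M ?N \<le> emeasure M {\<omega> \<in> space M. \<forall>m\<in>{p..<p + q}. Y (idx m) \<omega> \<le> c m}"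
        by (rule emeasure_mono) auto
      also have "\<dots> \<le> (\<Prod>m\<in>{p..<p + q}. u m)"
        unfolding u_def by (rule orthant_bound) (use idx p in auto)
      also have "\<dots> \<le> (\<Prod>m\<in>{p..<p + q}. ennreal (exp (- (\<kappa> / C) * (1 / real m))))"
        by (rule prod_mono_ennreal) (use ub p in auto)
      also have "\<dots> = ennreal (\<Prod>m\<in>{p..<p + q}. exp (- (\<kappa> / C) * (1 / real m)))"
        by (rule prod_ennreal) simp
      also have "(\<Prod>m\<in>{p..<p + q}. exp (- (\<kappa> / C) * (1 / real m))) = exp (- (\<kappa> / C) * (\<Sum>m\<in>{p..<p + q}. 1 / real m))"
        by (subst exp_sum[symmetric]) (auto simp: sum_distrib_left)
      finally show ?thesis by (simp add: emeasure_eq_measure)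
    qed
    have "filterlim (\<lambda>q. (\<Sum>m\<in>{p..<p + q}. 1 / real m)) at_top sequentially"
      unfolding filterlim_at_top
    proof
      fix Z :: real
      have "\<not> summable (\<lambda>n. 1 / real (n + p))"
      proof
        assume "summable (\<lambda>n. 1 / real (n + p))"
        then have "summable (\<lambda>n. 1 / real n)" by (rule summable_iff_shift[THEN iffD1])
        then show False using not_summable_harmonic[where 'a = real] by (simp add: inverse_eq_divide)
      qed
      then have nb: "\<not> (\<forall>n. (\<Sum>i<n. 1 / real (i + p)) \<le> Z)"
        using bounded_imp_summable[of "\<lambda>n. 1 / real (n + p)" Z] by (metis (no_types, lifting) lessThan_Suc_atMost of_nat_0_le_iff zero_le_divide_1_iff)
      then obtain n where n: "(\<Sum>i<n. 1 / real (i + p)) > Z" by (auto simp: not_le)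
      have "Z \<le> (\<Sum>m\<in>{p..<p + q}. 1 / real m)" if "q \<ge> n" for q
      proof -
        have "(\<Sum>i<n. 1 / real (i + p)) \<le> (\<Sum>i<q. 1 / real (i + p))" using that by (intro sum_mono2) auto
        also have "\<dots> = (\<Sum>m\<in>{p..<p + q}. 1 / real m)"
          by (rule sum.reindex_bij_witness[where i = "\<lambda>m. m - p" and j = "\<lambda>i. i + p"]) auto
        finally show ?thesis using n by simp
      qed
      then show "eventually (\<lambda>q. Z \<le> (\<Sum>m\<in>{p..<p + q}. 1 / real m)) sequentially" unfolding eventually_sequentially by blast
    qed
    then have "filterlim (\<lambda>q. - ((\<kappa> / C) * (\<Sum>m\<in>{p..<p + q}. 1 / real m))) at_bot sequentially"
      unfolding filterlim_uminus_at_top[symmetric]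
      by (intro filterlim_tendsto_pos_mult_at_top[OF tendsto_const]) (use kap C in auto)
    then have "(\<lambda>q. exp (- ((\<kappa> / C) * (\<Sum>m\<in>{p..<p + q}. 1 / real m)))) \<longlonglongrightarrow> 0"
      by (rule filterlim_compose[OF exp_at_bot])
    then have "prob ?N \<le> 0" using le by (intro LIMSEQ_le_const) auto
    then have "emeasure M ?N = 0" by (simp add: emeasure_eq_measure measure_le_0_iff)
    then show ?thesis by (intro AE_I[OF _ _ Nm]) (auto simp: not_less)
  qed
  have "AE \<omega> in M. \<forall>p. p \<ge> max 1 p0 \<longrightarrow> (\<exists>m\<ge>p. c m < Y (idx m) \<omega>)"
    unfolding AE_all_countable using null by auto
  then show ?thesis
  proof eventually_elim
    case (elim \<omega>)
    obtain J where J: "\<And>j. j \<ge> J \<Longrightarrow> log_sum j > 0"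
      using log_sum_at_top unfolding filterlim_at_top_dense eventually_sequentially by blast
    show ?case unfolding frequently_sequentially
    proof
      fix N
      obtain m where m: "m \<ge> max (max 1 p0) (max N J)" "c m < Y (idx m) \<omega>"
        using elim[rule_format, of "max (max 1 p0) (max N J)"] by auto
      have im: "idx m \<ge> m" using idx(1) by (rule strict_mono_imp_increasing)
      have "log_sum (idx m) > 0" using J[of "idx m"] im m by simp
      then have "K_seq s (idx m) \<le> ln (C * real m)" unfolding K_seq_log_sum using idx(4)[of m] by (simp add: C_def mult.commute)
      then have "(1 - \<epsilon>) * (s (idx m) * K_seq s (idx m)) \<le> c m"
        unfolding c_def using eps s_pos[OF idx1[of m]] by (intro mult_left_mono) auto
      then have "(1 - \<epsilon>) * (s (idx m) * K_seq s (idx m)) < Y (idx m) \<omega>" using m by linarith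
      moreover have "idx m \<ge> N" using im m by simp
      ultimately show "\<exists>n\<ge>N. (1 - \<epsilon>) * (s n * K_seq s n) < Y n \<omega>" by blast
    qed
  qed
qed

lemma limsup_eq_1: "AE \<omega> in M. limsup (\<lambda>j. ereal (Y j \<omega> / (s j * K_seq s j))) = 1"
proof -
  \<comment> \<open>A countable sequence, so that the exceptional null sets can be united. It starts
    at 1/2 because the lower bound needs \<epsilon> < 1.\<close>
  define e where "e n = 1 / real (n + 2)" for n
  have e: "0 < e n" "e n < 1" "e n \<le> 1" for n unfolding e_def by auto
  have "AE \<omega> in M. \<forall>n. eventually (\<lambda>j. Y j \<omega> \<le> (1 + e n) * (s j * K_seq s j)) sequentially"
    unfolding AE_all_countable using upper_bound[OF e(1,3)] by blast
  moreover have "AE \<omega> in M. \<forall>n. \<exists>\<^sub>F j in sequentially. (1 - e n) * (s j * K_seq s j) < Y j \<omega>"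
    unfolding AE_all_countable using lower_bound[OF e(1,2)] by blast
  ultimately show ?thesis
  proof eventually_elim
    case (elim \<omega>)
    let ?X = "\<lambda>j. Y j \<omega> / (s j * K_seq s j)"
    \<comment> \<open>For small j the iterated logarithm may be negative or 0; only from here on do
      the bounds on Y transfer to the quotient.\<close>
    have "eventually (\<lambda>j. log_sum j > 1) sequentially" using log_sum_at_top unfolding filterlim_at_top_dense by blast
    then have pos: "eventually (\<lambda>j. s j * K_seq s j > 0) sequentially"
      using eventually_ge_at_top[of 1] by eventually_elim (simp add: K_seq_log_sum s_pos)
    have lim: "(\<lambda>n. e n) \<longlonglongrightarrow> 0"
      unfolding e_def using LIMSEQ_ignore_initial_segment[OF lim_1_over_n, of 2] by simp
    have up: "limsup (\<lambda>j. ereal (?X j)) \<le> ereal (1 + e n)" for n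
    proof (rule Limsup_bounded)
      show "eventually (\<lambda>j. ereal (?X j) \<le> ereal (1 + e n)) sequentially"
        using elim(1)[rule_format, of n] pos by eventually_elim (simp add: pos_divide_le_eq)
    qed
    have lo: "ereal (1 - e n) \<le> limsup (\<lambda>j. ereal (?X j))" for n
    proof (rule ccontr)
      assume "\<not> ereal (1 - e n) \<le> limsup (\<lambda>j. ereal (?X j))"
      then have "limsup (\<lambda>j. ereal (?X j)) < ereal (1 - e n)" by simp
      then have "eventually (\<lambda>j. ereal (?X j) < ereal (1 - e n)) sequentially" by (rule Limsup_lessD)
      then have "eventually (\<lambda>j. \<not> (1 - e n) * (s j * K_seq s j) < Y j \<omega>) sequentially"
        using pos by eventually_elim (simp add: pos_divide_less_eq)
      then show False using elim(2)[rule_format, of n] unfolding frequently_def by simp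
    qed
    have "(\<lambda>n. ereal (1 + e n)) \<longlonglongrightarrow> ereal (1 + 0)" "(\<lambda>n. ereal (1 - e n)) \<longlonglongrightarrow> ereal (1 - 0)"
      by (intro tendsto_intros lim)+
    then have "limsup (\<lambda>j. ereal (?X j)) \<le> ereal (1 + 0)" "ereal (1 - 0) \<le> limsup (\<lambda>j. ereal (?X j))"
      using up lo by (auto intro: LIMSEQ_le_const LIMSEQ_le_const2)
    then show ?case by (simp add: one_ereal_def antisym)
  qed
qed

end

section \<open>Excessive functions\<close>

text \<open>\<phi> extends Vh from the points s j to the half-line, as a nonnegative mixture of the
  functions min x (s k). Each of these is increasing, concave, bounded and 0 at 0.\<close>

lemma min_potential:
  fixes s h :: "nat \<Rightarrow> real"
  assumes s: "\<And>k. k \<ge> 1 \<Longrightarrow> s k > 0" and h: "h \<in> ell1_plus"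
  defines "\<phi> \<equiv> \<lambda>x. \<Sum>\<^sub>\<infinity>k\<in>{1..}. min x (s k) * h k"
  shows "mono_on {0..} \<phi>" "concave_on {0..} \<phi>" "((\<lambda>x. \<phi> x / x) \<longlongrightarrow> 0) at_top" "\<phi> 0 = 0"
proof -
  note [simp del] = One_nat_def
  have h0: "h k \<ge> 0" if "k \<ge> 1" for k using h that unfolding ell1_plus_def by auto
  have hs: "h summable_on {1..}" using h unfolding ell1_plus_def by auto
  have sm: "(\<lambda>k. min x (s k) * h k) summable_on {1..}" if "x \<ge> 0" for x
  proof (rule summable_on_comparison_test)
    show "(\<lambda>k. x * h k) summable_on {1..}" by (rule summable_on_cmult_right[OF hs])
    show "min x (s k) * h k \<le> x * h k" if "k \<in> {1..}" for k using h0[of k] that by (intro mult_right_mono) auto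
    show "0 \<le> min x (s k) * h k" if "k \<in> {1..}" for k using h0[of k] s[of k] that \<open>x \<ge> 0\<close> by (intro mult_nonneg_nonneg) auto
  qed
  show "mono_on {0..} \<phi>"
  proof (rule mono_onI)
    fix x y :: real assume "x \<in> {0..}" "y \<in> {0..}" "x \<le> y"
    then show "\<phi> x \<le> \<phi> y" unfolding \<phi>_def using h0 by (intro infsum_mono sm) (auto intro!: mult_right_mono)
  qed
  show "concave_on {0..} \<phi>"
    unfolding concave_on_iff
  proof (intro conjI ballI allI impI)
    fix x y u v :: real assume xy: "x \<in> {0..}" "y \<in> {0..}" and uv: "0 \<le> u" "0 \<le> v" "u + v = 1"
    have sx: "(\<lambda>k. u * (min x (s k) * h k)) summable_on {1..}" and sy: "(\<lambda>k. v * (min y (s k) * h k)) summable_on {1..}"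
      using xy by (auto intro!: summable_on_cmult_right[OF sm])
    have "u * \<phi> x + v * \<phi> y = (\<Sum>\<^sub>\<infinity>k\<in>{1..}. u * (min x (s k) * h k) + v * (min y (s k) * h k))"
      unfolding \<phi>_def infsum_add[OF sx sy] using xy by (simp add: infsum_cmult_right[OF sm])
    also have "\<dots> \<le> (\<Sum>\<^sub>\<infinity>k\<in>{1..}. min (u * x + v * y) (s k) * h k)"
    proof (rule infsum_mono[OF summable_on_add[OF sx sy] sm])
      show "0 \<le> u * x + v * y" using xy uv by (auto intro!: add_nonneg_nonneg mult_nonneg_nonneg)
      fix k :: nat assume k: "k \<in> {1..}"
      have "u * min x (s k) + v * min y (s k) \<le> u * x + v * y" using uv by (intro add_mono mult_left_mono) auto
      moreover have "u * min x (s k) + v * min y (s k) \<le> u * s k + v * s k" using uv by (intro add_mono mult_left_mono) auto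
      moreover have "u * s k + v * s k = s k" using uv(3) by (simp add: distrib_right[symmetric])
      ultimately have "u * min x (s k) + v * min y (s k) \<le> min (u * x + v * y) (s k)" by simp
      then have "(u * min x (s k) + v * min y (s k)) * h k \<le> min (u * x + v * y) (s k) * h k"
        using h0[of k] k by (intro mult_right_mono) auto
      then show "u * (min x (s k) * h k) + v * (min y (s k) * h k) \<le> min (u * x + v * y) (s k) * h k"
        by (simp add: algebra_simps)
    qed
    finally show "u * \<phi> x + v * \<phi> y \<le> \<phi> (u *\<^sub>R x + v *\<^sub>R y)" unfolding \<phi>_def by simp
  qed simp
  have "min 0 (s k) * h k = 0" if "k \<in> {1..}" for k using s[of k] that by simp
  then show "\<phi> 0 = 0" unfolding \<phi>_def by (intro infsum_0) auto
  have nn: "\<phi> x \<ge> 0" if "x \<ge> 0" for x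
    unfolding \<phi>_def using that h0 s by (intro infsum_nonneg mult_nonneg_nonneg) (auto intro: less_imp_le)
  show "((\<lambda>x. \<phi> x / x) \<longlongrightarrow> 0) at_top"
  proof (rule tendstoI)
    fix e :: real assume e: "e > 0"
    \<comment> \<open>Sublinearity: the terms of a finite set F stay bounded as x grows, while those
      outside F contribute at most x times the remaining mass of h, which is below e / 2.\<close>
    have "(sum h \<longlongrightarrow> infsum h {1..}) (finite_subsets_at_top {1..})"
      using has_sum_infsum[OF hs] unfolding has_sum_def .
    then have "eventually (\<lambda>F. dist (sum h F) (infsum h {1..}) < e / 2) (finite_subsets_at_top {1..})"
      by (rule tendstoD) (use e in simp)
    then obtain F where F: "finite F" "F \<subseteq> {1..}" "dist (sum h F) (infsum h {1..}) < e / 2"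
      unfolding eventually_finite_subsets_at_top by blast
    have hF: "h summable_on F" "h summable_on ({1..} - F)" using F hs by (auto intro: summable_on_subset_banach)
    have tail: "infsum h ({1..} - F) < e / 2"
    proof -
      have "infsum h {1..} = infsum h F + infsum h ({1..} - F)"
        using infsum_Un_disjoint[OF hF] F by (simp add: Un_absorb1)
      then show ?thesis using F by (simp add: dist_real_def)
    qed
    \<comment> \<open>B bounds the part of \<phi> coming from F, as min x (s k) \<le> s k.\<close>
    define B where "B = (\<Sum>k\<in>F. s k * h k)"
    have bound: "\<phi> x \<le> B + x * (e / 2)" if x: "x \<ge> 0" for x
    proof -
      have sF: "(\<lambda>k. min x (s k) * h k) summable_on F" "(\<lambda>k. min x (s k) * h k) summable_on ({1..} - F)"
        using F sm[OF x] by (auto intro: summable_on_subset_banach)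
      have "\<phi> x = infsum (\<lambda>k. min x (s k) * h k) F + infsum (\<lambda>k. min x (s k) * h k) ({1..} - F)"
        unfolding \<phi>_def using infsum_Un_disjoint[OF sF] F by (simp add: Un_absorb1)
      also have "infsum (\<lambda>k. min x (s k) * h k) F = (\<Sum>k\<in>F. min x (s k) * h k)" using F by simp
      also have "\<dots> \<le> B" unfolding B_def using F h0 by (intro sum_mono mult_right_mono) auto
      also have "infsum (\<lambda>k. min x (s k) * h k) ({1..} - F) \<le> infsum (\<lambda>k. x * h k) ({1..} - F)"
        using hF sF h0 by (intro infsum_mono summable_on_cmult_right) (auto intro!: mult_right_mono)
      also have "\<dots> = x * infsum h ({1..} - F)" by (simp add: infsum_cmult_right hF)
      also have "\<dots> \<le> x * (e / 2)" using tail x by (intro mult_left_mono) auto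
      finally show ?thesis by simp
    qed
    show "eventually (\<lambda>x. dist (\<phi> x / x) 0 < e) at_top"
      using eventually_gt_at_top[of "max 1 (2 * B / e)"]
    proof eventually_elim
      case (elim x)
      then have x: "x > 0" "2 * B / e < x" by auto
      then have "B < x * (e / 2)" using e by (simp add: field_simps)
      then have "\<phi> x < x * e" using bound[of x] x by simp
      then show ?case using nn[of x] x by (simp add: pos_divide_less_eq mult.commute)
    qed
  qed
qed

theorem theorem1p6:
  fixes s h f :: "nat \<Rightarrow> real" and M :: "'a measure"
  assumes "strict_mono_on {1..} s"
    and "s 1 > 0"
    and "filterlim s at_top sequentially"
    and "h \<in> ell1_plus"
    and "\<And>j. j \<ge> 1 \<Longrightarrow> f j = kernel_apply (min_kernel s) h j"
    and "prob_space M"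
  shows "(\<exists>g. mono_on {0..} g \<and> strictly_concave g \<and> (\<forall>j\<ge>1. f j = g (s j))) \<and>
    (\<forall>\<alpha>>0. \<forall>Y. permanental_sequence M \<alpha> (\<lambda>j k. min_kernel s j k + f k) Y \<longrightarrow>
       (AE \<omega> in M. limsup (\<lambda>j. ereal (Y j \<omega> / (s j * K_seq s j))) = 1))"
proof -
  have s0: "s k > 0" if "k \<ge> 1" for k
    using assms(1,2) that by (cases "k = 1") (auto simp: strict_mono_on_def intro: less_trans)
  \<comment> \<open>This function serves twice, as the witness for g and as the parameter of the
    locale.\<close>
  define \<phi> where "\<phi> = (\<lambda>x. \<Sum>\<^sub>\<infinity>k\<in>{1..}. min x (s k) * h k)"
  have phi: "mono_on {0..} \<phi>" "concave_on {0..} \<phi>" "((\<lambda>x. \<phi> x / x) \<longlongrightarrow> 0) at_top" "\<phi> 0 = 0"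
    unfolding \<phi>_def
    by (rule min_potential(1), erule s0, rule assms, rule min_potential(2), erule s0, rule assms,
        rule min_potential(3), erule s0, rule assms, rule min_potential(4), erule s0, rule assms)
  have f: "f j = \<phi> (s j)" if "j \<ge> 1" for j
    unfolding assms(5)[OF that] \<phi>_def kernel_apply_def min_kernel_def ..
  show ?thesis
  proof (intro conjI exI[of _ \<phi>] allI impI)
    fix \<alpha> :: real and Y
    assume "\<alpha> > 0" and Y: "permanental_sequence M \<alpha> (\<lambda>j k. min_kernel s j k + f k) Y"
    then interpret min_permanental M \<alpha> s f \<phi> Y
      using assms(1-3,6) f phi by (simp add: min_permanental_def min_permanental_axioms_def)
    show "AE \<omega> in M. limsup (\<lambda>j. ereal (Y j \<omega> / (s j * K_seq s j))) = 1" by (rule limsup_eq_1)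
  qed (use phi f in \<open>auto simp: strictly_concave_def\<close>)
qed

end
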